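(* Let $A_S$ be an Artin--Tits group of spherical type, and let $\alpha\in A_S$. Then there is a unique parabolic subgroup $P_\alpha$ of $A_S$ which is minimal (by inclusion) among all parabolic subgroups of $A_S$ containing $\alpha$.
   Context: Artin--Tits group: let $S$ be a finite set and for all distinct $s,t\in S$ let $m(s,t)=m(t,s)\in\{2,3,\dots\}\cup\{\infty\}$. The Artin--Tits group $A_S$ is the group generated by $S$ with one relation $sts\cdots=tst\cdots$ (both sides of length $m(s,t)$) for each pair $s\ne t$ with $m(s,t)<\infty$. The Coxeter group $W_S$ is the quotient of $A_S$ by the relations $s^2=1$, $s\in S$. $A_S$ is of spherical type if $W_S$ is finite. For $X\subseteq S$, $A_X$ denotes the subgroup of $A_S$ generated by $X$ (a standard parabolic subgroup). A parabolic subgroup of $A_S$ is a subgroup of the form $\beta A_X\beta^{-1}$ with $X\subseteq S$ and $\beta\in A_S$. *)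

theory Defs
  imports "HOL-Algebra.Generated_Groups" "HOL-Library.Extended_Nat"
begin

section \<open>Groups given by generators and relations\<close>

text \<open>The letter \<open>(s, True)\<close> stands for the generator \<open>s\<close>, and \<open>(s, False)\<close> for its inverse.\<close>

type_synonym 's word = "('s \<times> bool) list"

definition words :: "'s set \<Rightarrow> 's word set" where
  "words S = lists (S \<times> UNIV)"

inductive_set word_cong :: "'s set \<Rightarrow> ('s word \<times> 's word) set \<Rightarrow> ('s word \<times> 's word) set"
  for S :: "'s set" and R :: "('s word \<times> 's word) set" where
  refl: "w \<in> words S \<Longrightarrow> (w, w) \<in> word_cong S R"
| sym: "(u, v) \<in> word_cong S R \<Longrightarrow> (v, u) \<in> word_cong S R"
| trans: "(u, v) \<in> word_cong S R \<Longrightarrow> (v, w) \<in> word_cong S R \<Longrightarrow> (u, w) \<in> word_cong S R"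
| append: "(u, u') \<in> word_cong S R \<Longrightarrow> (v, v') \<in> word_cong S R \<Longrightarrow> (u @ v, u' @ v') \<in> word_cong S R"
| cancel: "s \<in> S \<Longrightarrow> ([(s, b), (s, \<not> b)], []) \<in> word_cong S R"
| relator: "(u, v) \<in> R \<Longrightarrow> u \<in> words S \<Longrightarrow> v \<in> words S \<Longrightarrow> (u, v) \<in> word_cong S R"

definition presented_group :: "'s set \<Rightarrow> ('s word \<times> 's word) set \<Rightarrow> 's word set monoid" where
  "presented_group S R =
    \<lparr>carrier = words S // word_cong S R,
     mult = (\<lambda>A B. \<Union>u\<in>A. \<Union>v\<in>B. word_cong S R `` {u @ v}),
     one = word_cong S R `` {[]}\<rparr>"

lemma word_cong_words: "(u, v) \<in> word_cong S R \<Longrightarrow> u \<in> words S \<and> v \<in> words S"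
  by (induction rule: word_cong.induct) (simp_all add: words_def)

lemma equiv_word_cong: "equiv (words S) (word_cong S R)"
proof (rule equivI)
  show "word_cong S R \<subseteq> words S \<times> words S"
    using word_cong_words by fast
  show "refl_on (words S) (word_cong S R)"
    by (simp add: refl_on_def word_cong.refl)
  show "sym (word_cong S R)"
    by (rule symI) (rule word_cong.sym)
  show "trans (word_cong S R)"
    by (rule transI) (rule word_cong.trans)
qed

lemma presented_group_mult:
  assumes "u \<in> words S" "v \<in> words S"
  shows "word_cong S R `` {u} \<otimes>\<^bsub>presented_group S R\<^esub> word_cong S R `` {v} = word_cong S R `` {u @ v}"
proof -
  have "congruent2 (word_cong S R) (word_cong S R) (\<lambda>u v. word_cong S R `` {u @ v})"
    by (intro congruent2I' equiv_class_eq[OF equiv_word_cong] word_cong.append)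
  then show ?thesis
    unfolding presented_group_def
    using UN_equiv_class2[OF equiv_word_cong equiv_word_cong _ assms] by simp
qed

lemma word_cong_inverse:
  assumes "w \<in> words S"
  shows "(rev (map (\<lambda>(s, b). (s, \<not> b)) w) @ w, []) \<in> word_cong S R"
  using assms
proof (induction w)
  case Nil
  then show ?case by (simp add: word_cong.refl words_def)
next
  case (Cons x w)
  obtain s b where x: "x = (s, b)" by fastforce
  let ?i = "rev (map (\<lambda>(s, b). (s, \<not> b)) w)"
  have s: "s \<in> S" and w: "w \<in> words S" using Cons.prems x by (auto simp: words_def)
  then have i: "?i \<in> words S" by (auto simp: words_def)
  have "([(s, \<not> b), (s, b)], []) \<in> word_cong S R"
    using word_cong.cancel[OF s, of "\<not> b" R] by simp
  then have "(?i @ [(s, \<not> b), (s, b)] @ w, ?i @ [] @ w) \<in> word_cong S R"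
    using i w by (intro word_cong.append word_cong.refl)
  then show ?case
    using word_cong.trans[OF _ Cons.IH[OF w]] x by simp
qed

lemma group_presented_group: "group (presented_group S R)" (is "group ?G")
proof -
  let ?c = "\<lambda>w. word_cong S R `` {w}"
  have carrI: "?c w \<in> carrier ?G" if "w \<in> words S" for w
    using that by (simp add: presented_group_def quotientI)
  have carrE: "\<exists>w\<in>words S. x = ?c w" if "x \<in> carrier ?G" for x
    using that unfolding presented_group_def by (simp add: quotient_def)
  have app: "u @ v \<in> words S" if "u \<in> words S" "v \<in> words S" for u v :: "'a word"
    using that by (simp add: words_def)
  have nil: "[] \<in> words S" by (simp add: words_def)
  have one: "\<one>\<^bsub>?G\<^esub> = ?c []" by (simp add: presented_group_def)
  show ?thesis
  proof (rule groupI)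
    show "\<one>\<^bsub>?G\<^esub> \<in> carrier ?G"
      unfolding one by (rule carrI[OF nil])
  next
    fix x y assume x: "x \<in> carrier ?G" and y: "y \<in> carrier ?G"
    obtain u where u: "u \<in> words S" "x = ?c u" using carrE[OF x] by (elim bexE)
    obtain v where v: "v \<in> words S" "y = ?c v" using carrE[OF y] by (elim bexE)
    show "x \<otimes>\<^bsub>?G\<^esub> y \<in> carrier ?G"
      unfolding u(2) v(2) presented_group_mult[OF u(1) v(1)] by (rule carrI[OF app[OF u(1) v(1)]])
  next
    fix x y z assume x: "x \<in> carrier ?G" and y: "y \<in> carrier ?G" and z: "z \<in> carrier ?G"
    obtain u where u: "u \<in> words S" "x = ?c u" using carrE[OF x] by (elim bexE)
    obtain v where v: "v \<in> words S" "y = ?c v" using carrE[OF y] by (elim bexE)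
    obtain w where w: "w \<in> words S" "z = ?c w" using carrE[OF z] by (elim bexE)
    show "x \<otimes>\<^bsub>?G\<^esub> y \<otimes>\<^bsub>?G\<^esub> z = x \<otimes>\<^bsub>?G\<^esub> (y \<otimes>\<^bsub>?G\<^esub> z)"
      unfolding u(2) v(2) w(2) using u(1) v(1) w(1)
      by (simp only: presented_group_mult app append_assoc)
  next
    fix x assume x: "x \<in> carrier ?G"
    obtain u where u: "u \<in> words S" "x = ?c u" using carrE[OF x] by (elim bexE)
    show "\<one>\<^bsub>?G\<^esub> \<otimes>\<^bsub>?G\<^esub> x = x"
      unfolding one u(2) presented_group_mult[OF nil u(1)] by (simp only: append_Nil)
  next
    fix x assume x: "x \<in> carrier ?G"
    obtain w where w: "w \<in> words S" "x = ?c w" using carrE[OF x] by (elim bexE)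
    define i where "i = rev (map (\<lambda>(s, b). (s, \<not> b)) w)"
    have i: "i \<in> words S" and "(i @ w, []) \<in> word_cong S R"
      using word_cong_inverse[OF w(1), of R] w(1) by (auto simp: i_def words_def)
    then have "?c i \<otimes>\<^bsub>?G\<^esub> x = \<one>\<^bsub>?G\<^esub>"
      unfolding one w(2) presented_group_mult[OF i w(1)]
      by (intro equiv_class_eq[OF equiv_word_cong])
    then show "\<exists>y\<in>carrier ?G. y \<otimes>\<^bsub>?G\<^esub> x = \<one>\<^bsub>?G\<^esub>"
      using carrI[OF i] by (rule bexI)
  qed
qed


section \<open>Artin--Tits groups and Coxeter groups\<close>

text \<open>Only the values \<open>m s t\<close> for distinct \<open>s, t \<in> S\<close> matter.\<close>

definition coxeter_data :: "'s set \<Rightarrow> ('s \<Rightarrow> 's \<Rightarrow> enat) \<Rightarrow> bool" where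
  "coxeter_data S m \<longleftrightarrow>
    finite S \<and> (\<forall>s\<in>S. \<forall>t\<in>S. s \<noteq> t \<longrightarrow> m s t = m t s \<and> 2 \<le> m s t)"

text \<open>\<open>alt_word n s t\<close> is the positive word \<open>s t s \<dots>\<close> of length \<open>n\<close>.\<close>

fun alt_word :: "nat \<Rightarrow> 's \<Rightarrow> 's \<Rightarrow> 's word" where
  "alt_word 0 s t = []"
| "alt_word (Suc n) s t = (s, True) # alt_word n t s"

definition artin_relations :: "'s set \<Rightarrow> ('s \<Rightarrow> 's \<Rightarrow> enat) \<Rightarrow> ('s word \<times> 's word) set" where
  "artin_relations S m =
    {(alt_word n s t, alt_word n t s) | n s t. s \<in> S \<and> t \<in> S \<and> s \<noteq> t \<and> m s t = enat n}"

definition artin_group :: "'s set \<Rightarrow> ('s \<Rightarrow> 's \<Rightarrow> enat) \<Rightarrow> 's word set monoid" where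
  "artin_group S m = presented_group S (artin_relations S m)"

definition artin_gen :: "'s set \<Rightarrow> ('s \<Rightarrow> 's \<Rightarrow> enat) \<Rightarrow> 's \<Rightarrow> 's word set" where
  "artin_gen S m s = word_cong S (artin_relations S m) `` {[(s, True)]}"

definition normal_closure :: "('a, 'b) monoid_scheme \<Rightarrow> 'a set \<Rightarrow> 'a set" where
  "normal_closure G Z = \<Inter> {N. N \<lhd> G \<and> Z \<subseteq> N}"

definition coxeter_group :: "'s set \<Rightarrow> ('s \<Rightarrow> 's \<Rightarrow> enat) \<Rightarrow> 's word set set monoid" where
  "coxeter_group S m =
    artin_group S m Mod
      normal_closure (artin_group S m)
        {artin_gen S m s [^]\<^bsub>artin_group S m\<^esub> (2::nat) | s. s \<in> S}"

definition spherical_type :: "'s set \<Rightarrow> ('s \<Rightarrow> 's \<Rightarrow> enat) \<Rightarrow> bool" where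
  "spherical_type S m \<longleftrightarrow> finite (carrier (coxeter_group S m))"

definition standard_parabolic :: "'s set \<Rightarrow> ('s \<Rightarrow> 's \<Rightarrow> enat) \<Rightarrow> 's set \<Rightarrow> 's word set set" where
  "standard_parabolic S m X = generate (artin_group S m) (artin_gen S m ` X)"

definition parabolic_subgroup :: "'s set \<Rightarrow> ('s \<Rightarrow> 's \<Rightarrow> enat) \<Rightarrow> 's word set set \<Rightarrow> bool" where
  "parabolic_subgroup S m P \<longleftrightarrow>
    (\<exists>X \<beta>. X \<subseteq> S \<and> \<beta> \<in> carrier (artin_group S m) \<and>
      P = (\<beta> <#\<^bsub>artin_group S m\<^esub> standard_parabolic S m X) #>\<^bsub>artin_group S m\<^esub>
            inv\<^bsub>artin_group S m\<^esub> \<beta>)"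

end

theory Submission
  imports Defs Complex_Main
begin

text \<open>
Each element is a unique reduced fraction \<open>x = a\<^sup>-\<^sup>1 b\<close> of positive elements, and \<open>x\<close> lies in a
standard parabolic subgroup \<open>A\<^sub>X\<close> iff \<open>a\<close> and \<open>b\<close> do; the least such \<open>X\<close> is the support of \<open>x\<close>.
The swap \<open>a\<^sup>-\<^sup>1 b \<mapsto> b a\<^sup>-\<^sup>1\<close> conjugates \<open>x\<close> inside every standard parabolic subgroup containing it and
has finite orbits, so every element is conjugate to a recurrent (swap-periodic) one.
Swapping transports positive conjugators and preserves their meets, whence conjugating
a recurrent element by the meet of two positive elements leads to a recurrent
element if both of the given ones do. A positive conjugator between recurrent elements therefore
splits into divisors of \<open>\<Delta>\<^sub>X\<close> and of \<open>\<Delta>\<^sub>X\<^sup>-\<^sup>1 \<Delta>\<close>, where \<open>X\<close> is the current support, and each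
of them conjugates the parabolic subgroups of the supports into one another. Hence the parabolic
subgroup determined by the support of a recurrent conjugate of \<open>\<alpha>\<close> lies in all those containing
\<open>\<alpha>\<close>. The Garside structure comes from the exchange condition in the finite Coxeter group.
\<close>

section \<open>Conjugation and positive monoids\<close>

text \<open>Two obstacles shape the proof. The first is geometric: conjugation may change the size
  of a support, and cutting a conjugator between recurrent elements at an arbitrary letter gives no
  control over what lies in between. Meets with \<Delta>_X and \<Delta>_X^-1 \<Delta> are the right
  places to cut, because both elements conjugate X into the generators, hence commute with
  everything built from reduced fractions. Even so, one direction only yields that supports do not
  grow; equality comes from returning to the start along a second positive conjugator. The second is
  algebraic: it is not clear beforehand that positive words which are equal in the Artin group are
  related by braid moves alone. Cancellation and common multiples are first proved for words up to
  braid moves. The critical case of three generators is settled inside the longest word, which is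
  reduced, so that the finite Coxeter group decides it. The central square of \<Delta> then serves
  as a common denominator and embeds the monoid into the group.\<close>

text \<open>Groups are written additively, although they are not commutative, because \<open>group_add\<close> is
  the type class of all groups.\<close>

definition cj :: "'a::group_add \<Rightarrow> 'a \<Rightarrow> 'a" where
  "cj u x = - u + x + u"

lemmas group_nf = add.assoc diff_conv_add_uminus minus_add minus_minus add_minus_cancel
  minus_add_cancel left_minus right_minus add_0_left add_0_right minus_zero

lemma cj_0 [simp]: "cj 0 x = x" "cj u 0 = 0"
  by (simp_all add: cj_def)

lemma cj_add: "cj u (x + y) = cj u x + cj u y"
  by (simp only: cj_def group_nf)

lemma cj_minus: "cj u (- x) = - cj u x"
  by (simp only: cj_def group_nf)

lemma cj_cj: "cj v (cj u x) = cj (u + v) x"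
  by (simp only: cj_def group_nf)

lemma cj_inverse [simp]: "cj (- u) (cj u x) = x" "cj u (cj (- u) x) = x"
  by (simp_all only: cj_def group_nf)

lemma inj_cj: "inj_on (cj u) X"
  by (rule inj_on_inverseI[of _ "cj (- u)"]) simp

lemma cj_swap: "u + cj u x = x + u"
  by (simp only: cj_def group_nf)

inductive_set mon :: "'a::monoid_add set \<Rightarrow> 'a set" for X where
  zero: "0 \<in> mon X"
| gen_add: "s \<in> X \<Longrightarrow> a \<in> mon X \<Longrightarrow> s + a \<in> mon X"

lemma mon_add: "a \<in> mon X \<Longrightarrow> b \<in> mon X \<Longrightarrow> a + b \<in> mon X"
  by (induction rule: mon.induct) (auto simp: add.assoc intro: mon.intros)

lemma mon_gen: "s \<in> X \<Longrightarrow> s \<in> mon X"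
  using mon.gen_add[OF _ mon.zero] by fastforce

lemma mon_mono: "X \<subseteq> Y \<Longrightarrow> mon X \<subseteq> mon Y"
proof
  fix a assume "X \<subseteq> Y" "a \<in> mon X"
  from this(2,1) show "a \<in> mon Y" by (induction rule: mon.induct) (auto intro: mon.intros)
qed

lemma cj_mon:
  assumes "cj u ` X \<subseteq> Y" "a \<in> mon X" shows "cj u a \<in> mon Y"
  using assms(2) by induction (use assms(1) in \<open>auto simp: cj_add intro: mon.intros\<close>)

fun pw :: "'a::monoid_add \<Rightarrow> nat \<Rightarrow> 'a" where
  "pw d 0 = 0"
| "pw d (Suc n) = d + pw d n"

lemma cj_pw:
  assumes "cj d ` X = X" shows "cj (pw d n) ` X = X"
proof (induction n)
  case (Suc n)
  have "cj (pw d (Suc n)) ` X = cj (pw d n) ` cj d ` X" by (simp add: image_image cj_cj)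
  then show ?case using assms Suc by simp
qed simp

lemma cj_image_inverse:
  assumes "cj u ` X = Y" shows "cj (- u) ` Y = X"
  using assms by (auto simp: image_image)

text \<open>Left fractions only. That they are closed under addition is the Ore condition, which
  comes from the powers of \<open>D X\<close> in \<open>grp_swap\<close>.\<close>

definition grp :: "'a::group_add set \<Rightarrow> 'a set" where
  "grp X = {- a + b |a b. a \<in> mon X \<and> b \<in> mon X}"

lemma cj_grp:
  assumes "cj u ` X = Y" shows "cj u ` grp X = grp Y"
proof -
  have *: "cj u ` grp X \<subseteq> grp Y" if "cj u ` X = Y" for u X and Y :: "'a set"
    using that cj_mon[of u X Y] by (fastforce simp: grp_def cj_add cj_minus)
  have "grp Y = cj u ` cj (- u) ` grp Y" by (simp add: image_image)
  also have "\<dots> \<subseteq> cj u ` grp X" using *[OF cj_image_inverse[OF assms]] by (rule image_mono)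
  finally show ?thesis using *[OF assms] by blast
qed

section \<open>Garside groups with parabolic elements\<close>

text \<open>In the instance, \<open>mon S\<close> is the Artin monoid, \<open>D X\<close> lifts the
  longest element of W_X, and \<open>- D X + D S\<close> lifts the longest of the minimal
  representatives of the cosets W_X w. The assumption \<open>exchange\<close> is a form of Deodhar's
  lemma for divisors of that representative.\<close>

locale garside =
  fixes S :: "'a::group_add set" and len :: "'a \<Rightarrow> nat" and supp :: "'a \<Rightarrow> 'a set"
    and D :: "'a set \<Rightarrow> 'a" and le (infix "\<preceq>" 50)
  defines "a \<preceq> b \<equiv> - a + b \<in> mon S"
  assumes fin: "finite S"
    and len_add: "a \<in> mon S \<Longrightarrow> b \<in> mon S \<Longrightarrow> len (a + b) = len a + len b"
    and len_gen: "s \<in> S \<Longrightarrow> len s = 1"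
    and supp_0: "supp 0 = {}"
    and supp_add: "a \<in> mon S \<Longrightarrow> b \<in> mon S \<Longrightarrow> supp (a + b) = supp a \<union> supp b"
    and supp_gen: "s \<in> S \<Longrightarrow> supp s = {s}"
    and meet_ex: "a \<in> mon S \<Longrightarrow> b \<in> mon S \<Longrightarrow>
      \<exists>d\<in>mon S. d \<preceq> a \<and> d \<preceq> b \<and> (\<forall>e\<in>mon S. e \<preceq> a \<longrightarrow> e \<preceq> b \<longrightarrow> e \<preceq> d)"
    and D_mon: "X \<subseteq> S \<Longrightarrow> D X \<in> mon X"
    and le_D: "X \<subseteq> S \<Longrightarrow> t \<in> X \<Longrightarrow> t \<preceq> D X"
    and cj_D: "X \<subseteq> S \<Longrightarrow> t \<in> X \<Longrightarrow> cj (D X) t \<in> X"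
    and D_le: "X \<subseteq> S \<Longrightarrow> D X \<preceq> D S"
    and not_le_r: "X \<subseteq> S \<Longrightarrow> t \<in> X \<Longrightarrow> \<not> t \<preceq> - D X + D S"
    and le_r: "X \<subseteq> S \<Longrightarrow> s \<in> S \<Longrightarrow> s \<notin> X \<Longrightarrow> s \<preceq> - D X + D S"
    and exchange: "X \<subseteq> S \<Longrightarrow> t \<in> X \<Longrightarrow> t' \<in> S \<Longrightarrow> g \<in> mon S \<Longrightarrow> h \<in> mon S \<Longrightarrow>
      g \<preceq> - D X + D S \<Longrightarrow> h \<preceq> - D X + D S \<Longrightarrow> t + h = g + t' \<Longrightarrow> h = g"
begin

section \<open>Length, support and left divisibility\<close>

lemma monS: "X \<subseteq> S \<Longrightarrow> a \<in> mon X \<Longrightarrow> a \<in> mon S"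
  using subsetD[OF mon_mono] .

lemma len_0 [simp]: "len 0 = 0"
  using len_add[OF mon.zero mon.zero] by simp

lemma len_zeroD: "a \<in> mon S \<Longrightarrow> len a = 0 \<Longrightarrow> a = 0"
  by (induction rule: mon.induct) (auto simp: len_add len_gen mon_gen)

lemma pos_antisym: "a \<in> mon S \<Longrightarrow> - a \<in> mon S \<Longrightarrow> a = 0"
  using len_add[of a "- a"] len_zeroD by simp

lemma len_oneD: assumes "a \<in> mon S" "len a = 1" shows "a \<in> S"
  using assms(1)
proof cases
  case (gen_add s b)
  then have "b = 0" using assms(2) len_zeroD by (simp add: len_add len_gen mon_gen)
  then show ?thesis using gen_add by simp
qed (use assms(2) in simp)

lemma gen_nonzero: "s \<in> S \<Longrightarrow> s \<noteq> 0"
  using len_gen by fastforce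

lemma finite_len: "finite {a \<in> mon S. len a \<le> n}"
proof (induction n)
  case 0
  have "{a \<in> mon S. len a \<le> 0} \<subseteq> {0}" using len_zeroD by auto
  then show ?case using finite_subset by blast
next
  case (Suc n)
  let ?F = "{a \<in> mon S. len a \<le> n}"
  have "{a \<in> mon S. len a \<le> Suc n} \<subseteq> insert 0 ((\<lambda>(s, a). s + a) ` (S \<times> ?F))"
  proof
    fix a assume "a \<in> {a \<in> mon S. len a \<le> Suc n}"
    then have "a \<in> mon S" "len a \<le> Suc n" by auto
    then show "a \<in> insert 0 ((\<lambda>(s, a). s + a) ` (S \<times> ?F))"
    proof cases
      case (gen_add s b)
      then have "b \<in> ?F" using \<open>len a \<le> Suc n\<close> by (simp add: len_add len_gen mon_gen)
      then show ?thesis using gen_add by (auto intro: rev_image_eqI[of "(s, b)"])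
    qed simp
  qed
  then show ?case using Suc fin by (meson finite_SigmaI finite_imageI finite_insert finite_subset)
qed

lemma supp_mon: "a \<in> mon S \<Longrightarrow> a \<in> mon (supp a)"
proof (induction rule: mon.induct)
  case (gen_add s a)
  then have "supp (s + a) = insert s (supp a)" by (simp add: supp_add supp_gen mon_gen)
  then show ?case using gen_add mon_mono[of "supp a" "insert s (supp a)"]
    by (auto intro!: mon.gen_add)
qed (simp add: mon.zero)

lemma supp_le:
  assumes "X \<subseteq> S" "a \<in> mon X" shows "supp a \<subseteq> X"
  using assms(2)
proof induction
  case (gen_add s a)
  then have "s \<in> S" "a \<in> mon S" using assms(1) monS by auto
  then show ?case using gen_add by (simp add: supp_add supp_gen mon_gen)
qed (simp add: supp_0)

lemma mon_iff_supp: "X \<subseteq> S \<Longrightarrow> a \<in> mon S \<Longrightarrow> a \<in> mon X \<longleftrightarrow> supp a \<subseteq> X"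
  using supp_le[of X a] subsetD[OF mon_mono[of "supp a" X] supp_mon[of a]] by blast

lemma mon_factor:
  assumes "X \<subseteq> S" "a \<in> mon S" "b \<in> mon S" "a + b \<in> mon X"
  shows "a \<in> mon X" "b \<in> mon X"
  using assms supp_add[of a b] supp_le[of X "a + b"] by (auto simp: mon_iff_supp)

lemma le_addR: "b \<in> mon S \<Longrightarrow> a \<preceq> a + b"
  unfolding le_def by (simp only: minus_add_cancel)

lemma leE: "a \<preceq> b \<Longrightarrow> (\<And>c. c \<in> mon S \<Longrightarrow> b = a + c \<Longrightarrow> thesis) \<Longrightarrow> thesis"
  unfolding le_def by (metis add_minus_cancel)

lemma le_trans: assumes "a \<preceq> b" "b \<preceq> c" shows "a \<preceq> c"
proof -
  obtain d where "d \<in> mon S" "b = a + d" using assms(1) by (rule leE)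
  moreover obtain e where "e \<in> mon S" "c = b + e" using assms(2) by (rule leE)
  ultimately show ?thesis using le_addR[OF mon_add[of d S e]] by (simp only: add.assoc)
qed

lemma le_antisym: assumes "a \<preceq> b" "b \<preceq> a" shows "a = b"
proof -
  obtain d where d: "d \<in> mon S" "b = a + d" using assms(1) by (rule leE)
  have "- d \<in> mon S" using assms(2) unfolding le_def d by (simp only: group_nf)
  then have "d = 0" using pos_antisym d(1) by blast
  then show ?thesis using d(2) by simp
qed

lemma le_left [simp]: "c + a \<preceq> c + b \<longleftrightarrow> a \<preceq> b"
  unfolding le_def by (simp only: group_nf)

lemma zero_le [simp]: "0 \<preceq> a \<longleftrightarrow> a \<in> mon S"
  by (simp add: le_def)

lemma le_mon: "X \<subseteq> S \<Longrightarrow> a \<in> mon S \<Longrightarrow> a \<preceq> b \<Longrightarrow> b \<in> mon X \<Longrightarrow> a \<in> mon X"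
  by (metis leE mon_factor(1))

lemma len_le: "a \<in> mon S \<Longrightarrow> a \<preceq> b \<Longrightarrow> len a \<le> len b"
  by (metis leE len_add le_add1)

lemma le_pos: "a \<in> mon S \<Longrightarrow> a \<preceq> b \<Longrightarrow> b \<in> mon S"
  using le_trans zero_le by blast

section \<open>Powers of \<open>D X\<close> and standard subgroups\<close>

lemma cj_D_image: "X \<subseteq> S \<Longrightarrow> cj (D X) ` X = X"
  by (rule endo_inj_surj) (auto intro: finite_subset[OF _ fin] cj_D inj_cj)

lemma cj_pw_image: "X \<subseteq> S \<Longrightarrow> cj (pw (D X) n) ` X = X"
  by (rule cj_pw[OF cj_D_image])

lemma cj_pw_mon: "X \<subseteq> S \<Longrightarrow> a \<in> mon X \<Longrightarrow> cj (pw (D X) n) a \<in> mon X"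
  using cj_mon[of "pw (D X) n" X X] cj_pw_image[of X n] by simp

lemma cj_pw_mon': "X \<subseteq> S \<Longrightarrow> a \<in> mon X \<Longrightarrow> cj (- pw (D X) n) a \<in> mon X"
  using cj_mon[of "- pw (D X) n" X X] cj_image_inverse[OF cj_pw_image[of X n]] by simp

lemma pw_mon: "X \<subseteq> S \<Longrightarrow> pw (D X) n \<in> mon X"
  by (induction n) (auto intro: mon.zero mon_add D_mon)

text \<open>One letter \<open>s\<close> is split off at a time: \<open>D X\<close> is
  \<open>s + c\<close>, and since conjugation by \<open>D X\<close> permutes X, the rest
  \<open>c\<close> can be moved behind the remaining power and stays positive.\<close>

lemma le_pw:
  assumes X: "X \<subseteq> S" and "a \<in> mon X"
  shows "\<exists>n. \<forall>k\<ge>n. a \<preceq> pw (D X) k"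
  using assms(2)
proof (induction rule: mon.induct)
  case zero
  show ?case using X by (auto intro: exI[of _ 0] monS pw_mon)
next
  case (gen_add s a)
  then obtain n where n: "\<forall>k\<ge>n. a \<preceq> pw (D X) k" by blast
  obtain c where c: "c \<in> mon S" "D X = s + c" using le_D[OF X gen_add(1)] by (rule leE)
  have cX: "c \<in> mon X"
    using mon_factor(2)[OF X, of s c] c D_mon[OF X] mon_gen X gen_add(1) by auto
  have "s + a \<preceq> pw (D X) (Suc k)" if "k \<ge> n" for k
  proof -
    have "pw (D X) (Suc k) = s + (pw (D X) k + cj (pw (D X) k) c)"
      by (simp add: c(2) cj_swap add.assoc)
    moreover have "a \<preceq> pw (D X) k + cj (pw (D X) k) c"
      by (rule le_trans[OF _ le_addR]) (use n that monS[OF X] cj_pw_mon[OF X cX] in auto)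
    ultimately show ?thesis by simp
  qed
  then have "\<forall>k\<ge>Suc n. s + a \<preceq> pw (D X) k" using Suc_le_D by (metis Suc_le_mono)
  then show ?case by blast
qed

text \<open>Complete \<open>a\<close> to a power of \<open>D X\<close>, say \<open>a + e\<close>.
  Then \<open>b - a\<close> is \<open>b + e\<close> minus that power, and the power can be moved to
  the front because conjugation by it permutes X.\<close>

lemma grp_swap:
  assumes X: "X \<subseteq> S" and "a \<in> mon X" "b \<in> mon X"
  shows "b - a \<in> grp X"
proof -
  obtain n where "a \<preceq> pw (D X) n" using le_pw[OF assms(1,2)] by blast
  then obtain e where e: "e \<in> mon S" "pw (D X) n = a + e" by (rule leE)
  have eX: "e \<in> mon X" using mon_factor(2)[OF X _ e(1)] assms e(2) pw_mon[OF X, of n] monS by auto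
  let ?p = "pw (D X) n"
  have "b - a = b + e + (- ?p)" by (simp add: e(2) group_nf del: add_uminus_conv_diff)
  also have "\<dots> = - ?p + cj (- ?p) (b + e)" by (simp only: cj_swap)
  finally show ?thesis unfolding grp_def
    using cj_pw_mon'[OF X mon_add[OF assms(3) eX], of n] pw_mon[OF X, of n] by auto
qed

lemma grp_minus: "x \<in> grp X \<Longrightarrow> - x \<in> grp X"
proof -
  assume "x \<in> grp X"
  then obtain a b where "x = - a + b" "a \<in> mon X" "b \<in> mon X" unfolding grp_def by blast
  moreover from this(1) have "- x = - b + a" by (simp only: group_nf)
  ultimately show ?thesis unfolding grp_def by blast
qed

lemma grp_add:
  assumes X: "X \<subseteq> S" and "x \<in> grp X" "y \<in> grp X"
  shows "x + y \<in> grp X"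
proof -
  obtain a b where ab: "x = - a + b" "a \<in> mon X" "b \<in> mon X" using assms(2) unfolding grp_def by blast
  obtain c d where cd: "y = - c + d" "c \<in> mon X" "d \<in> mon X" using assms(3) unfolding grp_def by blast
  obtain e f where ef: "b - c = - e + f" "e \<in> mon X" "f \<in> mon X"
    using grp_swap[OF X cd(2) ab(3)] unfolding grp_def by blast
  have "x + y = - a + (b - c) + d" by (simp only: ab cd group_nf)
  also have "\<dots> = - (e + a) + (f + d)" unfolding ef by (simp only: group_nf)
  finally show ?thesis unfolding grp_def using mon_add ab cd ef by blast
qed

lemma mon_grp: "a \<in> mon X \<Longrightarrow> a \<in> grp X"
proof -
  have "a = - 0 + a" by simp
  then show "a \<in> mon X \<Longrightarrow> a \<in> grp X" unfolding grp_def using mon.zero by blast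
qed

lemma grp_mono: "X \<subseteq> Y \<Longrightarrow> grp X \<subseteq> grp Y"
  unfolding grp_def using mon_mono[of X Y] by blast

lemma grpS: "X \<subseteq> S \<Longrightarrow> x \<in> grp X \<Longrightarrow> x \<in> grp S"
  using subsetD[OF grp_mono] .

lemma grp_cj: "X \<subseteq> S \<Longrightarrow> x \<in> grp X \<Longrightarrow> u \<in> grp X \<Longrightarrow> cj u x \<in> grp X"
  unfolding cj_def by (intro grp_add grp_minus)

lemma grp_cj_image:
  assumes "X \<subseteq> S" "u \<in> grp X" shows "cj u ` grp X = grp X"
proof
  show "cj u ` grp X \<subseteq> grp X" using assms grp_cj by blast
  have "grp X = cj u ` cj (- u) ` grp X" by (simp add: image_image)
  also have "\<dots> \<subseteq> cj u ` grp X" using assms grp_cj grp_minus by blast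
  finally show "grp X \<subseteq> cj u ` grp X" .
qed

section \<open>Powers of Delta and meets in the whole group\<close>

abbreviation "\<Delta> n \<equiv> pw (D S) n"

lemma Delta_mon [simp]: "\<Delta> n \<in> mon S" by (simp add: pw_mon)

lemma Delta_shift:
  assumes "x \<in> grp S"
  shows "\<exists>n. \<forall>k\<ge>n. \<Delta> k + x \<in> mon S \<and> x + \<Delta> k \<in> mon S \<and> x \<preceq> \<Delta> k"
proof -
  obtain a b where ab: "x = - a + b" "a \<in> mon S" "b \<in> mon S" using assms unfolding grp_def by blast
  obtain n where n: "\<forall>k\<ge>n. a \<preceq> \<Delta> k" using le_pw[OF subset_refl ab(2)] by blast
  obtain m where m: "\<forall>k\<ge>m. b \<preceq> \<Delta> k" using le_pw[OF subset_refl ab(3)] by blast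
  have "\<Delta> k + x \<in> mon S \<and> x + \<Delta> k \<in> mon S \<and> x \<preceq> \<Delta> k" if "k \<ge> max m n" for k
  proof (intro conjI)
    have a: "- a + \<Delta> k \<in> mon S" and b: "- b + \<Delta> k \<in> mon S" using n m that by (auto simp: le_def)
    have "\<Delta> k + x = cj (- \<Delta> k) (- a + \<Delta> k) + b" by (simp only: ab cj_def group_nf)
    then show "\<Delta> k + x \<in> mon S" using cj_pw_mon'[OF _ a] ab mon_add by auto
    have "x + \<Delta> k = - a + \<Delta> k + cj (\<Delta> k) b" by (simp only: ab cj_def group_nf)
    then show "x + \<Delta> k \<in> mon S" using a cj_pw_mon[OF _ ab(3)] mon_add by auto
    have "- x + \<Delta> k = - b + \<Delta> k + cj (\<Delta> k) a" by (simp only: ab cj_def group_nf)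
    then show "x \<preceq> \<Delta> k" using b cj_pw_mon[OF _ ab(2)] mon_add by (auto simp: le_def)
  qed
  then show ?thesis by blast
qed

text \<open>The lower bounds \<open>e\<close> range over the whole group and not only over positive
  elements; this makes the notion invariant under left translation.\<close>

definition is_meet :: "'a \<Rightarrow> 'a \<Rightarrow> 'a \<Rightarrow> bool" where
  "is_meet d a b \<longleftrightarrow> d \<preceq> a \<and> d \<preceq> b \<and> (\<forall>e. e \<preceq> a \<longrightarrow> e \<preceq> b \<longrightarrow> e \<preceq> d)"

lemma is_meet_left: "is_meet (c + d) (c + a) (c + b) \<longleftrightarrow> is_meet d a b"
proof -
  have shift: "e \<preceq> c + a \<longleftrightarrow> - c + e \<preceq> a" for e a
    using le_left[of c "- c + e" a] by (simp only: add_minus_cancel)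
  have "(\<forall>e. e \<preceq> c + a \<longrightarrow> e \<preceq> c + b \<longrightarrow> e \<preceq> c + d) \<longleftrightarrow> (\<forall>e. e \<preceq> a \<longrightarrow> e \<preceq> b \<longrightarrow> e \<preceq> d)"
    unfolding shift by (auto dest: spec[of _ "c + _"] simp: minus_add_cancel)
  then show ?thesis by (simp add: is_meet_def)
qed

lemma is_meet_unique: "is_meet d a b \<Longrightarrow> is_meet d' a b \<Longrightarrow> d = d'"
  by (simp add: is_meet_def le_antisym)

lemma is_meet_ex:
  assumes "a \<in> grp S" "b \<in> grp S"
  shows "\<exists>d. is_meet d a b"
proof -
  have pos: "\<exists>d. is_meet d a b" if a: "a \<in> mon S" and b: "b \<in> mon S" for a b
  proof -
    obtain d where d: "d \<in> mon S" "d \<preceq> a" "d \<preceq> b" "\<forall>e\<in>mon S. e \<preceq> a \<longrightarrow> e \<preceq> b \<longrightarrow> e \<preceq> d"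
      using meet_ex[OF a b] by blast
    \<comment> \<open>The element \<open>e\<close> need not be positive. A shift by
      \<open>\<Delta> k\<close> makes it so, and the positive meet of the shifted elements has the
      form \<open>\<Delta> k + f\<close>, where \<open>f\<close> is a positive common divisor of
      \<open>a\<close> and \<open>b\<close>. Hence \<open>e\<close> divides \<open>f\<close> and
      \<open>f\<close> divides \<open>d\<close>.\<close>
    have "e \<preceq> d" if e: "e \<preceq> a" "e \<preceq> b" for e
    proof -
      obtain c where c: "c \<in> mon S" "a = e + c" using e(1) by (rule leE)
      then have "e = a - c" by simp
      then have "e \<in> grp S" using grp_swap[OF _ c(1) a] by simp
      then obtain k where k: "\<Delta> k + e \<in> mon S" using Delta_shift by blast
      obtain d' where d': "d' \<in> mon S" "d' \<preceq> \<Delta> k + a" "d' \<preceq> \<Delta> k + b"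
        "\<forall>e\<in>mon S. e \<preceq> \<Delta> k + a \<longrightarrow> e \<preceq> \<Delta> k + b \<longrightarrow> e \<preceq> d'"
        using meet_ex[of "\<Delta> k + a" "\<Delta> k + b"] a b by (auto simp: mon_add)
      have "\<Delta> k \<preceq> d'" using d'(4) a b by (auto intro: le_addR)
      then obtain f where f: "f \<in> mon S" "d' = \<Delta> k + f" by (rule leE)
      have "f \<preceq> d" using d' f d(4) by auto
      moreover have "e \<preceq> f" using d'(4) k e f by auto
      ultimately show ?thesis using le_trans by blast
    qed
    then show ?thesis using d by (auto simp: is_meet_def)
  qed
  obtain n where n: "\<forall>k\<ge>n. \<Delta> k + a \<in> mon S" using Delta_shift[OF assms(1)] by blast
  obtain m where m: "\<forall>k\<ge>m. \<Delta> k + b \<in> mon S" using Delta_shift[OF assms(2)] by blast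
  define k where "k = max m n"
  obtain d where "is_meet d (\<Delta> k + a) (\<Delta> k + b)" using pos n m unfolding k_def by (meson max.cobounded1 max.cobounded2)
  then have "is_meet (- \<Delta> k + d) a b" using is_meet_left[of "\<Delta> k" "- \<Delta> k + d"] by (simp add: add_minus_cancel)
  then show ?thesis by blast
qed

lemma is_meet_mono: "is_meet d a b \<Longrightarrow> is_meet d' a' b' \<Longrightarrow> a \<preceq> a' \<Longrightarrow> b \<preceq> b' \<Longrightarrow> d \<preceq> d'"
  unfolding is_meet_def by (meson le_trans)

lemma is_meet_pos: "is_meet d a b \<Longrightarrow> a \<in> mon S \<Longrightarrow> b \<in> mon S \<Longrightarrow> d \<in> mon S"
  unfolding is_meet_def by (metis zero_le)

section \<open>Reduced fractions, the swap and supports\<close>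

text \<open>The meet of 0 and \<open>x\<close> is the inverse of the reduced denominator; the
  numerator is \<open>den x + x\<close>.\<close>

definition den :: "'a \<Rightarrow> 'a" where
  "den x = - (THE d. is_meet d 0 x)"

definition sw :: "'a \<Rightarrow> 'a" where
  "sw x = cj (- den x) x"

definition spt :: "'a \<Rightarrow> 'a set" where
  "spt x = supp (den x) \<union> supp (den x + x)"

lemma zero_grp [simp]: "0 \<in> grp X"
  by (rule mon_grp[OF mon.zero])

lemma den_eqI: "is_meet (- a) 0 x \<Longrightarrow> den x = a"
  unfolding den_def by (metis is_meet_unique minus_minus the_equality)

lemma is_meet_den: "x \<in> grp S \<Longrightarrow> is_meet (- den x) 0 x"
  using is_meet_ex[of 0 x] den_eqI by (metis minus_minus zero_grp)

lemma den_pos: "x \<in> grp S \<Longrightarrow> den x \<in> mon S"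
  using is_meet_den[of x] by (simp add: is_meet_def le_def)

lemma num_pos: "x \<in> grp S \<Longrightarrow> den x + x \<in> mon S"
  using is_meet_den[of x] by (simp add: is_meet_def le_def)

lemma den_least:
  assumes "x \<in> grp S" "a \<in> mon S" "a + x \<in> mon S"
  shows "a + - den x \<in> mon S"
proof -
  have "- a \<preceq> 0" "- a \<preceq> x" unfolding le_def using assms by (simp_all only: minus_minus add_0_right)
  then have "- a \<preceq> - den x" using is_meet_den[OF assms(1)] by (simp only: is_meet_def)
  then show ?thesis unfolding le_def by (simp only: minus_minus)
qed

text \<open>By \<open>den_least\<close>, any fraction for \<open>x\<close> arises from the reduced
  one by a common positive left factor \<open>c\<close>. So the reduced numerator and denominator
  are factors of elements of \<open>mon X\<close>.\<close>

lemma den_grp: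
  assumes X: "X \<subseteq> S" and x: "x \<in> grp X"
  shows "den x \<in> mon X" "den x + x \<in> mon X"
proof -
  obtain a b where ab: "x = - a + b" "a \<in> mon X" "b \<in> mon X" using x unfolding grp_def by blast
  have xS: "x \<in> grp S" using grpS X x .
  define c where "c = a + - den x"
  have "a + x = b" by (simp only: ab add_minus_cancel)
  then have c: "c \<in> mon S" unfolding c_def using den_least[OF xS] monS[OF X] ab by blast
  have a: "a = c + den x" by (simp only: c_def group_nf)
  have b: "b = c + (den x + x)" by (simp only: c_def group_nf \<open>a + x = b\<close>[symmetric])
  show "den x \<in> mon X" using mon_factor(2)[OF X c den_pos[OF xS]] ab(2) a by simp
  show "den x + x \<in> mon X" using mon_factor(2)[OF X c num_pos[OF xS]] ab(3) b by simp
qed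

lemma grp_iff_spt:
  assumes X: "X \<subseteq> S" and x: "x \<in> grp S"
  shows "x \<in> grp X \<longleftrightarrow> spt x \<subseteq> X"
proof
  assume "x \<in> grp X"
  then show "spt x \<subseteq> X" unfolding spt_def using den_grp[OF X] supp_le[OF X] by simp
next
  assume "spt x \<subseteq> X"
  then have "den x \<in> mon X" "den x + x \<in> mon X"
    using x by (auto simp: spt_def mon_iff_supp[OF X] den_pos num_pos)
  moreover have "x = - den x + (den x + x)" by (simp only: minus_add_cancel)
  ultimately show "x \<in> grp X" unfolding grp_def by blast
qed

lemma spt_S: "x \<in> grp S \<Longrightarrow> spt x \<subseteq> S"
  using grp_iff_spt[of S x] by simp

lemma grp_spt: "x \<in> grp S \<Longrightarrow> x \<in> grp (spt x)"
  using grp_iff_spt[of "spt x" x] spt_S[of x] by simp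

lemma finite_spt: "x \<in> grp S \<Longrightarrow> finite (spt x)"
  using spt_S fin finite_subset by blast

text \<open>Each of the two denominators is compared with the image of the other by minimality. As
  \<open>cj u\<close> is only known to map \<open>mon X\<close> to \<open>mon Y\<close>, the second
  quotient has to be placed in \<open>mon X\<close> before it is conjugated.\<close>

lemma den_cj:
  assumes X: "X \<subseteq> S" and Y: "Y \<subseteq> S" and u: "cj u ` X = Y" and x: "x \<in> grp X"
  shows "den (cj u x) = cj u (den x)"
proof -
  have y: "cj u x \<in> grp Y" using cj_grp[OF u] x by blast
  have yS: "cj u x \<in> grp S" and xS: "x \<in> grp S" using y x grpS X Y by blast+
  let ?a = "den (cj u x)"
  have a: "?a \<in> mon Y" "?a + cj u x \<in> mon Y" using den_grp[OF Y y] by auto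
  have ud: "cj u (den x) \<in> mon Y" "cj u (den x + x) \<in> mon Y"
    using cj_mon[of u X Y] u den_grp[OF X x] by auto
  have le1: "cj u (den x) - ?a \<in> mon S"
    using den_least[OF yS monS[OF Y ud(1)]] monS[OF Y ud(2)] by (simp add: cj_add)
  have "cj (- u) ?a \<in> mon S" "cj (- u) (?a + cj u x) \<in> mon S"
    using a cj_mon[of "- u" Y X] cj_image_inverse[OF u] monS[OF X] by auto
  then have le2: "cj (- u) ?a - den x \<in> mon S" using den_least[OF xS] by (simp add: cj_add)
  have "cj (- u) ?a + - den x \<in> mon X"
  proof (rule mon_factor(1)[OF X])
    show "cj (- u) ?a + - den x \<in> mon S" using le2 by simp
    show "den x \<in> mon S" by (rule den_pos[OF xS])
    have "cj (- u) ?a \<in> mon X" using a(1) cj_mon[of "- u" Y X] cj_image_inverse[OF u] by simp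
    then show "cj (- u) ?a + - den x + den x \<in> mon X" by (simp add: add.assoc)
  qed
  then have "cj u (cj (- u) ?a + - den x) \<in> mon Y" using cj_mon[of u X Y] u by simp
  then have "?a + - cj u (den x) \<in> mon S" using monS[OF Y] by (simp only: cj_add cj_minus cj_inverse)
  moreover have "?a + - cj u (den x) = - (cj u (den x) - ?a)" by (simp only: group_nf)
  ultimately have "cj u (den x) - ?a = 0" using pos_antisym[OF le1] by simp
  then show ?thesis by simp
qed

lemma sw_cj:
  assumes "X \<subseteq> S" "Y \<subseteq> S" "cj u ` X = Y" "x \<in> grp X"
  shows "sw (cj u x) = cj u (sw x)"
  unfolding sw_def den_cj[OF assms] by (simp only: cj_def group_nf)

lemma supp_cj:
  assumes X: "X \<subseteq> S" and Y: "Y \<subseteq> S" and u: "cj u ` X = Y" and "a \<in> mon X"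
  shows "supp (cj u a) = cj u ` supp a"
  using assms(4)
proof induction
  case zero
  then show ?case by (simp add: supp_0)
next
  case (gen_add s a)
  have "s \<in> S" "a \<in> mon S" "cj u s \<in> S" "cj u a \<in> mon S"
    using gen_add X Y u monS[OF X] monS[OF Y] cj_mon[of u X Y a] by auto
  then show ?case using gen_add by (simp add: cj_add supp_add supp_gen mon_gen)
qed

lemma spt_cj:
  assumes "X \<subseteq> S" "Y \<subseteq> S" "cj u ` X = Y" "x \<in> grp X"
  shows "spt (cj u x) = cj u ` spt x"
  using supp_cj[OF assms(1-3)] den_grp[OF assms(1,4)]
  unfolding spt_def den_cj[OF assms] image_Un by (simp flip: cj_add)

lemma sw_grp: "X \<subseteq> S \<Longrightarrow> x \<in> grp X \<Longrightarrow> sw x \<in> grp X"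
  unfolding sw_def using grp_cj grp_minus mon_grp den_grp(1) by meson

lemma sw_funpow_grp: "X \<subseteq> S \<Longrightarrow> x \<in> grp X \<Longrightarrow> (sw ^^ n) x \<in> grp X"
  by (induction n) (simp_all add: sw_grp)

lemma sw_funpow_cj:
  assumes "X \<subseteq> S" "Y \<subseteq> S" "cj u ` X = Y" "x \<in> grp X"
  shows "(sw ^^ n) (cj u x) = cj u ((sw ^^ n) x)"
  by (induction n) (use assms in \<open>simp_all add: sw_cj[OF assms(1-3)] sw_funpow_grp\<close>)

section \<open>Recurrent elements\<close>

definition recurrent :: "'a \<Rightarrow> bool" where
  "recurrent x \<longleftrightarrow> x \<in> grp S \<and> (\<exists>n>0. (sw ^^ n) x = x)"

lemma recurrent_cj:
  assumes "X \<subseteq> S" "Y \<subseteq> S" "cj u ` X = Y" "x \<in> grp X" "recurrent x"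
  shows "recurrent (cj u x)"
proof -
  have "cj u x \<in> grp S" using cj_grp[OF assms(3)] assms(4) grpS[OF assms(2)] by blast
  then show ?thesis using assms(5) sw_funpow_cj[OF assms(1-4)] unfolding recurrent_def by auto
qed

lemma ex_recurrent:
  assumes "x \<in> grp S"
  shows "\<exists>n. recurrent ((sw ^^ n) x)"
proof -
  obtain p where "\<Delta> p + x \<in> mon S" using Delta_shift[OF assms] by blast
  then have p: "- \<Delta> p \<preceq> x" by (simp add: le_def)
  \<comment> \<open>Two quantities confine the orbit. The lower bound by the inverse of
    \<open>\<Delta> p\<close> bounds the length of the denominators; the degree, that is the length
    of the numerator minus that of the denominator, is constant and then bounds the
    numerators.\<close>
  define J where "J y \<longleftrightarrow> y \<in> grp S \<and> - \<Delta> p \<preceq> y \<and>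
    int (len (den y + y)) - int (len (den y)) = int (len (den x + x)) - int (len (den x))" for y
  have le_den: "\<Delta> p - den y \<in> mon S" if "J y" for y
    using den_least[of y "\<Delta> p"] that by (simp add: J_def le_def)
  have step: "J (sw y)" if y: "J y" for y
  proof -
    have yS: "y \<in> grp S" using y by (simp add: J_def)
    have zS: "sw y \<in> grp S" using sw_grp yS by simp
    have sw: "sw y = den y + y - den y" by (simp add: sw_def cj_def)
    have "\<Delta> p + sw y = cj (- \<Delta> p) (den y + y) + (\<Delta> p - den y)"
      by (simp only: sw cj_def group_nf)
    then have 1: "- \<Delta> p \<preceq> sw y"
      using le_den[OF y] cj_pw_mon'[OF _ num_pos[OF yS], of p] by (simp add: le_def mon_add)
    have "den (sw y) + (den y + y) = den (sw y) + sw y + den y" by (simp only: sw group_nf)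
    then have "len (den (sw y)) + len (den y + y) = len (den (sw y) + sw y) + len (den y)"
      using len_add den_pos[OF yS] num_pos[OF yS] den_pos[OF zS] num_pos[OF zS] by metis
    then show ?thesis using y zS 1 unfolding J_def by linarith
  qed
  have J: "J ((sw ^^ n) x)" for n
    by (induction n) (use assms p step in \<open>simp_all add: J_def\<close>)
  define L where "L = len (\<Delta> p)"
  define B where "B n = {a \<in> mon S. len a \<le> n}" for n
  have "{y. J y} \<subseteq> (\<lambda>(a, b). - a + b) ` (B L \<times> B (L + len (den x + x)))"
  proof
    fix y assume "y \<in> {y. J y}"
    then have y: "J y" and yS: "y \<in> grp S" by (simp_all add: J_def)
    have "\<Delta> p = (\<Delta> p - den y) + den y" by simp
    then have "len (den y) \<le> L" unfolding L_def
      using len_add[OF le_den[OF y] den_pos[OF yS]] by simp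
    moreover from this have "len (den y + y) \<le> L + len (den x + x)" using y unfolding J_def by linarith
    ultimately have "(den y, den y + y) \<in> B L \<times> B (L + len (den x + x))"
      using den_pos[OF yS] num_pos[OF yS] by (simp add: B_def)
    moreover have "y = - den y + (den y + y)" by (simp only: minus_add_cancel)
    ultimately show "y \<in> (\<lambda>(a, b). - a + b) ` (B L \<times> B (L + len (den x + x)))"
      by (intro rev_image_eqI[of "(den y, den y + y)"]) simp_all
  qed
  moreover have "finite (B n)" for n unfolding B_def by (rule finite_len)
  ultimately have "finite {y. J y}" by (meson finite_SigmaI finite_imageI finite_subset)
  then have "finite (range (\<lambda>n. (sw ^^ n) x))" using J by (auto elim!: finite_subset[rotated])
  then have "\<not> inj (\<lambda>n. (sw ^^ n) x)" using finite_imageD infinite_UNIV_nat by blast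
  then obtain i j where "i < j" "(sw ^^ i) x = (sw ^^ j) x"
    unfolding inj_on_def by (metis nat_neq_iff)
  moreover have "(sw ^^ j) x = (sw ^^ (j - i)) ((sw ^^ i) x)"
    using \<open>i < j\<close> by (metis add_diff_cancel_left' comp_apply funpow_add le_add_diff_inverse2 less_imp_le_nat)
  ultimately have "recurrent ((sw ^^ i) x)" unfolding recurrent_def
    using sw_funpow_grp[OF _ assms] by (auto intro!: exI[of _ "j - i"])
  then show ?thesis by blast
qed

section \<open>Transport of conjugators along swaps\<close>

fun Den :: "'a \<Rightarrow> nat \<Rightarrow> 'a" where
  "Den x 0 = 0"
| "Den x (Suc n) = den ((sw ^^ n) x) + Den x n"

lemma sw_funpow: "(sw ^^ n) x = cj (- Den x n) x"
proof (induction n)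
  case (Suc n)
  have "(sw ^^ Suc n) x = cj (- den ((sw ^^ n) x)) (cj (- Den x n) x)"
    unfolding Suc[symmetric] by (simp add: sw_def)
  then show ?case by (simp only: cj_cj Den.simps minus_add)
qed simp

lemma Den_grp: "X \<subseteq> S \<Longrightarrow> x \<in> grp X \<Longrightarrow> Den x n \<in> mon X"
  by (induction n) (auto intro!: mon.zero mon_add den_grp sw_funpow_grp)

lemma Den_add: "Den x (n + k) = Den ((sw ^^ n) x) k + Den x n"
proof (induction k)
  case (Suc k)
  have "(sw ^^ (n + k)) x = (sw ^^ k) ((sw ^^ n) x)" by (simp add: add.commute[of n] funpow_add)
  then show ?case using Suc by (simp add: add.assoc)
qed simp

text \<open>The transport of \<open>g\<close> under the \<open>n\<close>-th swap: it conjugates \<open>(sw ^^ n) x\<close> into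
  \<open>(sw ^^ n) (cj g x)\<close>, and it is positive if \<open>g\<close> is.\<close>

definition trn :: "'a \<Rightarrow> nat \<Rightarrow> 'a \<Rightarrow> 'a" where
  "trn x n g = Den x n + g - Den (cj g x) n"

lemma trn_0 [simp]: "trn x 0 g = g"
  by (simp add: trn_def)

lemma cj_trn: "cj (trn x n g) ((sw ^^ n) x) = (sw ^^ n) (cj g x)"
  unfolding sw_funpow cj_cj trn_def by (simp only: group_nf)

lemma trn_Suc: "trn x (Suc n) g = den ((sw ^^ n) x) + trn x n g - den ((sw ^^ n) (cj g x))"
  by (simp only: trn_def Den.simps group_nf)

lemma cj_mon_grp: "x \<in> grp S \<Longrightarrow> g \<in> mon S \<Longrightarrow> cj g x \<in> grp S"
  by (simp add: grp_cj mon_grp)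

text \<open>Let \<open>- a + b\<close> be the reduced fraction of the current iterate
  \<open>y\<close> and \<open>h\<close> the current transport. Translating the meet of 0 and
  \<open>cj h y\<close> by \<open>a + h\<close> gives the meet of \<open>a + h\<close> and
  \<open>b + h\<close>. Positivity, monotonicity and compatibility with meets follow in the next
  three lemmas.\<close>

lemma is_meet_trn:
  assumes x: "x \<in> grp S" and g: "g \<in> mon S"
  shows "is_meet (trn x (Suc n) g) (den ((sw ^^ n) x) + trn x n g)
           (den ((sw ^^ n) x) + (sw ^^ n) x + trn x n g)"
proof -
  let ?y = "(sw ^^ n) x" and ?h = "trn x n g"
  have "cj ?h ?y \<in> grp S" unfolding cj_trn using sw_funpow_grp cj_mon_grp[OF x g] by blast
  then have "is_meet (- den (cj ?h ?y)) 0 (cj ?h ?y)" by (rule is_meet_den)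
  then have "is_meet (den ?y + ?h + - den (cj ?h ?y)) (den ?y + ?h + 0) (den ?y + ?h + cj ?h ?y)"
    by (simp only: is_meet_left)
  moreover have "den ?y + ?h + cj ?h ?y = den ?y + ?y + ?h" by (simp only: cj_def group_nf)
  ultimately show ?thesis unfolding trn_Suc cj_trn[symmetric] by simp
qed

lemma trn_pos:
  assumes x: "x \<in> grp S" and g: "g \<in> mon S"
  shows "trn x n g \<in> mon S"
proof (induction n)
  case (Suc n)
  have "(sw ^^ n) x \<in> grp S" using sw_funpow_grp x by blast
  then show ?case using Suc den_pos num_pos mon_add is_meet_pos[OF is_meet_trn[OF x g]] by blast
qed (use g in simp)

lemma trn_mono:
  assumes x: "x \<in> grp S" and "g \<in> mon S" "g \<preceq> h"
  shows "trn x n g \<preceq> trn x n h"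
proof (induction n)
  case (Suc n)
  have "h \<in> mon S" using assms le_pos by blast
  then show ?case using is_meet_mono[OF is_meet_trn[OF x assms(2)] is_meet_trn[OF x]] Suc by simp
qed (use assms in simp)

lemma trn_meet:
  assumes x: "x \<in> grp S" and g: "g \<in> mon S" and h: "h \<in> mon S" and u: "is_meet u g h"
  shows "is_meet (trn x n u) (trn x n g) (trn x n h)"
proof (induction n)
  case (Suc n)
  let ?a = "den ((sw ^^ n) x)" and ?b = "den ((sw ^^ n) x) + (sw ^^ n) x"
  have uS: "u \<in> mon S" using is_meet_pos[OF u g h] .
  note G = is_meet_trn[OF x g, of n] and H = is_meet_trn[OF x h, of n] and U = is_meet_trn[OF x uS, of n]
  have "e \<preceq> trn x (Suc n) u" if e: "e \<preceq> trn x (Suc n) g" "e \<preceq> trn x (Suc n) h" for e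
  proof -
    have "e \<preceq> ?a + trn x n g" "e \<preceq> ?b + trn x n g" "e \<preceq> ?a + trn x n h" "e \<preceq> ?b + trn x n h"
      using e G H le_trans unfolding is_meet_def by blast+
    then have "e \<preceq> ?a + trn x n u" "e \<preceq> ?b + trn x n u"
      using is_meet_left[of ?a "trn x n u" "trn x n g" "trn x n h"]
        is_meet_left[of ?b "trn x n u" "trn x n g" "trn x n h"] Suc unfolding is_meet_def by blast+
    then show ?thesis using U unfolding is_meet_def by blast
  qed
  then show ?case using trn_mono[OF x uS] u unfolding is_meet_def by blast
qed (use u in simp)

text \<open>Such a conjugator commutes with the formation of denominators by \<open>den_cj\<close>.
  Being their own transports, powers of Delta and ribbons give bounds that persist under
  transport.\<close>

lemma trn_normal:
  assumes "X \<subseteq> S" "Y \<subseteq> S" "cj u ` X = Y" "x \<in> grp X"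
  shows "trn x n u = u"
proof (induction n)
  case (Suc n)
  have "den ((sw ^^ n) (cj u x)) = cj u (den ((sw ^^ n) x))"
    unfolding sw_funpow_cj[OF assms] using den_cj[OF assms(1-3)] sw_funpow_grp[OF assms(1,4)] by blast
  then show ?case unfolding trn_Suc Suc by (simp only: cj_def group_nf)
qed simp

lemma funpow_period: "(f ^^ n) x = x \<Longrightarrow> (f ^^ (n * k)) x = x"
  by (induction k) (simp_all add: funpow_add)

text \<open>Along the multiples of a common period \<open>K\<close> of \<open>x\<close> and
  \<open>cj g x\<close>, all transports divide one power of Delta. Their lengths are therefore
  bounded and two of them coincide. Transport by a multiple of \<open>K\<close> only adds fixed
  terms on the left and right, so the coincidence can be pulled back to \<open>g\<close>
  itself.\<close>

lemma trn_periodic: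
  assumes "recurrent x" and g: "g \<in> mon S" and "recurrent (cj g x)"
  shows "\<exists>N>0. (sw ^^ N) x = x \<and> trn x N g = g"
proof -
  have x: "x \<in> grp S" using assms by (simp add: recurrent_def)
  obtain m m' where m: "m > 0" "(sw ^^ m) x = x" "m' > 0" "(sw ^^ m') (cj g x) = cj g x"
    using assms unfolding recurrent_def by blast
  define K where "K = m * m'"
  have K: "(sw ^^ (K * k)) x = x" "(sw ^^ (K * k)) (cj g x) = cj g x" for k
    using funpow_period[OF m(2), of "m' * k"] funpow_period[OF m(4), of "m * k"]
    by (simp_all add: K_def ac_simps)
  obtain p where p: "g \<preceq> \<Delta> p" using le_pw[OF subset_refl g] by blast
  have "trn x n g \<in> {a \<in> mon S. len a \<le> len (\<Delta> p)}" for n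
  proof -
    have "trn x n g \<preceq> \<Delta> p"
      using trn_mono[OF x g p, of n] trn_normal[OF subset_refl subset_refl cj_pw_image x, of n p] by simp
    then show ?thesis using trn_pos[OF x g] len_le by simp
  qed
  then have "finite (range (\<lambda>j. trn x (K * j) g))"
    by (intro finite_subset[OF _ finite_len[of "len (\<Delta> p)"]]) blast
  then have "\<not> inj (\<lambda>j. trn x (K * j) g)" using finite_imageD infinite_UNIV_nat by blast
  then obtain i j where ij: "i < j" "trn x (K * i) g = trn x (K * j) g"
    unfolding inj_on_def by (metis nat_neq_iff)
  have "K * j = K * (j - i) + K * i" using ij(1) by (metis add_mult_distrib2 le_add_diff_inverse2 less_imp_le_nat)
  then have "Den x (K * j) = Den x (K * i) + Den x (K * (j - i))"
    "Den (cj g x) (K * j) = Den (cj g x) (K * i) + Den (cj g x) (K * (j - i))"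
    by (simp_all only: Den_add K)
  then have "Den x (K * i) + g - Den (cj g x) (K * i) =
      Den x (K * i) + (trn x (K * (j - i)) g) - Den (cj g x) (K * i)"
    using ij(2) by (simp only: trn_def group_nf)
  then have "trn x (K * (j - i)) g = g"
    by (simp only: diff_conv_add_uminus add_right_cancel add_left_cancel)
  moreover have "K * (j - i) > 0" using m ij by (simp add: K_def)
  ultimately show ?thesis using K by blast
qed

lemma trn_period_mult:
  assumes N: "(sw ^^ N) x = x" "trn x N g = g"
  shows "trn x (N * k) g = g"
proof (induction k)
  case (Suc k)
  have "(sw ^^ N) (cj g x) = cj g x" using cj_trn[of x N g] N by simp
  then have "Den x (N * Suc k) = Den x (N * k) + Den x N"
    "Den (cj g x) (N * Suc k) = Den (cj g x) (N * k) + Den (cj g x) N"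
    using N by (simp_all add: Den_add)
  then have "trn x (N * Suc k) g = Den x (N * k) + trn x N g - Den (cj g x) (N * k)"
    by (simp only: trn_def group_nf)
  then show ?case using Suc N by (simp add: trn_def)
qed simp

lemma recurrent_meet:
  assumes x: "recurrent x" and g: "g \<in> mon S" "recurrent (cj g x)"
    and h: "h \<in> mon S" "recurrent (cj h x)" and u: "is_meet u g h"
  shows "recurrent (cj u x)"
proof -
  have xS: "x \<in> grp S" using x by (simp add: recurrent_def)
  obtain n where n: "n > 0" "(sw ^^ n) x = x" "trn x n g = g" using trn_periodic[OF x g] by blast
  obtain m where m: "m > 0" "(sw ^^ m) x = x" "trn x m h = h" using trn_periodic[OF x h] by blast
  have "trn x (n * m) g = g" "trn x (n * m) h = h"
    using trn_period_mult[OF n(2,3), of m] trn_period_mult[OF m(2,3), of n] by (simp_all add: mult.commute)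
  then have "is_meet (trn x (n * m) u) g h" using trn_meet[OF xS g(1) h(1) u, of "n * m"] by simp
  then have "trn x (n * m) u = u" using is_meet_unique u by blast
  then have "(sw ^^ (n * m)) (cj u x) = cj u x"
    using cj_trn[of x "n * m" u] funpow_period[OF n(2), of m] by simp
  moreover have "cj u x \<in> grp S" using cj_mon_grp[OF xS] is_meet_pos[OF u g(1) h(1)] by blast
  ultimately show ?thesis unfolding recurrent_def using n(1) m(1) by (intro conjI exI[of _ "n * m"]) simp_all
qed

section \<open>Ribbons and the conjugation of supports\<close>

definition ribbon :: "'a set \<Rightarrow> 'a" where
  "ribbon X = - D X + D S"

lemma ribbon_pos: "X \<subseteq> S \<Longrightarrow> ribbon X \<in> mon S"
  using D_le[of X] by (simp add: ribbon_def le_def)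

lemma cj_ribbon:
  assumes "X \<subseteq> S" shows "cj (ribbon X) ` X \<subseteq> S"
proof -
  have "cj (ribbon X) ` X = cj (D S) ` cj (- D X) ` X" by (simp add: image_image cj_cj ribbon_def)
  also have "cj (- D X) ` X = X" by (rule cj_image_inverse[OF cj_D_image[OF assms]])
  finally show ?thesis using assms cj_D_image[of S] by blast
qed

text \<open>Moving a divisor of the ribbon past the letters of \<open>a\<close> cannot shorten it, and the length is
  kept only if every letter is conjugated to a generator.\<close>

lemma ribbon_divisor_letters:
  assumes X: "X \<subseteq> S" and "a \<in> mon X" "k \<in> mon S" "g \<in> mon S" "g \<preceq> ribbon X" "g \<preceq> a + k"
  shows "len g \<le> len k \<and> (len g = len k \<longrightarrow> k = g \<and> (\<forall>t\<in>supp a. cj g t \<in> S))"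
  using assms(2,4-6)
proof (induction arbitrary: g rule: mon.induct)
  case zero
  then have "g \<preceq> k" by simp
  then obtain c where c: "c \<in> mon S" "k = g + c" by (rule leE)
  then have "len k = len g + len c" using zero by (simp add: len_add)
  moreover have "c = 0" if "len c = 0" using len_zeroD[OF c(1) that] .
  ultimately show ?case using c(2) by (auto simp: supp_0)
next
  case (gen_add t a)
  have t: "t \<in> S" and aS: "a \<in> mon S" using gen_add X monS by auto
  let ?r = "ribbon X"
  \<comment> \<open>\<open>g1\<close> is the divisor of the ribbon that is passed on to the
    remaining letters \<open>a\<close>. The ribbon conjugates \<open>t\<close> to a generator and so
    divides \<open>t + ?r\<close>; hence \<open>g\<close> divides the meet
    \<open>t + g1\<close>.\<close>
  obtain g1 where g1: "is_meet g1 (a + k) ?r"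
    using is_meet_ex[of "a + k" ?r] mon_grp mon_add aS assms(3) ribbon_pos[OF X] by blast
  have g1S: "g1 \<in> mon S" by (rule is_meet_pos[OF g1]) (use aS assms(3) ribbon_pos[OF X] mon_add in auto)
  have "cj ?r t \<in> S" using cj_ribbon[OF X] gen_add by blast
  then have "?r \<preceq> t + ?r" using le_addR[OF mon_gen[of "cj ?r t" S], of ?r] by (simp add: cj_swap)
  then have "g \<preceq> t + ?r" using gen_add.prems le_trans by blast
  moreover have "g \<preceq> t + (a + k)" using gen_add.prems by (simp add: add.assoc)
  moreover have "is_meet (t + g1) (t + (a + k)) (t + ?r)" using g1 by (simp only: is_meet_left)
  ultimately have "g \<preceq> t + g1" by (simp add: is_meet_def)
  then obtain h where h: "h \<in> mon S" "t + g1 = g + h" by (rule leE)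
  have IH: "len g1 \<le> len k \<and> (len g1 = len k \<longrightarrow> k = g1 \<and> (\<forall>t\<in>supp a. cj g1 t \<in> S))"
    using gen_add.IH[OF g1S] g1 by (simp add: is_meet_def)
  have lens: "1 + len g1 = len g + len h"
    using len_add[OF mon_gen[OF t] g1S] len_add[OF gen_add.prems(1) h(1)] h(2) len_gen[OF t] by simp
  \<comment> \<open>If \<open>h\<close> were trivial, \<open>t\<close> would be a left divisor of
    the ribbon. So \<open>h\<close> uses up at least one letter, and \<open>g1\<close> is at least
    as long as \<open>g\<close>.\<close>
  have "len h \<noteq> 0"
  proof
    assume "len h = 0"
    then have "t + g1 = g" using h(2) len_zeroD[OF h(1)] by simp
    then have "t \<preceq> ?r" using le_addR[OF g1S, of t] gen_add.prems(2) le_trans by simp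
    then show False using not_le_r[OF X gen_add(1)] by (simp add: ribbon_def)
  qed
  show ?case
  proof (intro conjI impI)
    show "len g \<le> len k" using lens IH \<open>len h \<noteq> 0\<close> by linarith
    assume eq: "len g = len k"
    then have "len h = 1" and g1k: "len g1 = len k" using lens IH \<open>len h \<noteq> 0\<close> by linarith+
    then have hS: "h \<in> S" using h len_oneD by blast
    have "g1 = g"
    proof (rule exchange[OF X gen_add(1) hS gen_add.prems(1) g1S _ _ h(2)])
      show "g \<preceq> - D X + D S" "g1 \<preceq> - D X + D S"
        using gen_add.prems(2) g1 by (simp_all add: ribbon_def is_meet_def)
    qed
    then show "k = g" using IH g1k by simp
    have "cj g t = - g + (t + g1)" using \<open>g1 = g\<close> by (simp add: cj_def add.assoc)
    also have "\<dots> = h" unfolding h(2) by (simp only: minus_add_cancel)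
    finally have "cj g t \<in> S" using hS by simp
    then show "\<forall>t\<in>supp (t + a). cj g t \<in> S"
      using IH g1k \<open>g1 = g\<close> supp_add[OF mon_gen[OF t] aS] supp_gen[OF t] by simp
  qed
qed

text \<open>All transports of \<open>u\<close> divide the ribbon, which is its own transport. Each
  of them divides the denominator, and also the numerator, times the preceding transport, so lengths
  never increase. As \<open>u\<close> returns after \<open>N\<close> steps, the length is already
  kept at the first step, which is the case of equality in
  \<open>ribbon_divisor_letters\<close>.\<close>

lemma ribbon_conj:
  assumes x: "recurrent x" and u: "u \<in> mon S" "recurrent (cj u x)" "u \<preceq> ribbon (spt x)"
  shows "\<forall>t\<in>spt x. cj u t \<in> S"
proof -
  let ?X = "spt x"
  have xS: "x \<in> grp S" using x by (simp add: recurrent_def)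
  have X: "?X \<subseteq> S" by (rule spt_S[OF xS])
  obtain N where N: "N > 0" "trn x N u = u" using trn_periodic[OF x u(1,2)] by blast
  have pos: "trn x n u \<in> mon S" for n by (rule trn_pos[OF xS u(1)])
  have le: "trn x n u \<preceq> ribbon ?X" for n
    using trn_mono[OF xS u(1,3), of n] trn_normal[OF X cj_ribbon[OF X] HOL.refl grp_spt[OF xS], of n] by simp
  have grpX: "(sw ^^ n) x \<in> grp ?X" for n by (rule sw_funpow_grp[OF X grp_spt[OF xS]])
  have num: "trn x (Suc n) u \<preceq> den ((sw ^^ n) x) + (sw ^^ n) x + trn x n u"
   and den: "trn x (Suc n) u \<preceq> den ((sw ^^ n) x) + trn x n u" for n
    using is_meet_trn[OF xS u(1), of n] by (simp_all add: is_meet_def)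
  note L = ribbon_divisor_letters[OF X den_grp(1)[OF X grpX] pos pos le den]
    and L' = ribbon_divisor_letters[OF X den_grp(2)[OF X grpX] pos pos le num]
  have mono: "len (trn x (Suc n + k) u) \<le> len (trn x (Suc n) u)" for n k
  proof (induction k)
    case (Suc k)
    then show ?case using L[of "Suc n + k"] by (simp del: trn_Suc)
  qed simp
  have "len (trn x N u) \<le> len (trn x (Suc 0) u)" using mono[of 0 "N - 1"] N(1) by simp
  then have eq: "len (trn x (Suc 0) u) = len (trn x 0 u)" using L[of 0] N(2) by simp
  then have "u = trn x (Suc 0) u" using L[of 0] by simp
  then have "\<forall>t\<in>supp (den x). cj u t \<in> S" "\<forall>t\<in>supp (den x + x). cj u t \<in> S"
    using L[of 0] L'[of 0] eq by auto
  then show ?thesis unfolding spt_def by blast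
qed

text \<open>A nontrivial piece can always be split off \<open>g\<close>: if \<open>g\<close> has
  trivial meet with \<Delta>_X, its first letter lies outside X and therefore divides the ribbon. A
  piece of \<Delta>_X acts inside A_X, where the support might a priori shrink; this is why only an
  inequality of cardinalities is claimed.\<close>

lemma spt_conj:
  assumes "recurrent x" "g \<in> mon S" "recurrent (cj g x)"
  shows "card (spt (cj g x)) \<le> card (spt x) \<and>
    (card (spt (cj g x)) = card (spt x) \<longrightarrow> cj g ` grp (spt x) = grp (spt (cj g x)))"
  using assms
proof (induction "len g" arbitrary: g x rule: less_induct)
  case less
  let ?X = "spt x"
  note x = less.prems(1) and g = less.prems(2,3)
  have xS: "x \<in> grp S" using x by (simp add: recurrent_def)
  have X: "?X \<subseteq> S" by (rule spt_S[OF xS])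
  have xX: "x \<in> grp ?X" by (rule grp_spt[OF xS])
  have split: ?case if u: "u \<in> mon S" "u \<noteq> 0" "u \<preceq> g" "recurrent (cj u x)"
    "card (spt (cj u x)) \<le> card ?X \<and>
      (card (spt (cj u x)) = card ?X \<longrightarrow> cj u ` grp ?X = grp (spt (cj u x)))" for u
  proof -
    obtain v where v: "v \<in> mon S" "g = u + v" using u(3) by (rule leE)
    have "len v < len g" using v u(1,2) len_zeroD by (auto simp: len_add)
    moreover have gx: "cj g x = cj v (cj u x)" by (simp add: v(2) cj_cj)
    ultimately have "card (spt (cj g x)) \<le> card (spt (cj u x)) \<and>
      (card (spt (cj g x)) = card (spt (cj u x)) \<longrightarrow> cj v ` grp (spt (cj u x)) = grp (spt (cj g x)))"
      using less.hyps[of v "cj u x"] u(4) v(1) g(2) by simp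
    moreover have "cj g ` grp ?X = cj v ` cj u ` grp ?X" by (simp add: image_image v(2) cj_cj)
    ultimately show ?thesis using u(5) by auto
  qed
  show ?case
  proof (cases "g = 0")
    case False
    obtain u where u: "is_meet u g (D ?X)"
      using is_meet_ex mon_grp g(1) grpS[OF X] D_mon[OF X] by meson
    have DS: "D ?X \<in> mon S" using D_mon[OF X] monS[OF X] by blast
    have uS: "u \<in> mon S" by (rule is_meet_pos[OF u g(1) DS])
    show ?thesis
    proof (cases "u = 0")
      case False
      have "recurrent (cj (D ?X) x)" by (rule recurrent_cj[OF X X cj_D_image[OF X] xX x])
      then have rec: "recurrent (cj u x)" by (rule recurrent_meet[OF x g DS _ u])
      have uX: "u \<in> mon ?X" using le_mon[OF X uS _ D_mon[OF X]] u by (simp add: is_meet_def)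
      then have im: "cj u ` grp ?X = grp ?X" by (intro grp_cj_image[OF X] mon_grp)
      then have "cj u x \<in> grp ?X" using xX by blast
      then have sub: "spt (cj u x) \<subseteq> ?X" using grp_iff_spt[OF X grpS[OF X]] by blast
      show ?thesis
      proof (rule split[OF uS False _ rec])
        show "u \<preceq> g" using u by (simp add: is_meet_def)
        show "card (spt (cj u x)) \<le> card ?X \<and>
            (card (spt (cj u x)) = card ?X \<longrightarrow> cj u ` grp ?X = grp (spt (cj u x)))"
          using sub im card_mono[OF finite_spt[OF xS] sub] card_subset_eq[OF finite_spt[OF xS] sub] by auto
      qed
    next
      case True
      from g(1) \<open>g \<noteq> 0\<close> obtain s where s: "s \<in> S" "s \<preceq> g"
        by cases (auto intro: le_addR)
      have "s \<notin> ?X"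
      proof
        assume "s \<in> ?X"
        then have "s \<preceq> u" using u s(2) le_D[OF X] by (simp add: is_meet_def)
        then have "- s \<in> mon S" using True by (simp add: le_def)
        then show False using pos_antisym[OF mon_gen[OF s(1)]] gen_nonzero[OF s(1)] by simp
      qed
      note rS = ribbon_pos[OF X]
      obtain w where w: "is_meet w g (ribbon ?X)"
        using is_meet_ex mon_grp g(1) rS by meson
      have wS: "w \<in> mon S" by (rule is_meet_pos[OF w g(1) rS])
      have "s \<preceq> w" using w s(2) le_r[OF X s(1) \<open>s \<notin> ?X\<close>] by (simp add: is_meet_def ribbon_def)
      have "w \<noteq> 0"
      proof
        assume "w = 0"
        then have "- s \<in> mon S" using \<open>s \<preceq> w\<close> by (simp add: le_def)
        then show False using pos_antisym[OF mon_gen[OF s(1)]] gen_nonzero[OF s(1)] by simp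
      qed
      have "recurrent (cj (ribbon ?X) x)" by (rule recurrent_cj[OF X cj_ribbon[OF X] HOL.refl xX x])
      then have rec: "recurrent (cj w x)" by (rule recurrent_meet[OF x g rS _ w])
      have "\<forall>t\<in>?X. cj w t \<in> S" by (rule ribbon_conj[OF x wS rec]) (use w in \<open>simp add: is_meet_def\<close>)
      then have Y: "cj w ` ?X \<subseteq> S" by blast
      have spt: "spt (cj w x) = cj w ` ?X" by (rule spt_cj[OF X Y HOL.refl xX])
      show ?thesis
      proof (rule split[OF wS \<open>w \<noteq> 0\<close> _ rec])
        show "w \<preceq> g" using w by (simp add: is_meet_def)
        show "card (spt (cj w x)) \<le> card ?X \<and>
            (card (spt (cj w x)) = card ?X \<longrightarrow> cj w ` grp ?X = grp (spt (cj w x)))"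
          unfolding spt using cj_grp[OF HOL.refl] card_image[OF inj_cj] by (metis order_refl)
      qed
    qed
  qed simp
qed

text \<open>The conjugator \<open>c\<close> is made positive by a power of Delta, and a second
  positive conjugator leads on to \<open>cj (\<Delta> l) x\<close>. Its support is as large as that
  of \<open>x\<close>, so both inequalities of \<open>spt_conj\<close> are equalities. The powers of
  Delta permute S and are removed at the end.\<close>

lemma recurrent_spt_conj:
  assumes x: "recurrent x" and c: "c \<in> grp S" and y: "recurrent (cj c x)"
  shows "cj c ` grp (spt x) = grp (spt (cj c x))"
proof -
  have xS: "x \<in> grp S" using x by (simp add: recurrent_def)
  have yS: "cj c x \<in> grp S" using y by (simp add: recurrent_def)
  note D = cj_pw_image[OF subset_refl]
  have rec: "recurrent (cj (\<Delta> n) z)" if "recurrent z" for n z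
    using recurrent_cj[OF subset_refl subset_refl D _ that] that by (simp add: recurrent_def)
  have spt: "spt (cj (\<Delta> n) z) = cj (\<Delta> n) ` spt z" if "z \<in> grp S" for n z
    by (rule spt_cj[OF subset_refl subset_refl D that])
  obtain n where n: "c + \<Delta> n \<in> mon S" using Delta_shift[OF c] by blast
  have z: "cj (c + \<Delta> n) x = cj (\<Delta> n) (cj c x)" by (simp add: cj_cj)
  note F = spt_conj[OF x n, unfolded z, OF rec[OF y]]
  obtain l where "c + \<Delta> n \<preceq> \<Delta> l" 
    using Delta_shift[OF grp_add[OF subset_refl c mon_grp[OF Delta_mon]]] by blast
  then have l: "- (c + \<Delta> n) + \<Delta> l \<in> mon S" by (simp only: le_def)
  have "cj (- (c + \<Delta> n) + \<Delta> l) (cj (\<Delta> n) (cj c x)) = cj (\<Delta> l) x"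
    by (simp only: cj_def group_nf)
  note B = spt_conj[OF rec[OF y] l, of n, unfolded this, OF rec[OF x]]
  have "card (spt (cj (\<Delta> l) x)) = card (spt x)" unfolding spt[OF xS] by (rule card_image[OF inj_cj])
  then have "cj (c + \<Delta> n) ` grp (spt x) = grp (spt (cj (\<Delta> n) (cj c x)))" using F B by linarith
  also have "\<dots> = cj (\<Delta> n) ` grp (spt (cj c x))" unfolding spt[OF yS] by (rule cj_grp[OF HOL.refl, symmetric])
  finally have "cj (\<Delta> n) ` cj c ` grp (spt x) = cj (\<Delta> n) ` grp (spt (cj c x))"
    by (simp add: image_image cj_cj)
  then show ?thesis by (simp only: inj_image_eq_iff[OF inj_cj])
qed

section \<open>The least parabolic subgroup\<close>

theorem least_parabolic:
  assumes x: "x \<in> grp S"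
  shows "\<exists>X h. X \<subseteq> S \<and> h \<in> grp S \<and> cj h x \<in> grp X \<and>
    (\<forall>Y k. Y \<subseteq> S \<longrightarrow> k \<in> grp S \<longrightarrow> cj k x \<in> grp Y \<longrightarrow> cj (- h) ` grp X \<subseteq> cj (- k) ` grp Y)"
proof -
  obtain n where n: "recurrent ((sw ^^ n) x)" using ex_recurrent[OF x] by blast
  define h where "h = - Den x n"
  have x0: "(sw ^^ n) x = cj h x" by (simp add: sw_funpow h_def)
  have hS: "h \<in> grp S" unfolding h_def by (intro grp_minus mon_grp Den_grp x) simp
  have x0S: "cj h x \<in> grp S" using grp_cj x hS by blast
  have "cj (- h) ` grp (spt (cj h x)) \<subseteq> cj (- k) ` grp Y"
    if Y: "Y \<subseteq> S" and k: "k \<in> grp S" and kx: "cj k x \<in> grp Y" for Y k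
  proof -
    obtain l where l: "recurrent ((sw ^^ l) (cj k x))" using ex_recurrent[OF grpS[OF Y kx]] by blast
    define h' where "h' = - Den (cj k x) l"
    have h': "h' \<in> grp Y" unfolding h'_def by (intro grp_minus mon_grp Den_grp Y kx)
    \<comment> \<open>\<open>c\<close> joins the two recurrent conjugates of \<open>x\<close>. Its
      last factor \<open>h'\<close> lies in \<open>grp Y\<close> and hence normalizes it, so this
      factor disappears when the inclusion is conjugated back.\<close>
    define c where "c = - h + k + h'"
    have cS: "c \<in> grp S" unfolding c_def
      by (rule grp_add[OF subset_refl grp_add[OF subset_refl grp_minus[OF hS] k] grpS[OF Y h']])
    have y0: "(sw ^^ l) (cj k x) = cj c (cj h x)"
      by (simp only: sw_funpow cj_cj c_def h'_def group_nf)
    have rec: "recurrent (cj c (cj h x))" using l y0 by simp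
    have eq: "cj c ` grp (spt (cj h x)) = grp (spt (cj c (cj h x)))"
      by (rule recurrent_spt_conj[OF _ cS rec]) (use n x0 in simp)
    have "cj c (cj h x) \<in> grp Y" unfolding y0[symmetric] by (rule sw_funpow_grp[OF Y kx])
    then have "spt (cj c (cj h x)) \<subseteq> Y" using grp_iff_spt[OF Y grpS[OF Y]] by blast
    then have "cj c ` grp (spt (cj h x)) \<subseteq> grp Y" unfolding eq by (rule grp_mono)
    then have "cj (- (k + h')) ` cj c ` grp (spt (cj h x)) \<subseteq> cj (- (k + h')) ` grp Y" by (rule image_mono)
    moreover have "cj (- (k + h')) ` cj c ` Z = cj (- h) ` Z" for Z
      by (simp only: image_image cj_cj c_def group_nf)
    moreover have "cj (- (k + h')) ` grp Y = cj (- k) ` cj (- h') ` grp Y"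
      by (simp only: image_image cj_cj minus_add)
    moreover have "cj (- h') ` grp Y = grp Y" by (rule grp_cj_image[OF Y grp_minus[OF h']])
    ultimately show ?thesis by simp
  qed
  then show ?thesis using spt_S[OF x0S] hS grp_spt[OF x0S] by blast
qed

end

section \<open>Words modulo relations\<close>

definition wstep :: "('s list \<times> 's list) set \<Rightarrow> 's list \<Rightarrow> 's list \<Rightarrow> bool" where
  "wstep R u v \<longleftrightarrow> (\<exists>p q l r. u = p @ l @ q \<and> v = p @ r @ q \<and> ((l, r) \<in> R \<or> (r, l) \<in> R))"

definition weq :: "('s list \<times> 's list) set \<Rightarrow> 's list \<Rightarrow> 's list \<Rightarrow> bool" where
  "weq R = (wstep R)\<^sup>*\<^sup>*"

lemma weq_refl [simp]: "weq R u u"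
  by (simp add: weq_def)

lemma weq_trans [trans]: "weq R u v \<Longrightarrow> weq R v w \<Longrightarrow> weq R u w"
  by (simp add: weq_def)

lemma weq_sym: "weq R u v \<Longrightarrow> weq R v u"
proof -
  have "symp (wstep R)" unfolding wstep_def by (rule sympI) blast
  then show "weq R u v \<Longrightarrow> weq R v u" unfolding weq_def by (rule sympD[OF symp_rtranclp])
qed

lemma weq_rel: "(l, r) \<in> R \<Longrightarrow> weq R l r"
proof -
  assume "(l, r) \<in> R"
  moreover have "l = [] @ l @ []" "r = [] @ r @ []" by simp_all
  ultimately have "wstep R l r" unfolding wstep_def by blast
  then show "weq R l r" unfolding weq_def by (rule r_into_rtranclp)
qed

lemma weq_invariant:
  assumes "weq R u v" "\<And>u v. wstep R u v \<Longrightarrow> f u = f v"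
  shows "f u = f v"
  using assms(1) unfolding weq_def by induction (use assms(2) in auto)

lemma weq_ctx:
  assumes "weq R u v" shows "weq R (p @ u @ q) (p @ v @ q)"
  using assms unfolding weq_def
proof induction
  case (step v w)
  obtain p' q' l r where *: "v = p' @ l @ q'" "w = p' @ r @ q'" "(l, r) \<in> R \<or> (r, l) \<in> R"
    using step(2) unfolding wstep_def by blast
  then have "p @ v @ q = (p @ p') @ l @ (q' @ q)" "p @ w @ q = (p @ p') @ r @ (q' @ q)" by simp_all
  then have "wstep R (p @ v @ q) (p @ w @ q)" unfolding wstep_def using *(3) by blast
  then show ?case using step by simp
qed simp

lemma weq_append:
  assumes "weq R u u'" "weq R v v'" shows "weq R (u @ v) (u' @ v')"
proof -
  have "weq R (u @ v) (u' @ v)" using weq_ctx[OF assms(1), of "[]" v] by simp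
  also have "weq R (u' @ v) (u' @ v')" using weq_ctx[OF assms(2), of u' "[]"] by simp
  finally show ?thesis .
qed

lemma weq_left: "weq R u v \<Longrightarrow> weq R (p @ u) (p @ v)"
  by (simp add: weq_append)

lemma weq_right: "weq R u v \<Longrightarrow> weq R (u @ p) (v @ p)"
  by (simp add: weq_append)

lemma weq_Cons: "weq R u v \<Longrightarrow> weq R (s # u) (s # v)"
  using weq_left[of R u v "[s]"] by simp

lemma weq_mono:
  assumes "R \<subseteq> R'" "weq R u v" shows "weq R' u v"
proof -
  have "wstep R \<le> wstep R'" using assms(1) unfolding wstep_def by blast
  from predicate2D[OF rtranclp_mono[OF this]] assms(2) show ?thesis unfolding weq_def .
qed

fun alt :: "nat \<Rightarrow> 's \<Rightarrow> 's \<Rightarrow> 's list" where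
  "alt 0 s t = []"
| "alt (Suc n) s t = s # alt n t s"

lemma length_alt [simp]: "length (alt n s t) = n"
  by (induction n arbitrary: s t) auto

lemma set_alt: "set (alt n s t) \<subseteq> {s, t}"
  by (induction n arbitrary: s t) auto

lemma alt_add: "alt (k + l) s t = alt k s t @ (if even k then alt l s t else alt l t s)"
  by (induction k arbitrary: s t) auto

lemma alt_snoc: "alt (Suc n) s t = alt n s t @ [if even n then s else t]"
  using alt_add[of n 1 s t] by simp

lemma rev_alt: "rev (alt n s t) = (if even n then alt n t s else alt n s t)"
proof (induction n arbitrary: s t)
  case (Suc n)
  have "rev (alt (Suc n) s t) = rev (alt n t s) @ [s]" by simp
  also have "\<dots> = (if even (Suc n) then alt (Suc n) t s else alt (Suc n) s t)"
    unfolding Suc alt_snoc by simp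
  finally show ?case .
qed simp

definition braid_rel :: "('s \<Rightarrow> 's \<Rightarrow> nat) \<Rightarrow> ('s list \<times> 's list) set" where
  "braid_rel m = {(alt (m s t) s t, alt (m s t) t s) |s t. s \<noteq> t \<and> m s t \<noteq> 0}"

definition cox_rel :: "('s \<Rightarrow> 's \<Rightarrow> nat) \<Rightarrow> ('s list \<times> 's list) set" where
  "cox_rel m = braid_rel m \<union> {([s, s], []) |s. True}"

section \<open>Coxeter groups\<close>

text \<open>The value \<open>0\<close> of \<open>m\<close> encodes \<open>\<infinity>\<close>.\<close>

locale coxeter =
  fixes m :: "'s \<Rightarrow> 's \<Rightarrow> nat"
  assumes m_sym: "m s t = m t s" and m_ne_1: "s \<noteq> t \<Longrightarrow> m s t \<noteq> 1"
begin

section \<open>Words up to Coxeter and braid relations\<close>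

abbreviation ceq (infix "\<approx>" 50) where "u \<approx> v \<equiv> weq (cox_rel m) u v"
abbreviation beq (infix "\<sim>" 50) where "u \<sim> v \<equiv> weq (braid_rel m) u v"

lemma beq_imp_ceq: "u \<sim> v \<Longrightarrow> u \<approx> v"
  by (rule weq_mono[of "braid_rel m"]) (auto simp: cox_rel_def)

lemma beq_braid: "s \<noteq> t \<Longrightarrow> m s t \<noteq> 0 \<Longrightarrow> alt (m s t) s t \<sim> alt (m s t) t s"
  by (rule weq_rel) (auto simp: braid_rel_def)

lemma beq_length: "u \<sim> v \<Longrightarrow> length u = length v"
  by (rule weq_invariant) (auto simp: wstep_def braid_rel_def)

lemma set_alt_eq: assumes "n \<ge> 2" shows "set (alt n s t) = {s, t}"
proof -
  obtain k where "n = Suc (Suc k)" using le_Suc_ex[OF assms] by auto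
  then show ?thesis using set_alt[of k s t] by auto
qed

text \<open>Both sides of a braid relation contain both letters because their length is at least 2.
  The support of a positive element is well defined for this reason.\<close>

lemma beq_set:
  assumes "u \<sim> v" shows "set u = set v"
proof (rule weq_invariant[OF assms])
  fix u v assume "wstep (braid_rel m) u v"
  moreover have "set (alt (m s t) s t) = {s, t}" "set (alt (m s t) t s) = {s, t}"
    if "s \<noteq> t" "0 < m s t" for s t
    using set_alt_eq[of "m s t" s t] set_alt_eq[of "m s t" t s] m_ne_1[OF that(1)] that(2) by auto
  ultimately show "set u = set v" unfolding wstep_def braid_rel_def by auto
qed

lemma cox_cancel: "[s, s] \<approx> []"
  by (rule weq_rel) (auto simp: cox_rel_def)

lemma ceq_length_parity: "u \<approx> v \<Longrightarrow> even (length u) = even (length v)"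
  by (rule weq_invariant) (auto simp: wstep_def braid_rel_def cox_rel_def)

lemma ceq_cong1: "t \<approx> t' \<Longrightarrow> t \<approx> u \<longleftrightarrow> t' \<approx> u"
  by (rule iffI, erule weq_trans[OF weq_sym], assumption, erule weq_trans)

lemma ceq_cong2: "t \<approx> t' \<Longrightarrow> u \<approx> t \<longleftrightarrow> u \<approx> t'"
  by (rule iffI, erule weq_trans, assumption, erule weq_trans, erule weq_sym)

lemma inv_right: "u @ rev u \<approx> []"
proof (induction u)
  case (Cons s u)
  have "[s] @ (u @ rev u) @ [s] \<approx> [s] @ [] @ [s]" by (rule weq_ctx[OF Cons])
  also have "[s] @ [] @ [s] \<approx> []" using cox_cancel by simp
  finally show ?case by simp
qed simp

lemma inv_left: "rev u @ u \<approx> []"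
  using inv_right[of "rev u"] by simp

lemma inv_left_app: "rev p @ p @ u \<approx> u"
  using weq_right[OF inv_left[of p], of u] by simp

lemma inv_right_app: "p @ rev p @ u \<approx> u"
  using weq_right[OF inv_right[of p], of u] by simp

lemma cancel_left [simp]: "p @ u \<approx> p @ v \<longleftrightarrow> u \<approx> v"
proof
  assume "p @ u \<approx> p @ v"
  then have "rev p @ p @ u \<approx> rev p @ p @ v" by (rule weq_left)
  then show "u \<approx> v" unfolding ceq_cong1[OF inv_left_app] ceq_cong2[OF inv_left_app] .
qed (rule weq_left)

lemma cancel_Cons [simp]: "s # u \<approx> s # v \<longleftrightarrow> u \<approx> v"
  using cancel_left[of "[s]"] by simp

lemma cancel_right [simp]: "u @ p \<approx> v @ p \<longleftrightarrow> u \<approx> v"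
proof
  assume "u @ p \<approx> v @ p"
  then have "u @ (p @ rev p) \<approx> v @ (p @ rev p)" using weq_right[of _ _ _ "rev p"] by fastforce
  moreover have *: "x @ (p @ rev p) \<approx> x" for x using weq_left[OF inv_right, of x p] by simp
  ultimately show "u \<approx> v" unfolding ceq_cong1[OF *] ceq_cong2[OF *] by blast
qed (rule weq_right)

lemma move_left: "p @ u \<approx> v \<longleftrightarrow> u \<approx> rev p @ v"
proof -
  have "p @ u \<approx> v \<longleftrightarrow> rev p @ p @ u \<approx> rev p @ v" by simp
  also have "\<dots> \<longleftrightarrow> u \<approx> rev p @ v" by (rule ceq_cong1[OF inv_left_app])
  finally show ?thesis .
qed

lemma move_Cons: "s # u \<approx> v \<longleftrightarrow> u \<approx> s # v"
  using move_left[of "[s]"] by simp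

lemma move_right: "u @ p \<approx> v \<longleftrightarrow> u \<approx> v @ rev p"
proof -
  have *: "(x @ p) @ rev p \<approx> x" for x using weq_left[OF inv_right, of x p] by simp
  have "u @ p \<approx> v \<longleftrightarrow> (u @ p) @ rev p \<approx> v @ rev p" by (simp only: cancel_right)
  also have "\<dots> \<longleftrightarrow> u \<approx> v @ rev p" by (rule ceq_cong1[OF *])
  finally show ?thesis .
qed

lemma rev_ceq: "u \<approx> v \<Longrightarrow> rev u \<approx> rev v"
proof -
  assume *: "u \<approx> v"
  have "v @ rev u \<approx> u @ rev u" using * weq_sym by (intro weq_right) blast
  then have "v @ rev u \<approx> []" by (rule weq_trans[OF _ inv_right])
  then show "rev u \<approx> rev v" by (simp add: move_left)
qed

section \<open>Reflection parity and the exchange condition\<close>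

lemma conj_cong: "l \<approx> r \<Longrightarrow> rev l @ t @ l \<approx> rev r @ t @ r"
  by (intro weq_append rev_ceq) simp_all

text \<open>\<open>par t w\<close> is the parity of the number of positions \<open>i\<close> for which the reflection
  \<open>s\<^sub>1 \<dots> s\<^sub>i \<dots> s\<^sub>1\<close> attached to \<open>w = s\<^sub>1 \<dots> s\<^sub>n\<close> equals \<open>t\<close>.\<close>

fun par :: "'s list \<Rightarrow> 's list \<Rightarrow> bool" where
  "par t [] = False"
| "par t (s # w) = ((t \<approx> [s]) \<noteq> par ([s] @ t @ [s]) w)"

lemma par_cong: "t \<approx> t' \<Longrightarrow> par t w = par t' w"
proof (induction w arbitrary: t t')
  case (Cons s w)
  have "[s] @ t @ [s] \<approx> [s] @ t' @ [s]" by (rule weq_ctx[OF Cons.prems])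
  from Cons.IH[OF this] show ?case using ceq_cong1[OF Cons.prems] by simp
qed simp

lemma par_append: "par t (u @ v) = (par t u \<noteq> par (rev u @ t @ u) v)"
  by (induction u arbitrary: t) auto

lemma refl_move: "rev u @ t @ u \<approx> [s] \<longleftrightarrow> t \<approx> u @ [s] @ rev u"
  using move_left[of "rev u" "t @ u" "[s]"] move_right[of t u "u @ [s]"] by simp

text \<open>The reflections attached to an alternating word are the alternating words of odd length
  a, aba, ababa and so on.\<close>

lemma par_alt: "par t (alt n a b) = odd (card {i. i < n \<and> t \<approx> alt (2 * i + 1) a b})"
proof (induction n)
  case (Suc n)
  have "alt n a b @ [if even n then a else b] @ rev (alt n a b) = alt (2 * n + 1) a b"
    using alt_add[of n "Suc n" a b] by (auto simp: rev_alt mult_2)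
  then have *: "rev (alt n a b) @ t @ alt n a b \<approx> [if even n then a else b] \<longleftrightarrow> t \<approx> alt (2 * n + 1) a b"
    by (simp only: refl_move)
  have "{i. i < Suc n \<and> t \<approx> alt (2 * i + 1) a b} =
    (if t \<approx> alt (2 * n + 1) a b then insert n else id) {i. i < n \<and> t \<approx> alt (2 * i + 1) a b}"
    by (auto simp: less_Suc_eq)
  then have "card {i. i < Suc n \<and> t \<approx> alt (2 * i + 1) a b} =
    card {i. i < n \<and> t \<approx> alt (2 * i + 1) a b} + (if t \<approx> alt (2 * n + 1) a b then 1 else 0)"
    by simp
  then show ?case unfolding alt_snoc par_append par.simps * Suc by simp
qed simp

lemma alt_complement:
  assumes "a \<noteq> b" "m a b \<noteq> 0" "k + l = 2 * m a b"
  shows "alt k a b \<approx> alt l b a"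
proof -
  have *: "alt k a b @ rev (alt l b a) = alt (k + l) a b" if "even (k + l)" for k l
    using that by (auto simp: alt_add rev_alt)
  have "alt (m a b) a b @ rev (alt (m a b) b a) \<approx> []"
    using beq_imp_ceq[OF beq_braid[OF assms(1,2)]] move_right[of _ "rev (alt (m a b) b a)" "[]"] by simp
  then have "alt (2 * m a b) a b \<approx> []" unfolding *[of "m a b" "m a b", simplified] by (simp add: mult_2)
  then have "alt k a b @ rev (alt l b a) \<approx> []" using *[of k l] assms(3) by simp
  then show ?thesis using move_right[of _ "rev (alt l b a)" "[]"] by simp
qed

text \<open>The two sides of a braid relation have the same reflections in opposite order: by
  \<open>alt_complement\<close>, position \<open>i\<close> on one side matches position
  \<open>m a b - 1 - i\<close> on the other.\<close>

lemma par_braid: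
  assumes "a \<noteq> b" "m a b \<noteq> 0"
  shows "par t (alt (m a b) a b) = par t (alt (m a b) b a)"
proof -
  let ?m = "m a b"
  have *: "t \<approx> alt (2 * i + 1) a b \<longleftrightarrow> t \<approx> alt (2 * (?m - 1 - i) + 1) b a" if "i < ?m" for i
  proof -
    have "(2 * i + 1) + (2 * (?m - 1 - i) + 1) = 2 * ?m" using that by simp
    from ceq_cong2[OF alt_complement[OF assms this]] show ?thesis .
  qed
  define A where "A = {i. i < ?m \<and> t \<approx> alt (2 * i + 1) a b}"
  define B where "B = {i. i < ?m \<and> t \<approx> alt (2 * i + 1) b a}"
  have "i \<in> A \<longleftrightarrow> ?m - 1 - i \<in> B" if "i < ?m" for i
    unfolding A_def B_def mem_Collect_eq *[OF that] using that by simp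
  moreover have "A \<subseteq> {..<?m}" "B \<subseteq> {..<?m}" by (auto simp: A_def B_def)
  ultimately have "bij_betw (\<lambda>i. ?m - 1 - i) A B"
    by (intro bij_betw_byWitness[where f' = "\<lambda>i. ?m - 1 - i"]) force+
  then have "card A = card B" by (rule bij_betw_same_card)
  then show ?thesis unfolding par_alt A_def B_def by simp
qed

text \<open>In \<open>[s, s]\<close> both positions carry the same reflection and cancel; braid
  relations are covered by \<open>par_braid\<close>. Being conjugate by equivalent words,
  \<open>t\<close> meets the rest of the word identically on both sides.\<close>

lemma par_ceq:
  assumes "u \<approx> v" shows "par t u = par t v"
proof (rule fun_cong[of "\<lambda>t. par t u" "\<lambda>t. par t v"], rule weq_invariant[OF assms])
  fix u v assume "wstep (cox_rel m) u v"
  then obtain p q l r where *: "u = p @ l @ q" "v = p @ r @ q" "(l, r) \<in> cox_rel m \<or> (r, l) \<in> cox_rel m"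
    unfolding wstep_def by blast
  have rel: "par t l = par t r" if "(l, r) \<in> cox_rel m" for l r t
  proof -
    have "[s] @ t @ [s] \<approx> [s] \<longleftrightarrow> t \<approx> [s]" for s
    proof -
      have r: "rev [s] = [s]" by simp
      have "[s] @ t @ [s] \<approx> [s] \<longleftrightarrow> t \<approx> [s] @ [s] @ [s]" using refl_move[of "[s]" t s] unfolding r .
      also have "\<dots> \<longleftrightarrow> t \<approx> [s]" using ceq_cong2[OF inv_right_app[of "[s]" "[s]"]] unfolding r .
      finally show ?thesis .
    qed
    then have "par t [s, s] = par t []" for s by (simp only: par.simps simp_thms)
    then show ?thesis using that par_braid[of _ _ t] unfolding cox_rel_def braid_rel_def by auto
  qed
  have lr: "l \<approx> r" using *(3) weq_rel weq_sym by blast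
  have "par t l = par t r" for t using *(3) rel by blast
  then show "(\<lambda>t. par t u) = (\<lambda>t. par t v)"
    unfolding * par_append by (simp only: par_cong[OF conj_cong[OF lr]])
qed

text \<open>An odd count is not zero, so \<open>t\<close> is the reflection of some position, and
  multiplying by it deletes the letter there.\<close>

lemma par_exchange: "par t w \<Longrightarrow> \<exists>a y b. w = a @ y # b \<and> t @ w \<approx> a @ b"
proof (induction w arbitrary: t)
  case (Cons s w)
  show ?case
  proof (cases "t \<approx> [s]")
    case True
    then have "t @ s # w \<approx> [s] @ s # w" by (rule weq_right)
    also have "[s] @ s # w \<approx> [] @ w" using weq_right[OF cox_cancel, of s w] by simp
    finally show ?thesis by (intro exI[of _ "[]"] exI[of _ s] exI[of _ w]) simp
  next
    case False
    then have "par ([s] @ t @ [s]) w" using Cons.prems by simp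
    then obtain a y b where ab: "w = a @ y # b" "([s] @ t @ [s]) @ w \<approx> a @ b" using Cons.IH by blast
    then have "t @ s # w \<approx> (s # a) @ b" using move_Cons[of s "t @ s # w"] by simp
    then show ?thesis using ab(1) by (intro exI[of _ "s # a"] exI[of _ y] exI[of _ b]) simp
  qed
qed simp

definition reduced :: "'s list \<Rightarrow> bool" where
  "reduced w \<longleftrightarrow> (\<forall>v. v \<approx> w \<longrightarrow> length w \<le> length v)"

lemma reducedD: "reduced w \<Longrightarrow> v \<approx> w \<Longrightarrow> length w \<le> length v"
  by (simp add: reduced_def)

lemma reduced_ceq: "reduced w \<Longrightarrow> v \<approx> w \<Longrightarrow> length v = length w \<Longrightarrow> reduced v"
  unfolding reduced_def using ceq_cong2[of v w] by simp

lemma reduced_beq: "reduced w \<Longrightarrow> v \<sim> w \<Longrightarrow> reduced v"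
  using reduced_ceq beq_imp_ceq beq_length by blast

lemma reduced_append:
  assumes "reduced (u @ v)" shows "reduced u" "reduced v"
proof -
  show "reduced u" unfolding reduced_def
  proof (intro allI impI)
    fix x assume "x \<approx> u"
    then have "x @ v \<approx> u @ v" by (rule weq_right)
    then show "length u \<le> length x" using reducedD[OF assms] by fastforce
  qed
  show "reduced v" unfolding reduced_def
  proof (intro allI impI)
    fix x assume "x \<approx> v"
    then have "u @ x \<approx> u @ v" by (rule weq_left)
    then show "length v \<le> length x" using reducedD[OF assms] by fastforce
  qed
qed

lemma reduced_tl: "reduced (s # v) \<Longrightarrow> reduced v"
  using reduced_append(2)[of "[s]"] by simp

lemma ex_reduced: "\<exists>v. v \<approx> w \<and> reduced v"
  using ex_has_least_nat[of "\<lambda>v. v \<approx> w" w length] unfolding reduced_def using weq_trans[of "cox_rel m" _ _ w] by (metis weq_refl)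

lemma not_par_reduced: "reduced (s # w) \<Longrightarrow> \<not> par [s] w"
proof
  assume *: "reduced (s # w)" "par [s] w"
  then obtain a y b where ab: "w = a @ y # b" "[s] @ w \<approx> a @ b" using par_exchange by blast
  then show False using reducedD[OF *(1) weq_sym[of _ "s # w" "a @ b"]] by simp
qed

lemma exchange_condition:
  assumes "reduced w" "\<not> reduced (s # w)"
  obtains a y b where "w = a @ y # b" "s # a @ b \<approx> w" "reduced (s # a @ b)"
proof -
  obtain w' where w': "w' \<approx> s # w" "reduced w'" using ex_reduced by blast
  have "length w' \<noteq> length (s # w)" using assms(2) reduced_ceq[OF w'(2) weq_sym[OF w'(1)]] by auto
  moreover have "length w' \<le> length (s # w)" using reducedD[OF w'(2) weq_sym[OF w'(1)]] .
  moreover have "even (length w') = even (length (s # w))" using ceq_length_parity[OF w'(1)] .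
  \<comment> \<open>By parity a word shorter than \<open>s # w\<close> is shorter by at least two
    letters.\<close>
  ultimately have len: "length (s # w') \<le> length w" 
    unfolding length_Cons by presburger
  have eq: "s # w' \<approx> w" using w'(1) move_Cons[of s w' w] by simp
  then have "reduced (s # w')" using reduced_ceq[OF assms(1) eq] reducedD[OF assms(1) eq] len by simp
  then have "par [s] (s # w')" using not_par_reduced par_cong[of "[s] @ [s] @ [s]" "[s]" w']
    inv_right_app[of "[s]" "[s]"] by simp
  then have "par [s] w" using par_ceq[OF eq] by blast
  then obtain a y b where ab: "w = a @ y # b" "[s] @ w \<approx> a @ b" using par_exchange by blast
  have 1: "s # a @ b \<approx> w" using ab(2) move_Cons[of s w "a @ b"] weq_sym by simp
  then have "reduced (s # a @ b)" using reduced_ceq[OF assms(1)] ab(1) by simp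
  then show thesis using that ab(1) 1 by blast
qed

lemma descent_not_reduced: "reduced w \<Longrightarrow> s # u \<approx> w \<Longrightarrow> length w = Suc (length u) \<Longrightarrow> \<not> reduced (s # w)"
  using reducedD[of "s # w" u] move_Cons[of s u w] by force

lemma reduce_subset: "\<exists>v. v \<approx> w \<and> reduced v \<and> set v \<subseteq> set w"
proof (induction w)
  case Nil
  then show ?case by (auto simp: reduced_def intro: exI[of _ "[]"])
next
  case (Cons s w)
  then obtain v where v: "v \<approx> w" "reduced v" "set v \<subseteq> set w" by blast
  show ?case
  proof (cases "reduced (s # v)")
    case True
    then show ?thesis using v by (intro exI[of _ "s # v"]) auto
  next
    case False
    then obtain a y b where ab: "v = a @ y # b" "s # a @ b \<approx> v" "reduced (s # a @ b)"
      using exchange_condition v(2) by blast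
    have "a @ b \<approx> s # v" using ab(2) by (simp add: move_Cons)
    also have "s # v \<approx> s # w" using v(1) by simp
    finally show ?thesis using v(3) ab(1) reduced_tl[OF ab(3)] by (intro exI[of _ "a @ b"]) auto
  qed
qed

section \<open>Longest elements\<close>

lemma longest_element:
  assumes bound: "\<And>w. reduced w \<Longrightarrow> set w \<subseteq> X \<Longrightarrow> length w \<le> L"
  shows "\<exists>w0. reduced w0 \<and> set w0 \<subseteq> X \<and>
    (\<forall>a. reduced a \<longrightarrow> set a \<subseteq> X \<longrightarrow> (\<exists>p. w0 \<approx> a @ p \<and> reduced (a @ p) \<and> set p \<subseteq> X))"
proof -
  let ?P = "\<lambda>w. reduced w \<and> set w \<subseteq> X"
  have "?P []" by (simp add: reduced_def)
  then obtain w0 where w0: "reduced w0" "set w0 \<subseteq> X" and max: "\<And>w. ?P w \<Longrightarrow> length w \<le> length w0"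
    using ex_has_greatest_nat[of ?P "[]" length "Suc L"] bound by (metis less_Suc_eq_le)
  have "\<exists>p. w0 \<approx> a @ p \<and> reduced (a @ p) \<and> set p \<subseteq> X" if "reduced a" "set a \<subseteq> X" for a
    using that
  proof (induction a rule: rev_induct)
    case Nil
    then show ?case using w0 by (intro exI[of _ w0]) simp
  next
    case (snoc s a)
    then obtain p where p: "w0 \<approx> a @ p" "reduced (a @ p)" "set p \<subseteq> X"
      using reduced_append(1)[of a "[s]"] by auto
    have pr: "reduced p" by (rule reduced_append(2)[OF p(2)])
    \<comment> \<open>Otherwise the reflection \<open>t\<close>, which is not counted in
      \<open>a\<close> but is counted in \<open>s # p\<close> after conjugation, is an inversion of
      a s p. Multiplying by \<open>t\<close> shortens a reduced word for a s p and yields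
      \<open>w0\<close>, so that word is longer than \<open>w0\<close>, against maximality.\<close>
    have "\<not> reduced (s # p)"
    proof
      assume sp: "reduced (s # p)"
      define t where "t = a @ [s] @ rev a"
      have ta: "t @ a \<approx> a @ [s]" unfolding t_def
        using weq_left[OF inv_left[of a], of "a @ [s]"] by simp
      have "\<not> par t a"
      proof
        assume "par t a"
        then obtain x y b where xy: "a = x @ y # b" "t @ a \<approx> x @ b" using par_exchange by blast
        then have "x @ b \<approx> a @ [s]" using weq_trans[OF weq_sym[OF xy(2)] ta] by blast
        then show False using reducedD[OF snoc.prems(1)] xy(1) by fastforce
      qed
      moreover have conj: "rev a @ t @ a \<approx> [s]" unfolding refl_move t_def by simp
      then have "par (rev a @ t @ a) (s # p)"
        using par_cong[OF conj, of "s # p"] not_par_reduced[OF sp]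
          par_cong[of "[s] @ [s] @ [s]" "[s]" p] inv_right_app[of "[s]" "[s]"] by simp
      ultimately have par: "par t (a @ s # p)" by (simp add: par_append)
      obtain z where z: "z \<approx> a @ s # p" "reduced z" "set z \<subseteq> set (a @ s # p)"
        using reduce_subset by blast
      then have zX: "set z \<subseteq> X" using snoc.prems p(3) by auto
      have "par t z" using par par_ceq[OF z(1)] by simp
      then obtain x y b where xy: "z = x @ y # b" "t @ z \<approx> x @ b" using par_exchange by blast
      have "w0 \<approx> a @ p" by (rule p(1))
      also have "a @ p \<approx> a @ [s, s] @ p" using weq_ctx[OF weq_sym[OF cox_cancel], of a p s] by simp
      also have "a @ [s, s] @ p \<approx> t @ a @ s # p" using weq_right[OF weq_sym[OF ta], of "s # p"] by simp
      also have "t @ a @ s # p \<approx> t @ z" using z(1) weq_sym by simp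
      also have "t @ z \<approx> x @ b" by (rule xy(2))
      finally have "x @ b \<approx> w0" by (rule weq_sym)
      then have "length w0 < length z" using reducedD[OF w0(1)] xy(1) by fastforce
      then show False using max[of z] z(2) zX by auto
    qed
    then obtain x y b where xy: "p = x @ y # b" "s # x @ b \<approx> p" "reduced (s # x @ b)"
      using exchange_condition pr by blast
    have *: "(a @ [s]) @ x @ b \<approx> a @ p" using weq_left[OF xy(2), of a] by simp
    have "reduced ((a @ [s]) @ x @ b)" by (rule reduced_ceq[OF p(2) *]) (use xy(1) in simp)
    moreover have "w0 \<approx> (a @ [s]) @ x @ b" using weq_trans[OF p(1) weq_sym[OF *]] .
    ultimately show ?case using p(3) xy(1) by (intro exI[of _ "x @ b"]) auto
  qed
  then show ?thesis using w0 by blast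
qed

section \<open>A linear representation and the order of a product of two generators\<close>

text \<open>The dual of Tits' geometric representation; a value \<open>\<infinity>\<close> of the Coxeter matrix is replaced
  by an arbitrary \<open>N\<close>.\<close>

definition fin_m :: "nat \<Rightarrow> 's \<Rightarrow> 's \<Rightarrow> nat" where
  "fin_m N s t = (if m s t = 0 then N else m s t)"

definition coef :: "nat \<Rightarrow> 's \<Rightarrow> 's \<Rightarrow> real" where
  "coef N s u = (if s = u then - 2 else 2 * cos (pi / fin_m N s u))"

definition act :: "nat \<Rightarrow> 's \<Rightarrow> ('s \<Rightarrow> real) \<Rightarrow> 's \<Rightarrow> real" where
  "act N s f = (\<lambda>u. f u + coef N s u * f s)"

definition acts :: "nat \<Rightarrow> 's list \<Rightarrow> ('s \<Rightarrow> real) \<Rightarrow> 's \<Rightarrow> real" where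
  "acts N w = fold (act N) w"

lemma acts_append: "acts N (u @ v) f = acts N v (acts N u f)"
  by (simp add: acts_def)

lemma act_act: "act N s (act N s f) = f"
  by (rule ext) (simp add: act_def coef_def)

text \<open>The solution of the recursion x_(k+2) = 2 cos \<theta> x_(k+1) - x_k that starts with
  x_0 = -q and x_1 = p.\<close>

definition dihedral_val :: "real \<Rightarrow> real \<Rightarrow> real \<Rightarrow> nat \<Rightarrow> real" where
  "dihedral_val \<theta> p q k = (p * sin (real k * \<theta>) + q * sin (real k * \<theta> - \<theta>)) / sin \<theta>"

lemma dihedral_val_rec:
  "dihedral_val \<theta> p q (Suc (Suc k)) = 2 * cos \<theta> * dihedral_val \<theta> p q (Suc k) - dihedral_val \<theta> p q k"
proof -
  have rec: "sin (x + \<theta>) + sin (x - \<theta>) = 2 * cos \<theta> * sin x" for x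
    by (simp add: sin_add sin_diff)
  have 1: "sin (real (Suc (Suc k)) * \<theta>) = 2 * cos \<theta> * sin (real (Suc k) * \<theta>) - sin (real k * \<theta>)"
    using rec[of "real (Suc k) * \<theta>"] by (simp add: algebra_simps)
  have 2: "sin (real (Suc (Suc k)) * \<theta> - \<theta>) =
      2 * cos \<theta> * sin (real (Suc k) * \<theta> - \<theta>) - sin (real k * \<theta> - \<theta>)"
    using rec[of "real k * \<theta>"] by (simp add: algebra_simps)
  show ?thesis unfolding dihedral_val_def 1 2 by (simp add: add_divide_distrib diff_divide_distrib algebra_simps)
qed

lemma acts_alt:
  fixes f :: "'s \<Rightarrow> real" and s t :: 's
  assumes "s \<noteq> t" "fin_m N s t = M" "M \<ge> 2"
  defines "x \<equiv> dihedral_val (pi / M) (f s) (f t)"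
  shows "acts N (alt k s t) f s = (if even k then x (Suc k) else - x k) \<and>
    acts N (alt k s t) f t = (if even k then - x k else x (Suc k))"
proof (induction k)
  case 0
  have "0 < pi / M" "pi / M < pi" using assms(3) by (simp_all add: field_simps)
  then have "sin (pi / M) \<noteq> 0" using sin_gt_zero by fastforce
  then show ?case by (simp add: acts_def x_def dihedral_val_def)
next
  case (Suc k)
  have M: "fin_m N t s = M" using assms(2) by (auto simp: fin_m_def m_sym[of t s] split: if_splits)
  have rec: "x (Suc (Suc k)) = 2 * cos (pi / M) * x (Suc k) - x k"
    unfolding x_def by (rule dihedral_val_rec)
  show ?case using Suc assms(1,2) M unfolding alt_snoc acts_append
    by (auto simp: acts_def act_def coef_def rec)
qed

lemma acts_span:
  assumes "set w \<subseteq> {s, t}"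
  shows "\<exists>A B. \<forall>u. acts N w f u = f u + coef N s u * A + coef N t u * B"
  using assms
proof (induction w rule: rev_induct)
  case Nil
  then show ?case by (intro exI[of _ 0]) (simp add: acts_def)
next
  case (snoc a w)
  then obtain A B where AB: "acts N w f u = f u + coef N s u * A + coef N t u * B" for u by auto
  define G where "G = acts N w f a"
  have step: "acts N (w @ [a]) f u = f u + coef N s u * A + coef N t u * B + coef N a u * G" for u
    unfolding G_def AB[symmetric] by (simp add: acts_append) (simp add: acts_def act_def)
  have "a = s \<or> a = t" using snoc.prems by auto
  then show ?case
  proof
    assume "a = s"
    then show ?thesis unfolding step
      by (intro exI[of _ "A + G"] exI[of _ B]) (simp add: distrib_left)
  next
    assume "a = t"
    then show ?thesis unfolding step
      by (intro exI[of _ A] exI[of _ "B + G"]) (simp add: distrib_left)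
  qed
qed

text \<open>At \<open>s\<close> and \<open>t\<close> the two sides agree by the explicit values. By
  \<open>acts_span\<close> each side changes \<open>f\<close> by a combination of the two rows of
  \<open>coef\<close> with coefficients independent of \<open>u\<close>. The values at
  \<open>s\<close> and \<open>t\<close> determine these coefficients, since the determinant of the 2
  by 2 system is 4 sin^2 \<theta>.\<close>

lemma acts_braid:
  assumes st: "s \<noteq> t" and m: "m s t \<noteq> 0"
  shows "acts N (alt (m s t) s t) f = acts N (alt (m s t) t s) f"
proof -
  define M where "M = m s t"
  have M2: "M \<ge> 2" using m_ne_1[OF st] m by (simp add: M_def)
  have fM: "fin_m N s t = M" "fin_m N t s = M" using m by (simp_all add: fin_m_def M_def m_sym[of t s])
  define \<theta> where "\<theta> = pi / M"
  have M\<theta>: "real M * \<theta> = pi" using M2 by (simp add: \<theta>_def)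
  have \<theta>: "0 < \<theta>" "\<theta> < pi" using M2 by (simp_all add: \<theta>_def field_simps)
  then have sin: "sin \<theta> > 0" by (rule sin_gt_zero)
  define x where "x = dihedral_val \<theta> (f s) (f t)"
  define y where "y = dihedral_val \<theta> (f t) (f s)"
  have "real (Suc M) * \<theta> = pi + \<theta>" using M\<theta> by (simp add: algebra_simps)
  then have vals: "x M = f t" "x (Suc M) = - f s" "y M = f s" "y (Suc M) = - f t"
    using sin by (simp_all add: x_def y_def dihedral_val_def M\<theta> del: of_nat_Suc)
  have eq: "acts N (alt M s t) f s = acts N (alt M t s) f s" "acts N (alt M s t) f t = acts N (alt M t s) f t"
    using acts_alt[OF st fM(1) M2, where f = f and k = M] acts_alt[OF st[symmetric] fM(2) M2, where f = f and k = M] vals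
    by (auto simp: x_def y_def \<theta>_def)
  define c where "c = 2 * cos \<theta>"
  let ?c = "coef N"
  obtain A B where AB: "\<And>u. acts N (alt M s t) f u = f u + ?c s u * A + ?c t u * B"
    using acts_span[of "alt M s t" s t N f] set_alt[of M s t] by blast
  obtain A' B' where AB': "\<And>u. acts N (alt M t s) f u = f u + ?c s u * A' + ?c t u * B'"
    using acts_span[of "alt M t s" s t N f] set_alt[of M t s] by blast
  have c: "?c s t = c" "?c t s = c" "?c s s = - 2" "?c t t = - 2"
    using st fM by (simp_all add: coef_def c_def \<theta>_def)
  have e1: "- 2 * A + c * B = - 2 * A' + c * B'" using eq(1) unfolding AB AB' c by simp
  have e2: "c * A - 2 * B = c * A' - 2 * B'" using eq(2) unfolding AB AB' c by simp
  have "(4 - c\<^sup>2) * (A - A') = 0" using e1 e2 by (simp add: power2_eq_square) algebra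
  moreover have "(4 - c\<^sup>2) * (B - B') = 0" using e1 e2 by (simp add: power2_eq_square) algebra
  moreover have "4 - c\<^sup>2 = 4 * (sin \<theta>)\<^sup>2" by (simp add: c_def power_mult_distrib cos_squared_eq algebra_simps)
  ultimately have "A = A'" "B = B'" using sin by auto
  then show ?thesis unfolding M_def[symmetric] using AB AB' by (intro ext) simp
qed

lemma acts_ceq: assumes "u \<approx> v" shows "acts N u = acts N v"
proof (rule weq_invariant[OF assms])
  fix u v assume "wstep (cox_rel m) u v"
  then obtain p q l r where *: "u = p @ l @ q" "v = p @ r @ q" "(l, r) \<in> cox_rel m \<or> (r, l) \<in> cox_rel m"
    unfolding wstep_def by blast
  have "acts N l f = acts N r f" if "(l, r) \<in> cox_rel m" for l r f
    using that acts_braid[of _ _ N f] unfolding cox_rel_def braid_rel_def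
    by (auto simp: acts_def act_act)
  then have "acts N l f = acts N r f" for f using *(3) by metis
  then show "acts N u = acts N v" unfolding * by (intro ext) (simp add: acts_append)
qed

text \<open>Equality of the two actions on the indicator function of \<open>s\<close> would force
  sin (k \<theta>) = 0, although k \<theta> lies strictly between 0 and pi.\<close>

lemma alt_not_ceq:
  assumes st: "s \<noteq> t" and k: "0 < k" "m s t = 0 \<or> k < m s t"
  shows "\<not> alt k s t \<approx> alt k t s"
proof
  assume eq: "alt k s t \<approx> alt k t s"
  \<comment> \<open>For an infinite label any replacement above \<open>k\<close> separates the two
    words of length \<open>k\<close>.\<close>
  define N where "N = k + 1"
  define M where "M = fin_m N s t"
  have M: "k < M" "M \<ge> 2" using k by (auto simp: M_def fin_m_def N_def)
  have fM: "fin_m N s t = M" "fin_m N t s = M" by (simp_all add: fin_m_def M_def m_sym[of t s])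
  define \<theta> where "\<theta> = pi / M"
  have \<theta>: "0 < \<theta>" "\<theta> < pi" using M by (simp_all add: \<theta>_def field_simps)
  then have sin: "sin \<theta> > 0" by (rule sin_gt_zero)
  define f :: "'s \<Rightarrow> real" where "f u = (if u = s then 1 else 0)" for u
  have f: "f s = 1" "f t = 0" using st by (simp_all add: f_def)
  have "acts N (alt k s t) f t = acts N (alt k t s) f t" "acts N (alt k s t) f s = acts N (alt k t s) f s"
    using acts_ceq[OF eq, of N] by simp_all
  then have "dihedral_val \<theta> 1 0 k = - dihedral_val \<theta> 0 1 (Suc k)"
    using acts_alt[OF st fM(1) M(2), where f = f and k = k] acts_alt[OF st[symmetric] fM(2) M(2), where f = f and k = k] f
    by (auto simp: \<theta>_def split: if_splits)
  then have "sin (real k * \<theta>) = 0" using sin by (simp add: dihedral_val_def field_simps)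
  moreover have "0 < real k * \<theta>" "real k * \<theta> < pi"
    using k(1) M \<theta> by (simp_all add: \<theta>_def field_simps)
  ultimately show False using sin_gt_zero[of "real k * \<theta>"] by simp
qed

lemma ceq_singletonD: "[s] \<approx> [t] \<Longrightarrow> s = t"
  using alt_not_ceq[of s t 1] m_ne_1[of s t] by (cases "m s t") auto

section \<open>Matsumoto's theorem\<close>

lemma reduced_two_letters:
  assumes "reduced (b # w)" "set w \<subseteq> {a, b}"
  shows "b # w = alt (Suc (length w)) b a"
  using assms
proof (induction w arbitrary: a b)
  case (Cons c w)
  have "c \<noteq> b"
  proof
    assume "c = b"
    then have "w \<approx> b # c # w" using weq_right[OF weq_sym[OF cox_cancel[of b]], of w] by simp
    then show False using reducedD[OF Cons.prems(1)] by fastforce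
  qed
  then show ?case using Cons.IH[of c b] Cons.prems reduced_tl[OF Cons.prems(1)] by auto
qed simp

text \<open>This generalizes \<open>two_descents\<close> so that an alternating prefix can grow.
  Exchange with the letter \<open>b\<close> deletes a letter either of \<open>y\<close> or of the
  prefix. In the first case the prefix gets longer and \<open>a\<close> and \<open>b\<close> change
  roles; in the second the two alternating words of length \<open>k\<close> are equal, which by
  \<open>alt_not_ceq\<close> requires \<open>m a b \<le> k\<close>.\<close>

lemma dihedral_prefix:
  assumes "a \<noteq> b" "reduced w" "w \<approx> alt k a b @ y" "length w = k + length y" "0 < k"
    and a: "a # ua \<approx> w" "length w = Suc (length ua)" and b: "b # ub \<approx> w" "length w = Suc (length ub)"
  shows "m a b \<noteq> 0 \<and> (\<exists>p. w \<approx> alt (m a b) a b @ p \<and> length w = m a b + length p)"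
  using assms
proof (induction "length y" arbitrary: k a b y ua ub rule: less_induct)
  case less
  note ab = less.prems(1) and w = less.prems(2-5)
  have red: "reduced (alt k a b @ y)" using reduced_ceq[OF w(1) weq_sym[OF w(2)]] w(3) by simp
  have "b # ub \<approx> alt k a b @ y" using weq_trans[OF less.prems(8) w(2)] .
  then have "\<not> reduced (b # alt k a b @ y)"
    using descent_not_reduced[OF red] less.prems(9) w(3) by simp
  then obtain x c z where xz: "alt k a b @ y = x @ c # z" "b # x @ z \<approx> alt k a b @ y" "reduced (b # x @ z)"
    using exchange_condition red by blast
  consider (left) z' where "alt k a b = x @ c # z'" "z = z' @ y"
    | (right) x' where "x = alt k a b @ x'" "y = x' @ c # z"
  proof -
    obtain us where "alt k a b = x @ us \<and> us @ y = c # z \<or> alt k a b @ us = x \<and> y = us @ c # z"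
      using xz(1) unfolding append_eq_append_conv2 by blast
    then show thesis
    proof
      assume us: "alt k a b = x @ us \<and> us @ y = c # z"
      show thesis
      proof (cases us)
        case Nil
        then show thesis using us right[of "[]"] by simp
      next
        case (Cons d us')
        then show thesis using us left[of us'] by simp
      qed
    qed (use right[of us] in simp)
  qed
  then show ?case
  proof cases
    case left
    have "(b # x @ z') @ y \<approx> alt k a b @ y" using xz(2) left by simp
    then have eq: "b # x @ z' \<approx> alt k a b" by (simp only: cancel_right)
    have len: "length (x @ z') = k - 1" using arg_cong[OF left(1), of length] by simp
    have "reduced (b # x @ z')" using reduced_append(1)[of "b # x @ z'" y] xz(3) left by simp
    moreover have "set (x @ z') \<subseteq> {a, b}" using set_alt[of k a b] left(1) by auto
    ultimately have "b # x @ z' = alt (Suc (k - 1)) b a" using reduced_two_letters[of b "x @ z'" a] len by simp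
    then have "alt k a b \<approx> alt k b a" using weq_sym[OF eq] w(4) by simp
    then have "\<not> (m a b = 0 \<or> k < m a b)" using alt_not_ceq[OF ab w(4)] by blast
    then have m: "m a b \<noteq> 0" "m a b \<le> k" by simp_all
    define p where "p = (if even (m a b) then alt (k - m a b) a b else alt (k - m a b) b a) @ y"
    have "alt k a b @ y = alt (m a b) a b @ p" using alt_add[of "m a b" "k - m a b" a b] m(2)
      by (simp add: p_def)
    moreover have "length w = m a b + length p" using w(3) m(2) by (simp add: p_def)
    ultimately show ?thesis using w(2) m(1) by auto
  next
    case right
    let ?y = "x' @ z"
    have eq: "b # x @ z = alt (Suc k) b a @ ?y" using right by simp
    have "m b a \<noteq> 0 \<and> (\<exists>p. w \<approx> alt (m b a) b a @ p \<and> length w = m b a + length p)"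
    proof (rule less.hyps[of ?y b a "Suc k" ub ua])
      show "length ?y < length y" using right by simp
      show "w \<approx> alt (Suc k) b a @ ?y" using weq_trans[OF w(2) weq_sym[OF xz(2)]] eq by simp
      show "length w = Suc k + length ?y" using w(3) right by simp
    qed (use less.prems in auto)
    then obtain p where p: "m a b \<noteq> 0" "w \<approx> alt (m a b) b a @ p" "length w = m a b + length p"
      by (auto simp: m_sym[of b a])
    have "alt (m a b) b a @ p \<approx> alt (m a b) a b @ p"
      using beq_imp_ceq[OF beq_braid[OF ab p(1)]] weq_sym by (intro weq_right) blast
    then show ?thesis using p weq_trans by blast
  qed
qed

lemma two_descents:
  assumes "a \<noteq> b" "reduced (a # u)" "a # u \<approx> b # v" "length u = length v"
  shows "m a b \<noteq> 0 \<and> (\<exists>p. a # u \<approx> alt (m a b) a b @ p \<and> Suc (length u) = m a b + length p)"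
proof -
  have "m a b \<noteq> 0 \<and> (\<exists>p. a # u \<approx> alt (m a b) a b @ p \<and> length (a # u) = m a b + length p)"
    by (rule dihedral_prefix[of a b "a # u" 1 u u v]) (use assms weq_sym in auto)
  then show ?thesis by simp
qed

lemma alt_m_Cons: "s \<noteq> t \<Longrightarrow> m s t \<noteq> 0 \<Longrightarrow> alt (m s t) s t = s # alt (m s t - 1) t s"
  by (cases "m s t") auto

text \<open>If the first letters differ, the two sides of their braid relation are inserted between
  \<open>u\<close> and \<open>v\<close>; the remaining comparisons are between words with the same
  first letter and follow by induction on the tails.\<close>

lemma matsumoto:
  assumes "reduced u" "u \<approx> v" "length u = length v"
  shows "u \<sim> v"
  using assms
proof (induction "length u" arbitrary: u v rule: less_induct)
  case less
  show ?case
  proof (cases u)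
    case Nil
    then show ?thesis using less.prems by simp
  next
    case (Cons s u')
    then obtain t v' where v: "v = t # v'" using less.prems(3) by (cases v) auto
    have v_red: "reduced v" using reduced_ceq[OF less.prems(1) weq_sym[OF less.prems(2)]] less.prems(3) by simp
    have tail: "s # x \<sim> s # y" if "reduced (s # x)" "s # x \<approx> s # y" "length x = length y" "length x < length u" for s x y
    proof (rule weq_Cons, rule less.hyps)
      show "reduced x" by (rule reduced_tl[OF that(1)])
    qed (use that in simp_all)
    show ?thesis
    proof (cases "s = t")
      case True
      then show ?thesis using tail[of s u' v'] less.prems Cons v by simp
    next
      case False
      have "m s t \<noteq> 0 \<and> (\<exists>p. s # u' \<approx> alt (m s t) s t @ p \<and> Suc (length u') = m s t + length p)"
        by (rule two_descents[OF False, of u' v']) (use less.prems Cons v in auto)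
      then obtain p where p: "m s t \<noteq> 0" "s # u' \<approx> alt (m s t) s t @ p" "Suc (length u') = m s t + length p"
        by blast
      have br: "alt (m s t) s t @ p \<sim> alt (m s t) t s @ p" by (rule weq_right[OF beq_braid[OF False p(1)]])
      have st: "alt (m s t) s t @ p = s # (alt (m s t - 1) t s @ p)"
        and ts: "alt (m s t) t s @ p = t # (alt (m s t - 1) s t @ p)"
        using alt_m_Cons[OF False p(1)] alt_m_Cons[of t s] False p(1) by (simp_all add: m_sym[of t s])
      have "u \<sim> alt (m s t) s t @ p" unfolding Cons st
        by (rule tail) (use less.prems(1) Cons p st in auto)
      also note br
      also have "t # (alt (m s t - 1) s t @ p) \<sim> v" unfolding v
      proof (rule weq_sym, rule tail)
        show "reduced (t # v')" using v_red v by simp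
        have "alt (m s t) t s @ p \<approx> s # u'" using weq_trans[OF p(2) beq_imp_ceq[OF br]] by (rule weq_sym)
        from weq_sym[OF weq_trans[OF this less.prems(2)[unfolded Cons]]]
        show "t # v' \<approx> t # (alt (m s t - 1) s t @ p)" unfolding ts v .
        show "length v' = length (alt (m s t - 1) s t @ p)" using p less.prems(3) Cons v by simp
        show "length v' < length u" using less.prems(3) v by simp
      qed
      then have "alt (m s t) t s @ p \<sim> v" unfolding ts .
      finally show ?thesis .
    qed
  qed
qed

end

section \<open>The Artin monoid of a finite Coxeter group\<close>

text \<open>Finiteness enters as a bound on the lengths of reduced words, the form in which
  \<open>longest_element\<close> consumes it.\<close>

locale finite_coxeter = coxeter m for m :: "'s \<Rightarrow> 's \<Rightarrow> nat" +
  fixes S :: "'s set" and L :: nat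
  assumes bound: "reduced w \<Longrightarrow> set w \<subseteq> S \<Longrightarrow> length w \<le> L"
begin

section \<open>Words for the longest elements\<close>

definition lng :: "'s set \<Rightarrow> 's list" where
  "lng X = (SOME w0. reduced w0 \<and> set w0 \<subseteq> X \<and>
    (\<forall>a. reduced a \<longrightarrow> set a \<subseteq> X \<longrightarrow> (\<exists>p. w0 \<approx> a @ p \<and> reduced (a @ p) \<and> set p \<subseteq> X)))"

lemma lng_ex:
  assumes "X \<subseteq> S"
  shows "reduced (lng X) \<and> set (lng X) \<subseteq> X \<and>
    (\<forall>a. reduced a \<longrightarrow> set a \<subseteq> X \<longrightarrow> (\<exists>p. lng X \<approx> a @ p \<and> reduced (a @ p) \<and> set p \<subseteq> X))"
  unfolding lng_def
proof (rule someI_ex, rule longest_element)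
  show "reduced w \<Longrightarrow> set w \<subseteq> X \<Longrightarrow> length w \<le> L" for w using bound assms by blast
qed

lemma lng_reduced: "X \<subseteq> S \<Longrightarrow> reduced (lng X)"
  and lng_set: "X \<subseteq> S \<Longrightarrow> set (lng X) \<subseteq> X"
  using lng_ex by blast+

lemma reduced_length: "reduced u \<Longrightarrow> reduced v \<Longrightarrow> u \<approx> v \<Longrightarrow> length u = length v"
  using reducedD[of u v] reducedD[of v u] weq_sym[of _ u v] by simp

lemma lng_prefix:
  assumes "X \<subseteq> S" "reduced a" "set a \<subseteq> X"
  obtains p where "lng X \<sim> a @ p" "set p \<subseteq> X"
proof -
  obtain p where p: "lng X \<approx> a @ p" "reduced (a @ p)" "set p \<subseteq> X" using lng_ex[OF assms(1)] assms by blast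
  then have "lng X \<sim> a @ p" using matsumoto lng_reduced[OF assms(1)] reduced_length by blast
  then show thesis using that p(3) by blast
qed

lemma reduced_single: "reduced [s]"
  unfolding reduced_def using ceq_length_parity[of _ "[s]"] by (metis even_Suc length_0_conv length_Cons
    list.size(3) even_zero less_Suc0 not_le_imp_less)

lemma lng_Cons:
  assumes "X \<subseteq> S" "t \<in> X"
  obtains p where "lng X \<sim> t # p" "set p \<subseteq> X"
  using lng_prefix[OF assms(1) reduced_single[of t]] assms(2) by auto

section \<open>Left cancellation and least common multiples\<close>

text \<open>Left cancellation and least common multiples of generators are stated at a single word \<open>w\<close>,
  since they are proved simultaneously by induction on the length.\<close>

definition loc :: "'s list \<Rightarrow> bool" where
  "loc w \<longleftrightarrow> (\<forall>s u t v. w \<sim> s # u \<longrightarrow> w \<sim> t # v \<longrightarrow>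
    (if s = t then u \<sim> v else m s t \<noteq> 0 \<and>
      (\<exists>p. u \<sim> alt (m s t - 1) t s @ p \<and> v \<sim> alt (m s t - 1) s t @ p)))"

lemma loc_cancel: "loc w \<Longrightarrow> w \<sim> s # u \<Longrightarrow> w \<sim> s # v \<Longrightarrow> u \<sim> v"
  unfolding loc_def by metis

lemma loc_lcm:
  assumes "loc w" "w \<sim> s # u" "w \<sim> t # v" "s \<noteq> t"
  obtains p where "m s t \<noteq> 0" "u \<sim> alt (m s t - 1) t s @ p" "v \<sim> alt (m s t - 1) s t @ p"
  using assms unfolding loc_def by metis

lemma braid_rel_sym: "(r, l) \<in> braid_rel m \<Longrightarrow> (l, r) \<in> braid_rel m"
proof -
  assume "(r, l) \<in> braid_rel m"
  then obtain s t where "s \<noteq> t" "m s t \<noteq> 0" "r = alt (m s t) s t" "l = alt (m s t) t s"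
    unfolding braid_rel_def by blast
  then have "t \<noteq> s" "m t s \<noteq> 0" "l = alt (m t s) t s" "r = alt (m t s) s t"
    by (simp_all add: m_sym[of t s])
  then show "(l, r) \<in> braid_rel m" unfolding braid_rel_def by blast
qed

lemma alt_m_Cons': "s \<noteq> t \<Longrightarrow> m s t \<noteq> 0 \<Longrightarrow> alt (m s t) t s = t # alt (m s t - 1) s t"
  by (cases "m s t") auto

text \<open>By \<open>matsumoto\<close>, braid equivalence of reduced words of equal length is
  equality in the Coxeter group. Cancellation is then cancellation in a group, and the common
  multiple is supplied by \<open>two_descents\<close>.\<close>

lemma loc_reduced:
  assumes "reduced w" shows "loc w"
  unfolding loc_def
proof (intro allI impI)
  fix s u t v assume su: "w \<sim> s # u" and tv: "w \<sim> t # v"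
  have red: "reduced (s # u)" "reduced (t # v)"
    using reduced_beq[OF assms weq_sym[OF su]] reduced_beq[OF assms weq_sym[OF tv]] .
  have stuv: "s # u \<sim> t # v" by (rule weq_trans[OF weq_sym[OF su] tv])
  then have len: "length u = length v" using beq_length by fastforce
  show "if s = t then u \<sim> v else m s t \<noteq> 0 \<and>
      (\<exists>p. u \<sim> alt (m s t - 1) t s @ p \<and> v \<sim> alt (m s t - 1) s t @ p)"
  proof (cases "s = t")
    case True
    then have "u \<approx> v" using beq_imp_ceq[OF stuv] by simp
    then show ?thesis using True matsumoto[OF reduced_tl[OF red(1)] _ len] by simp
  next
    case False
    obtain p where p: "m s t \<noteq> 0" "s # u \<approx> alt (m s t) s t @ p" "Suc (length u) = m s t + length p"
      using two_descents[OF False red(1) beq_imp_ceq[OF stuv] len] by blast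
    have "u \<approx> alt (m s t - 1) t s @ p" using p(2) alt_m_Cons[OF False p(1)] by simp
    then have 1: "u \<sim> alt (m s t - 1) t s @ p"
      by (rule matsumoto[OF reduced_tl[OF red(1)]]) (use p in simp)
    have "t # v \<approx> alt (m s t) s t @ p" by (rule weq_trans[OF weq_sym[OF beq_imp_ceq[OF stuv]] p(2)])
    also have "alt (m s t) s t @ p \<approx> alt (m s t) t s @ p"
      by (rule weq_right[OF beq_imp_ceq[OF beq_braid[OF False p(1)]]])
    finally have "v \<approx> alt (m s t - 1) s t @ p" using alt_m_Cons'[OF False p(1)] by simp
    then have 2: "v \<sim> alt (m s t - 1) s t @ p"
      by (rule matsumoto[OF reduced_tl[OF red(2)]]) (use p len in simp)
    show ?thesis using 1 2 False p(1) by auto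
  qed
qed

text \<open>A common version of two existence statements: with \<open>K1 = K2\<close> it yields greatest common
  divisors, and with \<open>K2\<close> the reduced words it compares joins in the monoid and in the weak order.\<close>

lemma common_multiple:
  assumes K1: "\<And>w. K1 w \<Longrightarrow> loc w" "\<And>w w'. K1 w \<Longrightarrow> w \<sim> w' \<Longrightarrow> K1 w'" "\<And>s w. K1 (s # w) \<Longrightarrow> K1 w"
    and K2: "\<And>w. K2 w \<Longrightarrow> loc w" "\<And>w w'. K2 w \<Longrightarrow> w \<sim> w' \<Longrightarrow> K2 w'" "\<And>s w. K2 (s # w) \<Longrightarrow> K2 w"
    and "K1 w" "K2 y" "w \<sim> a @ p" "w \<sim> b @ q" "y \<sim> a @ p'" "y \<sim> b @ q'"
  shows "\<exists>c r r' a' b'. w \<sim> c @ r \<and> y \<sim> c @ r' \<and> c \<sim> a @ a' \<and> c \<sim> b @ b'"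
  using assms(7-12)
proof (induction "length w" arbitrary: w y a b p q p' q' rule: less_induct)
  case less
  note K = less.prems(1,2)
  \<comment> \<open>A common first letter is cancelled in both \<open>w\<close> and
    \<open>y\<close>, and the induction hypothesis is applied to the shorter words.\<close>
  have same: "\<exists>c r r' a' b'. w \<sim> s # c @ r \<and> y \<sim> s # c @ r' \<and> c \<sim> a @ a' \<and> c \<sim> b @ b'"
    if wy: "w \<sim> s # a @ p" "w \<sim> s # b @ q" "y \<sim> s # a @ p'" "y \<sim> s # b @ q'" for s a b p q p' q'
  proof -
    have "\<exists>c r r' a' b'. a @ p \<sim> c @ r \<and> a @ p' \<sim> c @ r' \<and> c \<sim> a @ a' \<and> c \<sim> b @ b'"
    proof (rule less.hyps)
      show "length (a @ p) < length w" using beq_length[OF wy(1)] by simp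
      show "K1 (a @ p)" by (rule K1(3)[OF K1(2)[OF K(1) wy(1)]])
      show "K2 (a @ p')" by (rule K2(3)[OF K2(2)[OF K(2) wy(3)]])
      show "a @ p \<sim> b @ q" by (rule loc_cancel[OF K1(1)[OF K(1)] wy(1,2)])
      show "a @ p' \<sim> b @ q'" by (rule loc_cancel[OF K2(1)[OF K(2)] wy(3,4)])
    qed (rule weq_refl)+
    then obtain c r r' a' b' where c: "a @ p \<sim> c @ r" "a @ p' \<sim> c @ r'" "c \<sim> a @ a'" "c \<sim> b @ b'" by blast
    have "w \<sim> s # c @ r" by (rule weq_trans[OF wy(1) weq_Cons[OF c(1)]])
    moreover have "y \<sim> s # c @ r'" by (rule weq_trans[OF wy(3) weq_Cons[OF c(2)]])
    ultimately show ?thesis using c(3,4) by blast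
  qed
  show ?case
  proof (cases a)
    case Nil
    then show ?thesis using less.prems(4,6) by (intro exI[of _ b] exI[of _ q] exI[of _ q'] exI[of _ b] exI[of _ "[]"]) simp
  next
    case a: (Cons s a1)
    show ?thesis
    proof (cases b)
      case Nil
      then show ?thesis using less.prems(3,5) by (intro exI[of _ a] exI[of _ p] exI[of _ p'] exI[of _ "[]"] exI[of _ a]) simp
    next
      case b: (Cons t b1)
      show ?thesis
      proof (cases "s = t")
        case True
        obtain c r r' a' b' where c: "w \<sim> s # c @ r" "y \<sim> s # c @ r'" "c \<sim> a1 @ a'" "c \<sim> b1 @ b'"
          using same[of s a1 p b1 q p' q'] less.prems a b True by auto
        show ?thesis using c weq_Cons[OF c(3), of s] weq_Cons[OF c(4), of s] True a b
          by (intro exI[of _ "s # c"] exI[of _ r] exI[of _ r'] exI[of _ a'] exI[of _ b']) simp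
      next
        case False
        have w1: "w \<sim> s # a1 @ p" "w \<sim> t # b1 @ q" and y1: "y \<sim> s # a1 @ p'" "y \<sim> t # b1 @ q'"
          using less.prems a b by auto
        obtain p2 where p2: "m s t \<noteq> 0" "a1 @ p \<sim> alt (m s t - 1) t s @ p2"
          using loc_lcm[OF K1(1)[OF K(1)] w1 False] by blast
        obtain p3 where p3: "a1 @ p' \<sim> alt (m s t - 1) t s @ p3"
          using loc_lcm[OF K2(1)[OF K(2)] y1 False] by blast
        \<comment> \<open>Now \<open>s # c\<close> is a common multiple of \<open>a\<close> and of
          both generators \<open>s\<close> and \<open>t\<close>. Rewritten to begin with
          \<open>t\<close>, it can be compared with \<open>b\<close> by a second use of
          \<open>same\<close>.\<close>
        obtain c r r' a' d where c: "w \<sim> s # c @ r" "y \<sim> s # c @ r'" "c \<sim> a1 @ a'" "c \<sim> alt (m s t - 1) t s @ d"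
          using same[OF w1(1) weq_trans[OF w1(1) weq_Cons[OF p2(2)]] y1(1) weq_trans[OF y1(1) weq_Cons[OF p3]]]
          by blast
        have "s # c \<sim> alt (m s t) s t @ d" using weq_Cons[OF c(4), of s] alt_m_Cons[OF False p2(1)] by simp
        also have "alt (m s t) s t @ d \<sim> alt (m s t) t s @ d"
          by (rule weq_right[OF beq_braid[OF False p2(1)]])
        finally have sc: "s # c \<sim> t # alt (m s t - 1) s t @ d" using alt_m_Cons'[OF False p2(1)] by simp
        have wt: "w \<sim> t # (alt (m s t - 1) s t @ d) @ r" "y \<sim> t # (alt (m s t - 1) s t @ d) @ r'"
          using weq_trans[OF c(1), of "(t # alt (m s t - 1) s t @ d) @ r"]
            weq_trans[OF c(2), of "(t # alt (m s t - 1) s t @ d) @ r'"] weq_right[OF sc, of r] weq_right[OF sc, of r']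
          by simp_all
        obtain c2 f f' e b' where c2: "w \<sim> t # c2 @ f" "y \<sim> t # c2 @ f'"
          "c2 \<sim> (alt (m s t - 1) s t @ d) @ e" "c2 \<sim> b1 @ b'"
          using same[OF wt(1) w1(2) wt(2) y1(2)] by blast
        have "t # c2 \<sim> (t # alt (m s t - 1) s t @ d) @ e" using weq_Cons[OF c2(3), of t] by simp
        also have "(t # alt (m s t - 1) s t @ d) @ e \<sim> (s # c) @ e" by (rule weq_right[OF weq_sym[OF sc]])
        also have "(s # c) @ e \<sim> (s # a1 @ a') @ e" by (rule weq_right[OF weq_Cons[OF c(3)]])
        finally have "t # c2 \<sim> a @ a' @ e" using a by simp
        then show ?thesis using c2(1,2) weq_Cons[OF c2(4), of t] b
          by (intro exI[of _ "t # c2"] exI[of _ f] exI[of _ f'] exI[of _ "a' @ e"] exI[of _ b']) simp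
      qed
    qed
  qed
qed

text \<open>A chain of braid moves is followed from \<open>s # u\<close>, keeping the condition
  \<open>Q\<close> between \<open>s # u\<close> and the current word. Moves behind the first letter
  are harmless. A move at the front exchanges the first letter \<open>x\<close> for
  \<open>t\<close>, and \<open>Q\<close> has to pass from the pairs s, x and x, t to the pair s,
  t.\<close>

lemma loc_all: "set w \<subseteq> S \<Longrightarrow> loc w"
proof (induction "length w" arbitrary: w rule: less_induct)
  case less
  let ?K = "\<lambda>x. set x \<subseteq> S \<and> length x < length w"
  have K: "?K x \<Longrightarrow> loc x" "?K x \<Longrightarrow> x \<sim> x' \<Longrightarrow> ?K x'" "?K (s # x) \<Longrightarrow> ?K x" for s x x'
    using less.hyps beq_set[of x x'] beq_length[of x x'] by auto
  have cancel: "p \<sim> q" if "?K (g @ p)" "g @ p \<sim> g @ q" for g p q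
    using that
  proof (induction g)
    case (Cons s g)
    have "g @ p \<sim> g @ q" using loc_cancel[OF K(1)[OF Cons.prems(1)], of s] Cons.prems(2) by simp
    then show ?case using Cons by simp
  qed simp
  define Q where "Q s u t v \<longleftrightarrow> (if s = t then u \<sim> v else m s t \<noteq> 0 \<and>
    (\<exists>p. u \<sim> alt (m s t - 1) t s @ p \<and> v \<sim> alt (m s t - 1) s t @ p))" for s u t v
  have Q_trans: "Q s u t v'" if Q: "Q s u t v" and v: "v' \<sim> v" for s u t v v'
  proof (cases "s = t")
    case True
    then have "u \<sim> v" using Q by (simp add: Q_def)
    then show ?thesis using True weq_trans[OF _ weq_sym[OF v]] by (simp add: Q_def)
  next
    case False
    then obtain p where "m s t \<noteq> 0" "u \<sim> alt (m s t - 1) t s @ p" "v \<sim> alt (m s t - 1) s t @ p"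
      using Q by (auto simp: Q_def)
    then show ?thesis using False weq_trans[OF v] unfolding Q_def by auto
  qed
  have Q_braid: "Q s u t (alt (m x t - 1) x t @ q)"
    if xt: "x \<noteq> t" "m x t \<noteq> 0" and Q: "Q s u x (alt (m x t - 1) t x @ q)"
      and S: "s # u \<sim> alt (m x t) x t @ q" and len: "length (s # u) = length w" "set (s # u) \<subseteq> S"
    for s u x t q
  proof (cases "s = x")
    case True
    then show ?thesis using Q xt unfolding Q_def by auto
  next
    case False
    let ?w = "alt (m x t - 1) t x @ q"
    have w_eq: "x # ?w = alt (m x t) x t @ q" using alt_m_Cons[OF xt] by simp
    have "?K ?w"
      using beq_set[OF S] beq_length[OF S] len unfolding w_eq[symmetric] by auto
    obtain p where p: "m s x \<noteq> 0" "u \<sim> alt (m s x - 1) x s @ p" "?w \<sim> alt (m s x - 1) s x @ p"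
      using Q False unfolding Q_def by auto
    have sx: "m x s = m s x" by (rule m_sym)
    show ?thesis
    proof (cases "t = s")
      case True
      have "q \<sim> p" using cancel[of "alt (m x t - 1) t x" q p] \<open>?K ?w\<close> p(3) True sx by simp
      then have "alt (m s x - 1) x s @ p \<sim> alt (m s x - 1) x s @ q" by (rule weq_left[OF weq_sym])
      then have "u \<sim> alt (m s x - 1) x s @ q" by (rule weq_trans[OF p(2)])
      then show ?thesis unfolding Q_def True sx if_P[OF HOL.refl] .
    next
      case ts: False
      have inS: "s \<in> S" "x \<in> S" "t \<in> S"
      proof -
        have "2 \<le> m x t" using m_ne_1[OF xt(1)] xt(2) by linarith
        from set_alt_eq[OF this, of x t] have "set (s # u) = {x, t} \<union> set q" using beq_set[OF S] by simp
        then show "s \<in> S" "x \<in> S" "t \<in> S" using len(2) by auto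
      qed
      \<comment> \<open>The longest word is a reduced multiple of all three generators. Its tail
        \<open>y0\<close> after \<open>x\<close> is thus a common multiple of the same two
        alternating words as \<open>?w\<close>, and \<open>common_multiple\<close> finds a common
        multiple \<open>c\<close> of them that divides both \<open>?w\<close> and
        \<open>y0\<close>.\<close>
      obtain y0 where y0: "lng S \<sim> x # y0" using lng_Cons[OF subset_refl inS(2)] by blast
      have red: "reduced (x # y0)" by (rule reduced_beq[OF lng_reduced[OF subset_refl] weq_sym[OF y0]])
      have y0r: "reduced y0" by (rule reduced_tl[OF red])
      have pre: "\<exists>e. y0 \<sim> alt (m x s - 1) s x @ e" if s: "s \<in> S" "s \<noteq> x" for s
      proof -
        obtain v where v: "lng S \<sim> s # v" using lng_Cons[OF subset_refl s(1)] by blast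
        show ?thesis using loc_lcm[OF loc_reduced[OF lng_reduced[OF subset_refl]] y0 v s(2)[symmetric]] by blast
      qed
      obtain e where e: "y0 \<sim> alt (m s x - 1) s x @ e" using pre[OF inS(1) False] sx by auto
      obtain e' where e': "y0 \<sim> alt (m x t - 1) t x @ e'" using pre[OF inS(3)] xt(1) by auto
      have "\<exists>c r r' a' b'. ?w \<sim> c @ r \<and> y0 \<sim> c @ r' \<and> c \<sim> alt (m s x - 1) s x @ a' \<and> c \<sim> alt (m x t - 1) t x @ b'"
        by (rule common_multiple[where ?K1.0 = ?K and ?K2.0 = reduced, OF K loc_reduced
              reduced_beq[OF _ weq_sym] reduced_tl \<open>?K ?w\<close> y0r p(3) weq_refl e e'])
      then obtain c r r' a' b' where c: "?w \<sim> c @ r" "y0 \<sim> c @ r'"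
        "c \<sim> alt (m s x - 1) s x @ a'" "c \<sim> alt (m x t - 1) t x @ b'" by blast
      have 1: "alt (m s x - 1) s x @ p \<sim> alt (m s x - 1) s x @ a' @ r"
        using weq_trans[OF weq_sym[OF p(3)] weq_trans[OF c(1) weq_right[OF c(3)]]] by simp
      have pa: "p \<sim> a' @ r" by (rule cancel[OF K(2)[OF \<open>?K ?w\<close> p(3)] 1])
      have "?w \<sim> alt (m x t - 1) t x @ b' @ r" using weq_trans[OF c(1) weq_right[OF c(4)]] by simp
      then have qb: "q \<sim> b' @ r" by (rule cancel[OF \<open>?K ?w\<close>])
      define U where "U = alt (m s x - 1) x s @ a'"
      define V where "V = alt (m x t - 1) x t @ b'"
      have "x # c \<sim> alt (m s x) x s @ a'" using weq_Cons[OF c(3), of x] alt_m_Cons'[OF False p(1)] by simp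
      also have "alt (m s x) x s @ a' \<sim> alt (m s x) s x @ a'"
        by (rule weq_right[OF weq_sym[OF beq_braid[OF False p(1)]]])
      finally have xU: "x # c \<sim> s # U" using alt_m_Cons[OF False p(1)] by (simp add: U_def)
      have "x # c \<sim> alt (m x t) x t @ b'" using weq_Cons[OF c(4), of x] alt_m_Cons[OF xt] by simp
      also have "alt (m x t) x t @ b' \<sim> alt (m x t) t x @ b'" by (rule weq_right[OF beq_braid[OF xt]])
      finally have xV: "x # c \<sim> t # V" using alt_m_Cons'[OF xt] by (simp add: V_def)
      \<comment> \<open>Since \<open>c\<close> divides \<open>y0\<close>, the word
        \<open>x # c\<close> is reduced and the Coxeter group provides the common multiple of
        \<open>s\<close> and \<open>t\<close>, whether or not \<open>x # ?w\<close> is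
        reduced.\<close>
      have "reduced ((x # c) @ r')"
        by (rule reduced_beq[OF red]) (use weq_Cons[OF weq_sym[OF c(2)], of x] in simp)
      then have "loc (x # c)" by (rule loc_reduced[OF reduced_append(1)])
      then obtain p3 where p3: "m s t \<noteq> 0" "U \<sim> alt (m s t - 1) t s @ p3" "V \<sim> alt (m s t - 1) s t @ p3"
        using loc_lcm[OF _ xU xV ts[symmetric]] by blast
      have "u \<sim> U @ r" unfolding U_def using weq_trans[OF p(2) weq_left[OF pa]] by simp
      also have "U @ r \<sim> alt (m s t - 1) t s @ p3 @ r" using weq_right[OF p3(2)] by simp
      finally have 1: "u \<sim> alt (m s t - 1) t s @ p3 @ r" .
      have "alt (m x t - 1) x t @ q \<sim> V @ r" using weq_left[OF qb] by (simp add: V_def)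
      also have "V @ r \<sim> alt (m s t - 1) s t @ p3 @ r" using weq_right[OF p3(3)] by simp
      finally show ?thesis using 1 ts p3(1) unfolding Q_def by auto
    qed
  qed
  have chain: "\<forall>t v. y = t # v \<longrightarrow> Q s u t v"
    if "s # u \<sim> y" "length (s # u) = length w" "set (s # u) \<subseteq> S" for s u y
    using that(1) unfolding weq_def
  proof induction
    case base
    then show ?case by (simp add: Q_def)
  next
    case (step y y')
    have suy: "s # u \<sim> y" using step(1) by (simp add: weq_def)
    obtain p l r q where plr: "y = p @ l @ q" "y' = p @ r @ q" "(l, r) \<in> braid_rel m \<or> (r, l) \<in> braid_rel m"
      using step(2) unfolding wstep_def by blast
    then obtain x t where xt: "x \<noteq> t" "m x t \<noteq> 0" "l = alt (m x t) x t" "r = alt (m x t) t x"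
      using braid_rel_sym[of r l] unfolding braid_rel_def by blast
    have lr: "l \<sim> r" unfolding xt by (rule beq_braid[OF xt(1,2)])
    show ?case
    proof (intro allI impI)
      fix t' v assume y': "y' = t' # v"
      show "Q s u t' v"
      proof (cases p)
        case Nil
        have "y = x # alt (m x t - 1) t x @ q" using plr Nil xt alt_m_Cons[OF xt(1,2)] by simp
        then have "Q s u x (alt (m x t - 1) t x @ q)" using step(3) by blast
        then have "Q s u t (alt (m x t - 1) x t @ q)"
          by (rule Q_braid[OF xt(1,2) _ _ that(2,3)]) (use suy plr Nil xt in simp)
        moreover have "t' = t" "v = alt (m x t - 1) x t @ q"
          using y' plr(2) Nil xt alt_m_Cons'[OF xt(1,2)] by auto
        ultimately show ?thesis by simp
      next
        case (Cons z p')
        then have "Q s u z (p' @ l @ q)" using step(3) plr(1) by simp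
        then have "Q s u z (p' @ r @ q)" by (rule Q_trans) (rule weq_ctx[OF weq_sym[OF lr]])
        then show ?thesis using y' plr(2) Cons by simp
      qed
    qed
  qed
  show ?case unfolding loc_def
  proof (intro allI impI)
    fix s u t v assume su: "w \<sim> s # u" and tv: "w \<sim> t # v"
    have "Q s u t v"
      using chain[OF weq_trans[OF weq_sym[OF su] tv]] beq_length[OF su] beq_set[OF su] less.prems by simp
    then show "if s = t then u \<sim> v else m s t \<noteq> 0 \<and>
        (\<exists>p. u \<sim> alt (m s t - 1) t s @ p \<and> v \<sim> alt (m s t - 1) s t @ p)" by (simp add: Q_def)
  qed
qed

lemma beq_cancel_left:
  assumes "set (g @ p) \<subseteq> S" "g @ p \<sim> g @ q" shows "p \<sim> q"
  using assms
proof (induction g)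
  case (Cons s g)
  have "g @ p \<sim> g @ q" using loc_cancel[OF loc_all[OF Cons.prems(1)], of s] Cons.prems(2) by simp
  then show ?case using Cons by simp
qed simp

section \<open>Greatest common divisors\<close>

text \<open>A longest common divisor \<open>d\<close> absorbs every other one:
  \<open>common_multiple\<close> gives a common multiple of \<open>d\<close> and \<open>e\<close>
  that is again a common divisor, hence no longer than \<open>d\<close>.\<close>

lemma gcd_exists:
  assumes "set w \<subseteq> S" "set y \<subseteq> S"
  shows "\<exists>d. (\<exists>p. w \<sim> d @ p) \<and> (\<exists>p. y \<sim> d @ p) \<and>
    (\<forall>e. (\<exists>p. w \<sim> e @ p) \<longrightarrow> (\<exists>p. y \<sim> e @ p) \<longrightarrow> (\<exists>p. d \<sim> e @ p))"
proof -
  let ?P = "\<lambda>d. (\<exists>p. w \<sim> d @ p) \<and> (\<exists>p. y \<sim> d @ p)"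
  have "?P []" by (auto intro: exI[of _ w] exI[of _ y])
  moreover have "?P d \<Longrightarrow> length d < Suc (length w)" for d using beq_length[of w] by fastforce
  ultimately obtain d where d: "?P d" "\<And>e. ?P e \<Longrightarrow> length e \<le> length d"
    using ex_has_greatest_nat[of ?P "[]" length "Suc (length w)"] by blast
  have "\<exists>p. d \<sim> e @ p" if e: "?P e" for e
  proof -
    obtain p p' q q' where pq: "w \<sim> d @ p" "w \<sim> e @ q" "y \<sim> d @ p'" "y \<sim> e @ q'" using d e by blast
    have "\<exists>c r r' a' b'. w \<sim> c @ r \<and> y \<sim> c @ r' \<and> c \<sim> d @ a' \<and> c \<sim> e @ b'"
    proof (rule common_multiple[where ?K1.0 = "\<lambda>w. set w \<subseteq> S" and ?K2.0 = "\<lambda>w. set w \<subseteq> S",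
          OF loc_all _ _ loc_all _ _ assms pq])
      show "set w \<subseteq> S \<Longrightarrow> w \<sim> w' \<Longrightarrow> set w' \<subseteq> S" for w w' using beq_set[of w w'] by simp
      then show "set w \<subseteq> S \<Longrightarrow> w \<sim> w' \<Longrightarrow> set w' \<subseteq> S" for w w' .
    qed simp_all
    then obtain c r r' a' b' where c: "w \<sim> c @ r" "y \<sim> c @ r'" "c \<sim> d @ a'" "c \<sim> e @ b'" by blast
    then have "length c \<le> length d" using d(2) by blast
    then have "a' = []" using beq_length[OF c(3)] by simp
    then have "d \<sim> e @ b'" using weq_trans[OF weq_sym[OF c(3)] c(4)] by simp
    then show ?thesis by blast
  qed
  then show ?thesis using d(1) by blast
qed

section \<open>Conjugation by longest words\<close>

lemma lng_snoc_not_reduced: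
  assumes X: "X \<subseteq> S" "t \<in> X" shows "\<not> reduced (lng X @ [t])"
proof
  assume *: "reduced (lng X @ [t])"
  have "set (lng X @ [t]) \<subseteq> X" using lng_set[OF X(1)] X(2) by simp
  from lng_prefix[OF X(1) * this] obtain p where "lng X \<sim> (lng X @ [t]) @ p" by blast
  from beq_length[OF this] show False by simp
qed

text \<open>If \<open>lng X\<close> is written as \<open>t # v\<close>, then the reduced word
  \<open>v\<close> is itself a prefix of \<open>lng X\<close>, and exactly one letter
  \<open>t'\<close> remains. Both sides are then the word t v t'.\<close>

lemma lng_conj:
  assumes X: "X \<subseteq> S" "t \<in> X" shows "\<exists>t'\<in>X. t # lng X \<sim> lng X @ [t']"
proof -
  obtain v where v: "lng X \<sim> t # v" "set v \<subseteq> X" using lng_Cons[OF X] by blast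
  have "reduced (t # v)" by (rule reduced_beq[OF lng_reduced[OF X(1)] weq_sym[OF v(1)]])
  then have "reduced v" by (rule reduced_tl)
  from lng_prefix[OF X(1) this v(2)] obtain p where p: "lng X \<sim> v @ p" "set p \<subseteq> X" by blast
  have "length p = 1" using beq_length[OF v(1)] beq_length[OF p(1)] by simp
  then obtain t' where t': "p = [t']" by (auto simp: length_Suc_conv)
  have "t # lng X \<sim> t # v @ [t']" using weq_Cons[OF p(1)] t' by simp
  also have "t # v @ [t'] \<sim> lng X @ [t']" using weq_right[OF weq_sym[OF v(1)], of "[t']"] by simp
  finally show ?thesis using p(2) t' by auto
qed

lemma rev_reduced: "reduced (rev w) \<longleftrightarrow> reduced w"
proof -
  have *: "reduced (rev w)" if "reduced w" for w
    unfolding reduced_def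
  proof (intro allI impI)
    fix v assume "v \<approx> rev w"
    then have "rev v \<approx> w" using rev_ceq by fastforce
    then show "length (rev w) \<le> length v" using reducedD[OF that] by fastforce
  qed
  show ?thesis using *[of w] *[of "rev w"] by auto
qed

text \<open>Passing \<open>lng S\<close> twice turns \<open>t\<close> into some generator
  \<open>t''\<close>. In the Coxeter group the square of \<open>lng S\<close> is trivial, so
  \<open>t\<close> and \<open>t''\<close> are equal there, and distinct generators stay
  distinct.\<close>

lemma lng_central: assumes "t \<in> S" shows "t # lng S @ lng S \<sim> lng S @ lng S @ [t]"
proof -
  let ?w = "lng S"
  have red: "reduced (rev ?w)" using lng_reduced[of S] rev_reduced by simp
  have "set (rev ?w) \<subseteq> S" using lng_set[of S] by simp
  from lng_prefix[OF subset_refl red this] obtain p where p: "?w \<sim> rev ?w @ p" by blast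
  then have "p = []" using beq_length by fastforce
  then have "?w @ ?w \<approx> rev ?w @ ?w" using beq_imp_ceq[OF p] by (intro weq_right) simp
  also have "rev ?w @ ?w \<approx> []" by (rule inv_left)
  finally have sq: "?w @ ?w \<approx> []" .
  obtain t' where t': "t' \<in> S" "t # ?w \<sim> ?w @ [t']" using lng_conj[OF subset_refl assms] by blast
  obtain t'' where t'': "t'' \<in> S" "t' # ?w \<sim> ?w @ [t'']" using lng_conj[OF subset_refl t'(1)] by blast
  have "t # ?w @ ?w \<sim> ?w @ t' # ?w" using weq_right[OF t'(2), of ?w] by simp
  also have "?w @ t' # ?w \<sim> ?w @ ?w @ [t'']" using weq_left[OF t''(2), of ?w] by simp
  finally have *: "t # ?w @ ?w \<sim> ?w @ ?w @ [t'']" .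
  have "[t] \<approx> [t] @ ?w @ ?w" using weq_left[OF weq_sym[OF sq], of "[t]"] by simp
  also have "[t] @ ?w @ ?w \<approx> (?w @ ?w) @ [t'']" using beq_imp_ceq[OF *] by simp
  also have "(?w @ ?w) @ [t''] \<approx> [t'']" using weq_right[OF sq, of "[t'']"] by simp
  finally have "t = t''" by (rule ceq_singletonD)
  then show ?thesis using * by simp
qed

section \<open>The minimal coset representative \<open>r\<close>\<close>

context
  fixes X r assumes X: "X \<subseteq> S" and r: "lng S \<sim> lng X @ r"
begin

lemma lng_r_reduced: "reduced (lng X @ r)"
  by (rule reduced_beq[OF lng_reduced[OF subset_refl] weq_sym[OF r]])

lemma r_no_descent: assumes "t \<in> X" shows "\<not> r \<sim> t # p"
proof
  assume "r \<sim> t # p"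
  then have "lng X @ r \<sim> (lng X @ [t]) @ p" using weq_left[of _ r "t # p" "lng X"] by simp
  then have "reduced ((lng X @ [t]) @ p)" using reduced_beq[OF lng_r_reduced weq_sym] by blast
  then show False using reduced_append(1) lng_snoc_not_reduced[OF X assms] by blast
qed

text \<open>If \<open>s\<close> could not be appended to \<open>lng X\<close> in a reduced way,
  exchange would give a reduced word for its reverse that contains \<open>s\<close>; but braid moves
  do not change the set of letters. So \<open>lng S\<close>, and with it \<open>r\<close>, can be
  continued by \<open>s\<close> after \<open>lng X\<close>.\<close>

lemma r_descent: assumes "s \<in> S" "s \<notin> X" shows "\<exists>p. r \<sim> s # p"
proof -
  have "reduced (s # rev (lng X))"
  proof (rule ccontr)
    assume "\<not> reduced (s # rev (lng X))"
    then obtain a y b where *: "rev (lng X) = a @ y # b" "s # a @ b \<approx> rev (lng X)" "reduced (s # a @ b)"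
      by (rule exchange_condition[OF iffD2[OF rev_reduced lng_reduced[OF X]]])
    then have "s # a @ b \<sim> rev (lng X)" by (intro matsumoto) auto
    from beq_set[OF this] show False using lng_set[OF X] assms(2) by auto
  qed
  then have red: "reduced (lng X @ [s])" using rev_reduced[of "lng X @ [s]"] by simp
  have "set (lng X @ [s]) \<subseteq> S" using lng_set[OF X] X assms(1) by auto
  from lng_prefix[OF subset_refl red this] obtain p where p: "lng S \<sim> (lng X @ [s]) @ p" by blast
  have "lng X @ r \<sim> lng X @ s # p" using weq_trans[OF weq_sym[OF r] p] by simp
  then have "r \<sim> s # p" using beq_cancel_left beq_set[OF r] lng_set[of S] by blast
  then show ?thesis by blast
qed

text \<open>The word \<open>t # h\<close> is reduced because \<open>lng X\<close> can be written
  with last letter \<open>t\<close>, and \<open>t # g\<close> is reduced because \<open>r\<close>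
  has no left descent in X. On the other hand \<open>t # g @ [t']\<close> is not reduced. Exchange
  therefore deletes the last letter \<open>t'\<close>; deleting a letter of \<open>g\<close> would
  shorten \<open>t # g\<close>.\<close>

lemma r_exchange:
  assumes "t \<in> X" "r \<sim> g @ g'" "r \<sim> h @ h'" "t # h \<sim> g @ [t']"
  shows "h \<sim> g"
proof -
  have "\<not> reduced (t # rev (lng X))"
    using lng_snoc_not_reduced[OF X assms(1)] rev_reduced[of "lng X @ [t]"] by simp
  then obtain a y b where ab: "rev (lng X) = a @ y # b" "t # a @ b \<approx> rev (lng X)"
    by (rule exchange_condition[OF iffD2[OF rev_reduced lng_reduced[OF X]]])
  have "lng X \<approx> rev (a @ b) @ [t]" using rev_ceq[OF weq_sym[OF ab(2)]] by simp
  then have "lng X \<sim> rev (a @ b) @ [t]"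
    using arg_cong[OF ab(1), of length] by (intro matsumoto[OF lng_reduced[OF X]]) simp_all
  then have "lng X @ r \<sim> (rev (a @ b) @ [t]) @ h @ h'" using assms(3) by (rule weq_append)
  then have "reduced ((rev (a @ b) @ [t]) @ h @ h')" using reduced_beq[OF lng_r_reduced weq_sym] by blast
  then have "reduced (rev (a @ b) @ ((t # h) @ h'))" by simp
  then have th: "reduced (t # h)" by (rule reduced_append(1)[OF reduced_append(2)])
  have gt: "reduced (g @ [t'])" by (rule reduced_beq[OF th weq_sym[OF assms(4)]])
  have gr: "reduced g" by (rule reduced_append(1)[OF gt])
  have tg: "reduced (t # g)"
  proof (rule ccontr)
    assume "\<not> reduced (t # g)"
    then obtain a y b where *: "g = a @ y # b" "t # a @ b \<approx> g" by (rule exchange_condition[OF gr])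
    then have "g \<sim> t # a @ b" using matsumoto[OF gr weq_sym[OF *(2)]] by simp
    from weq_trans[OF assms(2) weq_right[OF this]] have "r \<sim> t # (a @ b @ g')" by simp
    then show False using r_no_descent[OF assms(1)] by blast
  qed
  have eq: "g @ [t'] \<approx> t # h" by (rule weq_sym[OF beq_imp_ceq[OF assms(4)]])
  have "\<not> reduced (t # g @ [t'])"
    by (rule descent_not_reduced[OF gt weq_sym[OF eq]]) (use beq_length[OF assms(4)] in simp)
  then obtain a y b where ab: "g @ [t'] = a @ y # b" "t # a @ b \<approx> g @ [t']"
    by (rule exchange_condition[OF gt])
  have len: "length h = length g" using beq_length[OF assms(4)] by simp
  show ?thesis
  proof (cases b rule: rev_cases)
    case Nil
    then have "t # g \<approx> g @ [t']" using ab by simp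
    from weq_trans[OF this eq] have "g \<approx> h" by simp
    from weq_sym[OF this] have "h \<approx> g" .
    then show ?thesis by (rule matsumoto[OF reduced_tl[OF th] _ len])
  next
    case (snoc b0 y')
    then have g: "g = a @ y # b0" "y' = t'" using ab(1) by auto
    then have "(t # a @ b0) @ [t'] \<approx> g @ [t']" using ab(2) snoc by simp
    then have "t # a @ b0 \<approx> g" by (simp only: cancel_right)
    then have "a @ b0 \<approx> t # g" by (simp add: move_Cons)
    from reducedD[OF tg this] show ?thesis using g by simp
  qed
qed

end

lemma lng_dvd: assumes "X \<subseteq> S" obtains r where "lng S \<sim> lng X @ r"
proof -
  have "set (lng X) \<subseteq> S" using lng_set[OF assms] assms by blast
  then show thesis using lng_prefix[OF subset_refl lng_reduced[OF assms]] that by blast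
qed

end

section \<open>Groups of bijections\<close>

typedef 'a bijection = "{f :: 'a \<Rightarrow> 'a. bij f}"
  by (rule exI[of _ id]) simp

setup_lifting type_definition_bijection

instantiation bijection :: (type) group_add
begin

lift_definition zero_bijection :: "'a bijection" is id by simp

lift_definition plus_bijection :: "'a bijection \<Rightarrow> 'a bijection \<Rightarrow> 'a bijection" is "\<lambda>f g. f \<circ> g"
  by (rule bij_comp)

lift_definition uminus_bijection :: "'a bijection \<Rightarrow> 'a bijection" is "\<lambda>f. inv_into UNIV f"
  by (rule bij_imp_bij_inv)

definition minus_bijection :: "'a bijection \<Rightarrow> 'a bijection \<Rightarrow> 'a bijection" where
  "minus_bijection f g = f + - g"

instance
proof
  fix a b c :: "'a bijection"
  show "a + b + c = a + (b + c)" by transfer (simp add: comp_assoc)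
  show "0 + a = a" by transfer simp
  show "a + 0 = a" by transfer simp
  show "- a + a = 0" by transfer (simp add: bij_is_inj)
  show "a + - b = a - b" by (simp add: minus_bijection_def)
qed

end

text \<open>The regular representation turns a group given by a carrier into a subset of an instance of
  \<open>group_add\<close>.\<close>

definition left_mult :: "('a, 'b) monoid_scheme \<Rightarrow> 'a \<Rightarrow> 'a bijection" where
  "left_mult G g = Abs_bijection (\<lambda>x. if x \<in> carrier G then g \<otimes>\<^bsub>G\<^esub> x else x)"

context group
begin

lemma Rep_left_mult:
  assumes "g \<in> carrier G"
  shows "Rep_bijection (left_mult G g) = (\<lambda>x. if x \<in> carrier G then g \<otimes> x else x)"
proof -
  have "bij (\<lambda>x. if x \<in> carrier G then g \<otimes> x else x)"
  proof (rule o_bij[of "\<lambda>x. if x \<in> carrier G then inv g \<otimes> x else x"])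
    show "(\<lambda>x. if x \<in> carrier G then inv g \<otimes> x else x) \<circ> (\<lambda>x. if x \<in> carrier G then g \<otimes> x else x) = id"
      using assms by (auto simp: fun_eq_iff m_assoc[symmetric])
    show "(\<lambda>x. if x \<in> carrier G then g \<otimes> x else x) \<circ> (\<lambda>x. if x \<in> carrier G then inv g \<otimes> x else x) = id"
      using assms by (auto simp: fun_eq_iff m_assoc[symmetric])
  qed
  then show ?thesis unfolding left_mult_def by (simp add: Abs_bijection_inverse)
qed

lemma left_mult_mult:
  assumes "g \<in> carrier G" "h \<in> carrier G"
  shows "left_mult G (g \<otimes> h) = left_mult G g + left_mult G h"
  using assms by (simp add: Rep_bijection_inject[symmetric] plus_bijection.rep_eq Rep_left_mult fun_eq_iff m_assoc)

lemma left_mult_one: "left_mult G \<one> = 0"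
  by (simp add: Rep_bijection_inject[symmetric] zero_bijection.rep_eq Rep_left_mult fun_eq_iff)

lemma left_mult_inv: "g \<in> carrier G \<Longrightarrow> left_mult G (inv g) = - left_mult G g"
  by (rule minus_unique[symmetric]) (simp add: left_mult_mult[symmetric] left_mult_one)

lemma left_mult_inj: "inj_on (left_mult G) (carrier G)"
proof (rule inj_onI)
  fix g h assume *: "g \<in> carrier G" "h \<in> carrier G" "left_mult G g = left_mult G h"
  then have "Rep_bijection (left_mult G g) \<one> = Rep_bijection (left_mult G h) \<one>" by simp
  then show "g = h" unfolding Rep_left_mult[OF *(1)] Rep_left_mult[OF *(2)] using *(1,2) by simp
qed

end

section \<open>Artin--Tits groups of spherical type\<close>

definition cls :: "'s set \<Rightarrow> ('s word \<times> 's word) set \<Rightarrow> 's word \<Rightarrow> 's word set" where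
  "cls S R w = word_cong S R `` {w}"

lemma cls_eq_iff: "u \<in> words S \<Longrightarrow> v \<in> words S \<Longrightarrow> cls S R u = cls S R v \<longleftrightarrow> (u, v) \<in> word_cong S R"
  unfolding cls_def using eq_equiv_class_iff[OF equiv_word_cong] .

lemma words_append [simp]: "u @ v \<in> words S \<longleftrightarrow> u \<in> words S \<and> v \<in> words S"
  by (auto simp: words_def)

lemma words_Nil [simp]: "[] \<in> words S"
  by (simp add: words_def)

lemma words_Cons [simp]: "x # w \<in> words S \<longleftrightarrow> fst x \<in> S \<and> w \<in> words S"
  by (cases x) (auto simp: words_def)

lemma carrier_presented_group: "carrier (presented_group S R) = cls S R ` words S"
  by (auto simp: presented_group_def quotient_def cls_def)

lemma one_presented_group: "\<one>\<^bsub>presented_group S R\<^esub> = cls S R []"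
  by (simp add: presented_group_def cls_def)

lemma mult_presented_group:
  "u \<in> words S \<Longrightarrow> v \<in> words S \<Longrightarrow> cls S R u \<otimes>\<^bsub>presented_group S R\<^esub> cls S R v = cls S R (u @ v)"
  unfolding cls_def by (rule presented_group_mult)

lemma inv_presented_group:
  assumes "w \<in> words S"
  shows "inv\<^bsub>presented_group S R\<^esub> cls S R w = cls S R (rev (map (\<lambda>(s, b). (s, \<not> b)) w))"
proof -
  interpret group "presented_group S R" by (rule group_presented_group)
  let ?i = "rev (map (\<lambda>(s, b). (s, \<not> b)) w)"
  have i: "?i \<in> words S" using assms by (auto simp: words_def)
  have "cls S R ?i \<otimes>\<^bsub>presented_group S R\<^esub> cls S R w = \<one>\<^bsub>presented_group S R\<^esub>"
    using word_cong_inverse[OF assms, of R] assms i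
    by (simp add: mult_presented_group one_presented_group cls_eq_iff)
  then show ?thesis using i assms by (intro inv_equality) (auto simp: carrier_presented_group)
qed

definition pos :: "'s list \<Rightarrow> 's word" where
  "pos w = map (\<lambda>s. (s, True)) w"

lemma pos_words [simp]: "pos w \<in> words S \<longleftrightarrow> set w \<subseteq> S"
  by (auto simp: pos_def words_def)

lemma pos_append: "pos (u @ v) = pos u @ pos v"
  by (simp add: pos_def)

lemma map_fst_pos [simp]: "map fst (pos w) = w"
  by (simp add: pos_def comp_def)

lemma alt_word_pos: "alt_word n s t = pos (alt n s t)"
  by (induction n arbitrary: s t) (auto simp: pos_def)

text \<open>The Coxeter part treats every element of the type as a generator. Pairs not inside S,
  and the diagonal, receive 0, so no braid relation involves a letter outside S.\<close>

definition cox_matrix :: "'s set \<Rightarrow> ('s \<Rightarrow> 's \<Rightarrow> enat) \<Rightarrow> 's \<Rightarrow> 's \<Rightarrow> nat" where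
  "cox_matrix S M s t =
    (if s \<in> S \<and> t \<in> S \<and> s \<noteq> t then case M s t of enat n \<Rightarrow> n | \<infinity> \<Rightarrow> 0 else 0)"

lemma coxeter_cox_matrix:
  assumes "coxeter_data S M" shows "coxeter (cox_matrix S M)"
proof
  show "cox_matrix S M s t = cox_matrix S M t s" for s t
    using assms by (auto simp: cox_matrix_def coxeter_data_def)
  show "cox_matrix S M s t \<noteq> 1" if "s \<noteq> t" for s t
  proof
    assume "cox_matrix S M s t = 1"
    then have "s \<in> S" "t \<in> S" "M s t = enat 1"
      by (auto simp: cox_matrix_def split: if_splits enat.splits)
    moreover have "2 \<le> M s t"
      using assms that \<open>s \<in> S\<close> \<open>t \<in> S\<close> unfolding coxeter_data_def by blast
    ultimately show False by (simp add: numeral_eq_enat)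
  qed
qed

locale artin = coxeter "cox_matrix S M" for S :: "'s set" and M :: "'s \<Rightarrow> 's \<Rightarrow> enat" +
  assumes data: "coxeter_data S M"
begin

abbreviation "m \<equiv> cox_matrix S M"
abbreviation cox_eq (infix "\<approx>" 50) where "u \<approx> v \<equiv> weq (cox_rel m) u v"
abbreviation braid_eq (infix "\<sim>" 50) where "u \<sim> v \<equiv> weq (braid_rel m) u v"
abbreviation "R \<equiv> artin_relations S M"
abbreviation "G \<equiv> artin_group S M"

sublocale group G
  unfolding artin_group_def by (rule group_presented_group)

section \<open>The map to the Coxeter group and its kernel\<close>

lemma relator_braid: "(u, v) \<in> R \<Longrightarrow> (map fst u, map fst v) \<in> braid_rel m"
proof -
  assume "(u, v) \<in> R"
  then obtain n s t where *: "u = alt_word n s t" "v = alt_word n t s" "s \<in> S" "t \<in> S" "s \<noteq> t" "M s t = enat n"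
    unfolding artin_relations_def by blast
  then have "m s t = n" by (simp add: cox_matrix_def)
  moreover have "2 \<le> M s t" using data *(3-5) unfolding coxeter_data_def by blast
  then have "n \<noteq> 0" using *(6) by (auto simp: numeral_eq_enat)
  ultimately show ?thesis unfolding braid_rel_def * alt_word_pos map_fst_pos using *(5) by blast
qed

lemma braid_relator: "(l, r) \<in> braid_rel m \<Longrightarrow> (pos l, pos r) \<in> R"
proof -
  assume "(l, r) \<in> braid_rel m"
  then obtain s t where *: "s \<noteq> t" "m s t \<noteq> 0" "l = alt (m s t) s t" "r = alt (m s t) t s"
    unfolding braid_rel_def by blast
  then have "s \<in> S" "t \<in> S" "M s t = enat (m s t)" by (auto simp: cox_matrix_def split: if_splits enat.splits)
  then show ?thesis using *(1) unfolding artin_relations_def * alt_word_pos by blast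
qed

text \<open>Forgetting the signs is the homomorphism to the Coxeter group, in which every generator
  is its own inverse.\<close>

lemma word_cong_ceq: "(u, v) \<in> word_cong S R \<Longrightarrow> map fst u \<approx> map fst v"
proof (induction rule: word_cong.induct)
  case (sym u v) show ?case by (rule weq_sym[OF sym.IH])
next
  case (trans u v w) show ?case by (rule weq_trans[OF trans.IH])
next
  case (append u u' v v') then show ?case by (simp add: weq_append)
next
  case (cancel s b) then show ?case using cox_cancel by simp
next
  case (relator u v)
  then show ?case using relator_braid by (intro beq_imp_ceq weq_rel) blast
qed simp

lemma beq_word_cong:
  assumes "u \<sim> v" "set u \<subseteq> S" shows "(pos u, pos v) \<in> word_cong S R"
  using assms unfolding weq_def
proof (induction)
  case base
  then show ?case by (simp add: word_cong.refl)
next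
  case (step v w)
  have "set v \<subseteq> S" using beq_set[of u v] step(1,4) by (simp add: weq_def)
  obtain p q l r where *: "v = p @ l @ q" "w = p @ r @ q" "(l, r) \<in> braid_rel m \<or> (r, l) \<in> braid_rel m"
    using step(2) unfolding wstep_def by blast
  have "l \<sim> r" using *(3) weq_rel weq_sym by blast
  then have sets: "set p \<subseteq> S" "set l \<subseteq> S" "set r \<subseteq> S" "set q \<subseteq> S"
    using \<open>set v \<subseteq> S\<close> * beq_set[of l r] by auto
  have "(pos l, pos r) \<in> word_cong S R"
    using *(3) braid_relator sets word_cong.relator[of _ _ R S] word_cong.sym[of _ _ S R] by fastforce
  then have "(pos v, pos w) \<in> word_cong S R" unfolding * pos_append
    using sets by (intro word_cong.append word_cong.refl) simp_all
  then show ?case using step word_cong.trans by blast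
qed

lemma normal_ceq_kernel:
  "{cls S R w |w. w \<in> words S \<and> map fst w \<approx> []} \<lhd> G" (is "?K \<lhd> G")
proof -
  have G: "G = presented_group S R" by (simp add: artin_group_def)
  have "subgroup ?K G"
  proof
    show "?K \<subseteq> carrier G" by (auto simp: G carrier_presented_group)
    show "\<one>\<^bsub>G\<^esub> \<in> ?K" unfolding G one_presented_group by (intro CollectI exI[of _ "[]"]) simp
    fix x y assume "x \<in> ?K" "y \<in> ?K"
    then obtain u v where uv: "x = cls S R u" "y = cls S R v" "u \<in> words S" "v \<in> words S"
      "map fst u \<approx> []" "map fst v \<approx> []" by auto
    then have "map fst (u @ v) \<approx> []" using weq_append[of _ "map fst u" "[]" "map fst v" "[]"] by simp
    then show "x \<otimes>\<^bsub>G\<^esub> y \<in> ?K" using uv unfolding G by (auto simp: mult_presented_group)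
  next
    fix x assume "x \<in> ?K"
    then obtain u where u: "x = cls S R u" "u \<in> words S" "map fst u \<approx> []" by auto
    let ?i = "rev (map (\<lambda>(s, b). (s, \<not> b)) u)"
    have "map fst ?i = rev (map fst u)" by (simp add: rev_map comp_def case_prod_beta)
    then have "map fst ?i \<approx> []" using rev_ceq[OF u(3)] by simp
    moreover have "?i \<in> words S" using u(2) by (auto simp: words_def)
    ultimately show "inv\<^bsub>G\<^esub> x \<in> ?K" unfolding G u(1) inv_presented_group[OF u(2)] by blast
  qed
  moreover have "x \<otimes>\<^bsub>G\<^esub> h \<otimes>\<^bsub>G\<^esub> inv\<^bsub>G\<^esub> x \<in> ?K" if x: "x \<in> carrier G" and h: "h \<in> ?K" for x h
  proof -
    obtain v where v: "x = cls S R v" "v \<in> words S" using x by (auto simp: G carrier_presented_group)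
    obtain u where u: "h = cls S R u" "u \<in> words S" "map fst u \<approx> []" using h by auto
    let ?i = "rev (map (\<lambda>(s, b). (s, \<not> b)) v)"
    have i: "?i \<in> words S" using v(2) by (auto simp: words_def)
    have "map fst ?i = rev (map fst v)" by (simp add: rev_map comp_def case_prod_beta)
    then have "map fst ((v @ u) @ ?i) \<approx> map fst v @ [] @ rev (map fst v)"
      using weq_ctx[OF u(3), of "map fst v" "rev (map fst v)"] by simp
    also have "map fst v @ [] @ rev (map fst v) \<approx> []" using inv_right by simp
    finally have "map fst ((v @ u) @ ?i) \<approx> []" .
    moreover have "x \<otimes>\<^bsub>G\<^esub> h \<otimes>\<^bsub>G\<^esub> inv\<^bsub>G\<^esub> x = cls S R ((v @ u) @ ?i)"
      unfolding G v(1) u(1) inv_presented_group[OF v(2)]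
      using u v i by (simp add: mult_presented_group)
    ultimately show ?thesis using u v i by (intro CollectI exI[of _ "(v @ u) @ ?i"]) simp
  qed
  ultimately show ?thesis unfolding normal_inv_iff by blast
qed

text \<open>The normal closure \<open>N\<close> of the squares lies in the kernel \<open>K\<close>
  of the sign-forgetting map, so reduced words with the same coset are equivalent and have equal
  length. Length is thus a function \<open>F\<close> of the coset, and finitely many cosets allow
  finitely many lengths.\<close>

lemma spherical_bound:
  assumes "spherical_type S M"
  shows "\<exists>L. \<forall>w. reduced w \<longrightarrow> set w \<subseteq> S \<longrightarrow> length w \<le> L"
proof -
  have G: "G = presented_group S R" by (simp add: artin_group_def)
  define Z where "Z = {artin_gen S M s [^]\<^bsub>G\<^esub> (2::nat) | s. s \<in> S}"
  define N where "N = normal_closure G Z"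
  define K where "K = {cls S R w |w. w \<in> words S \<and> map fst w \<approx> []}"
  have gen: "artin_gen S M s = cls S R [(s, True)]" for s by (simp add: artin_gen_def cls_def)
  have "Z \<subseteq> K"
  proof
    fix z assume "z \<in> Z"
    then obtain s where s: "s \<in> S" "z = artin_gen S M s [^]\<^bsub>G\<^esub> (2::nat)" by (auto simp: Z_def)
    have "artin_gen S M s \<in> carrier G" unfolding gen G carrier_presented_group using s by auto
    then have "z = artin_gen S M s \<otimes>\<^bsub>G\<^esub> artin_gen S M s" unfolding s by (simp add: numeral_2_eq_2)
    also have "\<dots> = cls S R [(s, True), (s, True)]" unfolding gen G using s by (simp add: mult_presented_group)
    finally show "z \<in> K" unfolding K_def using s cox_cancel
      by (intro CollectI exI[of _ "[(s, True), (s, True)]"]) simp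
  qed
  then have NK: "N \<subseteq> K" unfolding N_def normal_closure_def using normal_ceq_kernel unfolding K_def by blast
  have oneN: "\<one>\<^bsub>G\<^esub> \<in> N" unfolding N_def normal_closure_def
    by (auto dest!: normal_imp_subgroup subgroup.one_closed)
  have fin: "finite (rcosets\<^bsub>G\<^esub> N)" using assms
    by (simp add: spherical_type_def coxeter_group_def FactGroup_def N_def Z_def)
  define P where "P C n \<longleftrightarrow> (\<exists>w. reduced w \<and> set w \<subseteq> S \<and> n = length w \<and> cls S R (pos w) \<in> C)" for C n
  define F where "F C = (SOME n. P C n)" for C
  have F: "N #>\<^bsub>G\<^esub> cls S R (pos w) \<in> rcosets\<^bsub>G\<^esub> N \<and> length w = F (N #>\<^bsub>G\<^esub> cls S R (pos w))"
    if w: "reduced w" "set w \<subseteq> S" for w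
  proof -
    let ?C = "N #>\<^bsub>G\<^esub> cls S R (pos w)"
    have cw: "cls S R (pos w) \<in> carrier G" using w by (auto simp: G carrier_presented_group)
    have "cls S R (pos w) = \<one>\<^bsub>G\<^esub> \<otimes>\<^bsub>G\<^esub> cls S R (pos w)" using cw by simp
    then have "cls S R (pos w) \<in> ?C" unfolding r_coset_def using oneN by blast
    then have "P ?C (length w)" unfolding P_def using w by blast
    then have "P ?C (F ?C)" unfolding F_def by (rule someI)
    then obtain v where v: "reduced v" "set v \<subseteq> S" "F ?C = length v" "cls S R (pos v) \<in> ?C"
      unfolding P_def by blast
    then obtain k where k: "k \<in> N" "cls S R (pos v) = k \<otimes>\<^bsub>G\<^esub> cls S R (pos w)" by (auto simp: r_coset_def)
    then obtain u where u: "k = cls S R u" "u \<in> words S" "map fst u \<approx> []" using NK by (auto simp: K_def)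
    have "cls S R (pos v) = cls S R (u @ pos w)" using k u w by (simp add: G mult_presented_group)
    then have "(pos v, u @ pos w) \<in> word_cong S R" using u v w by (simp add: cls_eq_iff)
    then have "v \<approx> map fst u @ w" using word_cong_ceq by fastforce
    also have "map fst u @ w \<approx> w" using weq_right[OF u(3), of w] by simp
    finally have "v \<approx> w" .
    then have "length v = length w" using reducedD[OF w(1)] reducedD[OF v(1) weq_sym[OF \<open>v \<approx> w\<close>]]
      \<open>v \<approx> w\<close> by (meson le_antisym)
    moreover have "?C \<in> rcosets\<^bsub>G\<^esub> N" using cw by (auto simp: RCOSETS_def)
    ultimately show ?thesis using v(3) by simp
  qed
  have "length ` {w. reduced w \<and> set w \<subseteq> S} \<subseteq> F ` (rcosets\<^bsub>G\<^esub> N)" using F by blast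
  then have "finite (length ` {w. reduced w \<and> set w \<subseteq> S})" using fin finite_subset by blast
  then obtain L where "\<forall>n\<in>length ` {w. reduced w \<and> set w \<subseteq> S}. n \<le> L"
    unfolding finite_nat_set_iff_bounded_le by blast
  then show ?thesis by blast
qed

end

section \<open>Central fractions and the embedding of the Artin monoid\<close>

locale spherical_artin = artin S M + finite_coxeter "cox_matrix S M" S L
  for S :: "'s set" and M :: "'s \<Rightarrow> 's \<Rightarrow> enat" and L :: nat
begin

text \<open>Conjugation by \<open>lng S\<close> may permute the generators, whereas its square is
  central.\<close>

definition z :: "'s list" where
  "z = lng S @ lng S"

definition zp :: "nat \<Rightarrow> 's list" where
  "zp n = concat (replicate n z)"

text \<open>A positive word for s^-1 \<open>z\<close>, the numerator of s^-1 over the denominator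
  \<open>z\<close>.\<close>

definition star :: "'s \<Rightarrow> 's list" where
  "star s = (SOME v. set v \<subseteq> S \<and> z \<sim> s # v)"

lemma set_z: "set z \<subseteq> S"
  unfolding z_def using lng_set[of S] by simp

lemma set_zp: "set (zp n) \<subseteq> S"
  using set_z by (auto simp: zp_def)

lemma zp_add: "zp (k + l) = zp k @ zp l"
  by (simp add: zp_def replicate_add)

lemma star: assumes "s \<in> S" shows "set (star s) \<subseteq> S" "z \<sim> s # star s"
proof -
  obtain p where p: "lng S \<sim> s # p" "set p \<subseteq> S" using lng_Cons[OF subset_refl assms] by blast
  have "set (p @ lng S) \<subseteq> S \<and> z \<sim> s # (p @ lng S)"
    using weq_right[OF p(1), of "lng S"] p(2) lng_set[of S] by (simp add: z_def)
  then have "set (star s) \<subseteq> S \<and> z \<sim> s # star s" unfolding star_def by (rule someI)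
  then show "set (star s) \<subseteq> S" "z \<sim> s # star s" by blast+
qed

lemma z_central: "set w \<subseteq> S \<Longrightarrow> w @ z \<sim> z @ w"
proof (induction w)
  case (Cons s w)
  then have "w @ z \<sim> z @ w" "s # z \<sim> z @ [s]" using lng_central[of s] by (simp_all add: z_def)
  from weq_trans[OF weq_Cons[OF this(1)]] weq_right[OF this(2), of w] show ?case by simp
qed simp

lemma zp_central: "set w \<subseteq> S \<Longrightarrow> w @ zp n \<sim> zp n @ w"
proof (induction n)
  case (Suc n)
  have "w @ zp (Suc n) \<sim> z @ w @ zp n" using weq_right[OF z_central[OF Suc.prems], of "zp n"] by (simp add: zp_def)
  also have "z @ w @ zp n \<sim> z @ zp n @ w" by (rule weq_left[OF Suc.IH[OF Suc.prems]])
  finally show ?case by (simp add: zp_def)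
qed (simp add: zp_def)

text \<open>As \<open>z\<close> is central and every generator divides \<open>z\<close>, a word in the generators and their
  inverses is represented by the fraction \<open>num u / z\<^sup>c\<close> with \<open>c = cnt u\<close>.\<close>

definition num :: "'s word \<Rightarrow> 's list" where
  "num u = concat (map (\<lambda>(s, b). if b then [s] else star s) u)"

definition cnt :: "'s word \<Rightarrow> nat" where
  "cnt u = length (filter (\<lambda>(s, b). \<not> b) u)"

lemma num_append: "num (u @ v) = num u @ num v"
  by (simp add: num_def)

lemma cnt_append: "cnt (u @ v) = cnt u + cnt v"
  by (simp add: cnt_def)

lemma num_pos: "num (pos w) = w"
  by (induction w) (simp_all add: num_def pos_def)

lemma cnt_pos: "cnt (pos w) = 0"
  by (simp add: cnt_def pos_def)

lemma set_num: "u \<in> words S \<Longrightarrow> set (num u) \<subseteq> S"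
proof (induction u)
  case (Cons x u)
  obtain s b where x: "x = (s, b)" by fastforce
  then have "num (x # u) = (if b then [s] else star s) @ num u" by (simp add: num_def)
  then show ?case using Cons star(1)[of s] x by auto
qed (simp add: num_def)

text \<open>Fractions are compared by cross-multiplication inside the monoid. For positive words
  both counts vanish, and the lemma says that equality in the group already follows from braid
  moves.\<close>

lemma word_cong_fractions:
  assumes "(u, v) \<in> word_cong S R" shows "num u @ zp (cnt v) \<sim> num v @ zp (cnt u)"
  using assms
proof (induction rule: word_cong.induct)
  case (sym u v)
  show ?case by (rule weq_sym[OF sym.IH])
next
  case (trans u v w)
  have w: "u \<in> words S" "v \<in> words S" "w \<in> words S" using word_cong_words trans.hyps by blast+
  have S: "set (num x @ zp k) \<subseteq> S" if "x \<in> words S" for x k using set_num[OF that] set_zp by simp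
  \<comment> \<open>The power belonging to the middle word \<open>v\<close> is moved to the front,
    so that left cancellation can remove it at the end.\<close>
  have "zp (cnt v) @ num u @ zp (cnt w) \<sim> (num u @ zp (cnt w)) @ zp (cnt v)"
    by (rule weq_sym[OF zp_central[OF S[OF w(1)]]])
  also have "(num u @ zp (cnt w)) @ zp (cnt v) = (num u @ zp (cnt v)) @ zp (cnt w)"
    by (simp add: zp_add[symmetric] add.commute)
  also have "\<dots> \<sim> (num v @ zp (cnt u)) @ zp (cnt w)" by (rule weq_right[OF trans.IH(1)])
  also have "(num v @ zp (cnt u)) @ zp (cnt w) = (num v @ zp (cnt w)) @ zp (cnt u)"
    by (simp add: zp_add[symmetric] add.commute)
  also have "\<dots> \<sim> (num w @ zp (cnt v)) @ zp (cnt u)" by (rule weq_right[OF trans.IH(2)])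
  also have "(num w @ zp (cnt v)) @ zp (cnt u) = (num w @ zp (cnt u)) @ zp (cnt v)"
    by (simp add: zp_add[symmetric] add.commute)
  also have "\<dots> \<sim> zp (cnt v) @ num w @ zp (cnt u)" by (rule zp_central[OF S[OF w(3)]])
  finally show ?case by (rule beq_cancel_left[rotated]) (use S[OF w(1)] set_zp in auto)
next
  case (append u u' v v')
  have w: "u \<in> words S" "u' \<in> words S" "v \<in> words S" "v' \<in> words S"
    using word_cong_words append.hyps by blast+
  have "num (u @ v) @ zp (cnt (u' @ v')) = num u @ (num v @ zp (cnt u')) @ zp (cnt v')"
    by (simp add: num_append cnt_append zp_add)
  also have "\<dots> \<sim> num u @ (zp (cnt u') @ num v) @ zp (cnt v')"
    by (rule weq_ctx[OF zp_central[OF set_num[OF w(3)]]])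
  also have "num u @ (zp (cnt u') @ num v) @ zp (cnt v') = (num u @ zp (cnt u')) @ (num v @ zp (cnt v'))" by simp
  also have "\<dots> \<sim> (num u' @ zp (cnt u)) @ (num v' @ zp (cnt v))" by (rule weq_append[OF append.IH])
  also have "(num u' @ zp (cnt u)) @ (num v' @ zp (cnt v)) = num u' @ (zp (cnt u) @ num v') @ zp (cnt v)" by simp
  also have "\<dots> \<sim> num u' @ (num v' @ zp (cnt u)) @ zp (cnt v)"
    by (rule weq_ctx[OF weq_sym[OF zp_central[OF set_num[OF w(4)]]]])
  also have "num u' @ (num v' @ zp (cnt u)) @ zp (cnt v) = num (u' @ v') @ zp (cnt (u @ v))"
    by (simp add: num_append cnt_append zp_add)
  finally show ?case .
next
  case (cancel s b)
  note st = star[OF cancel]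
  have 1: "s # star s \<sim> z" by (rule weq_sym[OF st(2)])
  have "s # star s @ [s] \<sim> z @ [s]" using weq_right[OF 1, of "[s]"] by simp
  also have "z @ [s] \<sim> [s] @ z" by (rule weq_sym[OF z_central]) (use cancel in simp)
  finally have "[s] @ (star s @ [s]) \<sim> [s] @ z" by simp
  then have 2: "star s @ [s] \<sim> z" by (rule beq_cancel_left[rotated]) (use cancel st in auto)
  show ?case by (cases b) (use 1 2 in \<open>simp_all add: num_def cnt_def zp_def\<close>)
next
  case (relator u v)
  then obtain n s t where *: "u = alt_word n s t" "v = alt_word n t s" unfolding artin_relations_def by blast
  have "num u \<sim> num v" using relator_braid[OF relator(1)] unfolding * alt_word_pos num_pos map_fst_pos
    by (rule weq_rel)
  then show ?case unfolding * alt_word_pos cnt_pos by (rule weq_right)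
qed simp

section \<open>The Garside structure of the Artin group\<close>

definition \<gamma> :: "'s list \<Rightarrow> 's word set bijection" where
  "\<gamma> w = left_mult G (cls S R (pos w))"

lemma G_def: "G = presented_group S R"
  by (simp add: artin_group_def)

lemma carrier_G: "carrier G = cls S R ` words S"
  unfolding G_def by (rule carrier_presented_group)

lemma \<gamma>_append: "set u \<subseteq> S \<Longrightarrow> set v \<subseteq> S \<Longrightarrow> \<gamma> (u @ v) = \<gamma> u + \<gamma> v"
  unfolding \<gamma>_def pos_append
  by (subst left_mult_mult[symmetric]) (auto simp: carrier_presented_group G_def mult_presented_group)

lemma \<gamma>_Nil: "\<gamma> [] = 0"
  unfolding \<gamma>_def left_mult_one[symmetric] by (simp add: G_def one_presented_group pos_def)

lemma \<gamma>_eq_iff: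
  assumes "set u \<subseteq> S" "set v \<subseteq> S" shows "\<gamma> u = \<gamma> v \<longleftrightarrow> u \<sim> v"
proof -
  have "\<gamma> u = \<gamma> v \<longleftrightarrow> cls S R (pos u) = cls S R (pos v)"
    unfolding \<gamma>_def using assms by (intro inj_on_eq_iff[OF left_mult_inj]) (auto simp: carrier_G)
  also have "\<dots> \<longleftrightarrow> (pos u, pos v) \<in> word_cong S R" using assms by (simp add: cls_eq_iff)
  also have "\<dots> \<longleftrightarrow> u \<sim> v"
    using word_cong_fractions[of "pos u" "pos v"] beq_word_cong[of u v] assms(1)
    by (auto simp: num_pos cnt_pos zp_def)
  finally show ?thesis .
qed

definition gen :: "'s \<Rightarrow> 's word set bijection" where
  "gen s = \<gamma> [s]"

lemma gen_inj: "inj_on gen S"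
  unfolding gen_def using beq_imp_ceq ceq_singletonD by (intro inj_onI) (auto simp: \<gamma>_eq_iff)

lemma mon_gen_eq: "Y \<subseteq> S \<Longrightarrow> mon (gen ` Y) = \<gamma> ` {w. set w \<subseteq> Y}"
proof (intro equalityI subsetI)
  fix a assume Y: "Y \<subseteq> S" and "a \<in> mon (gen ` Y)"
  from this(2) show "a \<in> \<gamma> ` {w. set w \<subseteq> Y}"
  proof induction
    case zero
    then show ?case using \<gamma>_Nil by (auto intro!: rev_image_eqI[of "[]"])
  next
    case (gen_add s a)
    then obtain t w where tw: "s = gen t" "t \<in> Y" "a = \<gamma> w" "set w \<subseteq> Y" by auto
    then have "set [t] \<subseteq> S" "set w \<subseteq> S" using Y by auto
    then have "s + a = \<gamma> (t # w)" using \<gamma>_append[of "[t]" w] tw by (simp add: gen_def)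
    then show ?case using tw by (intro rev_image_eqI[of "t # w"]) auto
  qed
next
  fix a assume Y: "Y \<subseteq> S" and "a \<in> \<gamma> ` {w. set w \<subseteq> Y}"
  then obtain w where "a = \<gamma> w" "set w \<subseteq> Y" by auto
  moreover have "set w \<subseteq> Y \<Longrightarrow> \<gamma> w \<in> mon (gen ` Y)" for w
  proof (induction w)
    case (Cons t w)
    then have "\<gamma> (t # w) = gen t + \<gamma> w" using Y \<gamma>_append[of "[t]" w] by (auto simp: gen_def)
    then show ?case using Cons by (auto intro: mon.gen_add)
  qed (simp add: \<gamma>_Nil mon.zero)
  ultimately show "a \<in> mon (gen ` Y)" by blast
qed

lemma \<gamma>_mon: "set w \<subseteq> S \<Longrightarrow> \<gamma> w \<in> mon (gen ` S)"
  using mon_gen_eq[OF subset_refl] by blast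

lemma mon_\<gamma>E: assumes "a \<in> mon (gen ` S)" obtains w where "set w \<subseteq> S" "a = \<gamma> w"
  using assms mon_gen_eq[OF subset_refl] by blast

lemma le_\<gamma>_iff:
  assumes "set u \<subseteq> S" "set v \<subseteq> S"
  shows "- \<gamma> u + \<gamma> v \<in> mon (gen ` S) \<longleftrightarrow> (\<exists>p. v \<sim> u @ p)"
proof
  assume "- \<gamma> u + \<gamma> v \<in> mon (gen ` S)"
  then obtain p where p: "set p \<subseteq> S" "- \<gamma> u + \<gamma> v = \<gamma> p" by (rule mon_\<gamma>E)
  have "\<gamma> v = \<gamma> u + (- \<gamma> u + \<gamma> v)" by (simp only: add_minus_cancel)
  then have "\<gamma> v = \<gamma> (u @ p)" using p \<gamma>_append assms by simp
  then show "\<exists>p. v \<sim> u @ p" using \<gamma>_eq_iff[of v "u @ p"] assms p by auto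
next
  assume "\<exists>p. v \<sim> u @ p"
  then obtain p where p: "v \<sim> u @ p" by blast
  then have "set p \<subseteq> S" using beq_set[OF p] assms by auto
  moreover from this have "\<gamma> v = \<gamma> u + \<gamma> p" using p \<gamma>_eq_iff[of v "u @ p"] \<gamma>_append assms by simp
  ultimately show "- \<gamma> u + \<gamma> v \<in> mon (gen ` S)" using \<gamma>_mon by (simp only: minus_add_cancel)
qed

text \<open>The chosen word is arbitrary; braid moves preserve length and letters, so
  \<open>len\<close> and \<open>supp\<close> do not depend on the choice for positive
  elements.\<close>

definition word_of :: "'s word set bijection \<Rightarrow> 's list" where
  "word_of a = (SOME w. set w \<subseteq> S \<and> \<gamma> w = a)"

lemma word_of: assumes "set w \<subseteq> S" shows "word_of (\<gamma> w) \<sim> w"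
proof -
  have "set (word_of (\<gamma> w)) \<subseteq> S \<and> \<gamma> (word_of (\<gamma> w)) = \<gamma> w"
    unfolding word_of_def by (rule someI[of _ w]) (use assms in simp)
  then show ?thesis using \<gamma>_eq_iff assms by blast
qed

definition len :: "'s word set bijection \<Rightarrow> nat" where
  "len a = length (word_of a)"

definition supp :: "'s word set bijection \<Rightarrow> 's word set bijection set" where
  "supp a = gen ` set (word_of a)"

definition D :: "'s word set bijection set \<Rightarrow> 's word set bijection" where
  "D X = \<gamma> (lng {s \<in> S. gen s \<in> X})"

lemma len_\<gamma>: "set w \<subseteq> S \<Longrightarrow> len (\<gamma> w) = length w"
  unfolding len_def by (rule beq_length[OF word_of])

lemma supp_\<gamma>: "set w \<subseteq> S \<Longrightarrow> supp (\<gamma> w) = gen ` set w"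
  unfolding supp_def using beq_set[OF word_of] by simp

lemma D_gen: "Y \<subseteq> S \<Longrightarrow> D (gen ` Y) = \<gamma> (lng Y)"
proof -
  assume "Y \<subseteq> S"
  then have "{s \<in> S. gen s \<in> gen ` Y} = Y" using inj_on_image_mem_iff[OF gen_inj] by blast
  then show ?thesis by (simp add: D_def)
qed

lemma subset_genE: assumes "X \<subseteq> gen ` S" obtains Y where "Y \<subseteq> S" "X = gen ` Y"
  using assms by (auto simp: subset_image_iff)

lemma set_lng: "Y \<subseteq> S \<Longrightarrow> set (lng Y) \<subseteq> S"
  using lng_set by blast

lemma ribbon_word:
  assumes "Y \<subseteq> S"
  obtains r where "lng S \<sim> lng Y @ r" "set r \<subseteq> S" "- D (gen ` Y) + D (gen ` S) = \<gamma> r"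
proof -
  obtain r where r: "lng S \<sim> lng Y @ r" using lng_dvd[OF assms] by blast
  then have rS: "set r \<subseteq> S" using beq_set[OF r] set_lng[of S] by auto
  then have "\<gamma> (lng S) = \<gamma> (lng Y) + \<gamma> r"
    using r \<gamma>_eq_iff[of "lng S" "lng Y @ r"] \<gamma>_append set_lng assms by simp
  then have "- D (gen ` Y) + D (gen ` S) = \<gamma> r"
    unfolding D_gen[OF assms] D_gen[OF subset_refl] by (simp only: minus_add_cancel)
  then show thesis using that r rS by blast
qed

sublocale garside: garside "gen ` S" len supp D "\<lambda>a b. - a + b \<in> mon (gen ` S)"
proof (unfold_locales)
  show "finite (gen ` S)" using data by (simp add: coxeter_data_def)
next
  fix a b assume "a \<in> mon (gen ` S)" "b \<in> mon (gen ` S)"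
  then obtain u v where uv: "set u \<subseteq> S" "a = \<gamma> u" "set v \<subseteq> S" "b = \<gamma> v" by (elim mon_\<gamma>E)
  show "len (a + b) = len a + len b" "supp (a + b) = supp a \<union> supp b"
    using uv by (simp_all add: \<gamma>_append[symmetric] len_\<gamma> supp_\<gamma> image_Un)
  obtain d where d: "\<exists>p. u \<sim> d @ p" "\<exists>p. v \<sim> d @ p"
    "\<forall>e. (\<exists>p. u \<sim> e @ p) \<longrightarrow> (\<exists>p. v \<sim> e @ p) \<longrightarrow> (\<exists>p. d \<sim> e @ p)"
    using gcd_exists[OF uv(1,3)] by blast
  obtain p where "u \<sim> d @ p" using d(1) by blast
  then have dS: "set d \<subseteq> S" using beq_set[of u "d @ p"] uv(1) by simp
  show "\<exists>d\<in>mon (gen ` S). - d + a \<in> mon (gen ` S) \<and> - d + b \<in> mon (gen ` S) \<and>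
    (\<forall>e\<in>mon (gen ` S). - e + a \<in> mon (gen ` S) \<longrightarrow> - e + b \<in> mon (gen ` S) \<longrightarrow> - e + d \<in> mon (gen ` S))"
  proof (intro bexI[of _ "\<gamma> d"] conjI ballI impI)
    show "\<gamma> d \<in> mon (gen ` S)" by (rule \<gamma>_mon[OF dS])
    show "- \<gamma> d + a \<in> mon (gen ` S)" "- \<gamma> d + b \<in> mon (gen ` S)"
      unfolding uv using d le_\<gamma>_iff dS uv by blast+
    fix e assume "e \<in> mon (gen ` S)" and e: "- e + a \<in> mon (gen ` S)" "- e + b \<in> mon (gen ` S)"
    then obtain w where w: "set w \<subseteq> S" "e = \<gamma> w" by (elim mon_\<gamma>E)
    show "- e + \<gamma> d \<in> mon (gen ` S)"
      using e d(3) unfolding w uv le_\<gamma>_iff[OF w(1) uv(1)] le_\<gamma>_iff[OF w(1) uv(3)] le_\<gamma>_iff[OF w(1) dS] by blast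
  qed
next
  fix s assume "s \<in> gen ` S"
  then obtain t where "t \<in> S" "s = \<gamma> [t]" by (auto simp: gen_def)
  then show "len s = 1" "supp s = {s}" by (simp_all add: len_\<gamma> supp_\<gamma>) (simp add: gen_def)
next
  show "supp 0 = {}" using supp_\<gamma>[of "[]"] by (simp add: \<gamma>_Nil)
next
  fix X assume "X \<subseteq> gen ` S"
  then obtain Y where Y: "Y \<subseteq> S" "X = gen ` Y" by (rule subset_genE)
  obtain r where r: "lng S \<sim> lng Y @ r" "set r \<subseteq> S" "- D X + D (gen ` S) = \<gamma> r"
    using ribbon_word[OF Y(1)] unfolding Y(2) by blast
  show "D X \<in> mon X" unfolding Y(2) D_gen[OF Y(1)] mon_gen_eq[OF Y(1)] using lng_set[OF Y(1)] by blast
  show "- D X + D (gen ` S) \<in> mon (gen ` S)" unfolding r(3) by (rule \<gamma>_mon[OF r(2)])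
  {
    fix t assume "t \<in> X"
    then obtain y where y: "y \<in> Y" "t = \<gamma> [y]" using Y by (auto simp: gen_def)
    then have yS: "set [y] \<subseteq> S" using Y by auto
    obtain p where p: "lng Y \<sim> y # p" using lng_Cons[OF Y(1) y(1)] by blast
    show "- t + D X \<in> mon (gen ` S)"
      unfolding y Y(2) D_gen[OF Y(1)] le_\<gamma>_iff[OF yS set_lng[OF Y(1)]] using p by auto
    obtain y' where y': "y' \<in> Y" "y # lng Y \<sim> lng Y @ [y']" using lng_conj[OF Y(1) y(1)] by blast
    have "\<gamma> ([y] @ lng Y) = \<gamma> (lng Y @ [y'])"
      using y' Y yS set_lng[OF Y(1)] by (subst \<gamma>_eq_iff) auto
    then have "t + D X = D X + \<gamma> [y']"
      unfolding Y(2) D_gen[OF Y(1)] y(2) using yS y' Y set_lng[OF Y(1)] by (subst (asm) (1 2) \<gamma>_append) auto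
    then have "cj (D X) t = \<gamma> [y']" unfolding cj_def by (simp only: add.assoc minus_add_cancel)
    then show "cj (D X) t \<in> X" using y' Y by (simp add: gen_def)
    show "\<not> - t + (- D X + D (gen ` S)) \<in> mon (gen ` S)"
      unfolding r(3) y le_\<gamma>_iff[OF yS r(2)] using r_no_descent[OF Y(1) r(1) y(1)] by simp
    fix t' g h assume t': "t' \<in> gen ` S" and gh: "g \<in> mon (gen ` S)" "h \<in> mon (gen ` S)"
      and le: "- g + (- D X + D (gen ` S)) \<in> mon (gen ` S)" "- h + (- D X + D (gen ` S)) \<in> mon (gen ` S)"
      and eq: "t + h = g + t'"
    obtain x where x: "x \<in> S" "t' = \<gamma> [x]" using t' by (auto simp: gen_def)
    obtain u where u: "set u \<subseteq> S" "g = \<gamma> u" using gh(1) by (rule mon_\<gamma>E)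
    obtain v where v: "set v \<subseteq> S" "h = \<gamma> v" using gh(2) by (rule mon_\<gamma>E)
    obtain g' where g': "r \<sim> u @ g'" using le(1) unfolding r(3) u(2) le_\<gamma>_iff[OF u(1) r(2)] by blast
    obtain h' where h': "r \<sim> v @ h'" using le(2) unfolding r(3) v(2) le_\<gamma>_iff[OF v(1) r(2)] by blast
    have "\<gamma> ([y] @ v) = \<gamma> (u @ [x])"
      using eq unfolding y(2) x(2) u(2) v(2) using yS u v x by (subst (1 2) \<gamma>_append) auto
    then have "y # v \<sim> u @ [x]" using \<gamma>_eq_iff[of "[y] @ v" "u @ [x]"] yS u v x by simp
    from r_exchange[OF Y(1) r(1) y(1) g' h' this] show "h = g"
      unfolding u v \<gamma>_eq_iff[OF v(1) u(1)] .
  }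
  fix s assume s: "s \<in> gen ` S" "s \<notin> X"
  then obtain x where x: "x \<in> S" "x \<notin> Y" "s = \<gamma> [x]" using Y by (auto simp: gen_def)
  have xS: "set [x] \<subseteq> S" using x(1) by simp
  show "- s + (- D X + D (gen ` S)) \<in> mon (gen ` S)"
    unfolding r(3) x(3) le_\<gamma>_iff[OF xS r(2)] using r_descent[OF Y(1) r(1) x(1,2)] by simp
qed

end

section \<open>Transfer to parabolic subgroups\<close>

context spherical_artin
begin

lemma artin_gen_cls: "artin_gen S M s = cls S R (pos [s])"
  by (simp add: artin_gen_def cls_def pos_def)

lemma gen_artin_gen: "left_mult G (artin_gen S M s) = gen s"
  by (simp add: gen_def \<gamma>_def artin_gen_cls)

lemma artin_gen_carrier: "s \<in> S \<Longrightarrow> artin_gen S M s \<in> carrier G"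
  unfolding artin_gen_cls carrier_G by (rule imageI) simp

lemma standard_parabolic_subgroup: "X \<subseteq> S \<Longrightarrow> subgroup (standard_parabolic S M X) G"
  unfolding standard_parabolic_def using artin_gen_carrier by (intro generate_is_subgroup) blast

text \<open>One inclusion is an induction over \<open>generate\<close>, possible because left
  fractions are closed under sums and negatives; the other writes numerator and denominator as
  products of generators.\<close>

lemma left_mult_standard_parabolic:
  assumes X: "X \<subseteq> S" shows "left_mult G ` standard_parabolic S M X = grp (gen ` X)"
proof
  have gX: "gen ` X \<subseteq> gen ` S" using X by blast
  have AX: "artin_gen S M ` X \<subseteq> carrier G" using X artin_gen_carrier by blast
  show "left_mult G ` standard_parabolic S M X \<subseteq> grp (gen ` X)"
  proof
    fix a assume "a \<in> left_mult G ` standard_parabolic S M X"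
    then obtain h where h: "h \<in> generate G (artin_gen S M ` X)" "a = left_mult G h"
      by (auto simp: standard_parabolic_def)
    from h(1) have "left_mult G h \<in> grp (gen ` X)"
    proof induction
      case one
      then show ?case by (simp add: left_mult_one)
    next
      case (incl h)
      then obtain x where "x \<in> X" "h = artin_gen S M x" by blast
      then show ?case by (simp add: gen_artin_gen garside.mon_grp mon_gen)
    next
      case (inv h)
      then obtain x where "x \<in> X" "h = artin_gen S M x" by blast
      then have "left_mult G h \<in> grp (gen ` X)" by (simp add: gen_artin_gen garside.mon_grp mon_gen)
      then show ?case using inv AX by (subst left_mult_inv) (auto intro: garside.grp_minus)
    next
      case (eng h1 h2)
      then show ?case using generate_in_carrier[OF AX] garside.grp_add[OF gX]
        by (subst left_mult_mult) auto
    qed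
    then show "a \<in> grp (gen ` X)" using h(2) by simp
  qed
  show "grp (gen ` X) \<subseteq> left_mult G ` standard_parabolic S M X"
  proof
    let ?H = "standard_parabolic S M X"
    note H = standard_parabolic_subgroup[OF X]
    have pos: "\<exists>h\<in>?H. a = left_mult G h" if "a \<in> mon (gen ` X)" for a
      using that
    proof induction
      case zero
      then show ?case using left_mult_one subgroup.one_closed[OF H] by force
    next
      case (gen_add s a)
      then obtain x h where x: "x \<in> X" "s = gen x" and h: "h \<in> ?H" "a = left_mult G h" by blast
      have xH: "artin_gen S M x \<in> ?H" unfolding standard_parabolic_def using x by (intro generate.incl) blast
      have "s + a = left_mult G (artin_gen S M x \<otimes>\<^bsub>G\<^esub> h)"
        unfolding x h gen_artin_gen[symmetric]
        using subgroup.mem_carrier[OF H] xH h by (intro left_mult_mult[symmetric]) auto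
      then show ?case using subgroup.m_closed[OF H xH h(1)] by blast
    qed
    fix a assume "a \<in> grp (gen ` X)"
    then obtain b c where bc: "a = - b + c" "b \<in> mon (gen ` X)" "c \<in> mon (gen ` X)" unfolding grp_def by blast
    obtain g where g: "g \<in> ?H" "b = left_mult G g" using pos bc(2) by blast
    obtain h where h: "h \<in> ?H" "c = left_mult G h" using pos bc(3) by blast
    have gh: "g \<in> carrier G" "h \<in> carrier G" using subgroup.mem_carrier[OF H] g h by auto
    then have "a = left_mult G (inv\<^bsub>G\<^esub> g \<otimes>\<^bsub>G\<^esub> h)"
      unfolding bc g h by (simp add: left_mult_mult left_mult_inv)
    then show "a \<in> left_mult G ` ?H"
      using subgroup.m_closed[OF H subgroup.m_inv_closed[OF H g(1)] h(1)] by blast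
  qed
qed

lemma carrier_standard_parabolic: "carrier G = standard_parabolic S M S"
proof
  note H = standard_parabolic_subgroup[OF subset_refl]
  show "standard_parabolic S M S \<subseteq> carrier G" by (rule subgroup.subset[OF H])
  have "w \<in> words S \<Longrightarrow> cls S R w \<in> standard_parabolic S M S" for w
  proof (induction w)
    case Nil
    then show ?case using subgroup.one_closed[OF H] by (simp add: G_def one_presented_group)
  next
    case (Cons x w)
    obtain s b where x: "x = (s, b)" by fastforce
    have s: "s \<in> S" and w: "w \<in> words S" using Cons.prems x by simp_all
    have g: "artin_gen S M s \<in> standard_parabolic S M S"
      unfolding standard_parabolic_def using s by (intro generate.incl) blast
    have "cls S R [(s, False)] = inv\<^bsub>G\<^esub> artin_gen S M s"
      unfolding artin_gen_cls G_def using s by (subst inv_presented_group) (simp_all add: pos_def)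
    then have "cls S R [x] \<in> standard_parabolic S M S"
      using g subgroup.m_inv_closed[OF H g] x by (cases b) (simp_all add: artin_gen_cls pos_def)
    then have "cls S R [x] \<otimes>\<^bsub>G\<^esub> cls S R w \<in> standard_parabolic S M S"
      using subgroup.m_closed[OF H] Cons.IH[OF w] by blast
    then show ?case using s w x by (simp add: G_def mult_presented_group)
  qed
  then show "carrier G \<subseteq> standard_parabolic S M S" unfolding carrier_G by blast
qed

lemma left_mult_carrier: "left_mult G ` carrier G = grp (gen ` S)"
  unfolding carrier_standard_parabolic by (rule left_mult_standard_parabolic[OF subset_refl])

text \<open>The minus sign appears because \<open>cj u\<close> puts the inverse of \<open>u\<close>
  on the left.\<close>

lemma left_mult_conjugate:
  assumes X: "X \<subseteq> S" and \<beta>: "\<beta> \<in> carrier G"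
  shows "left_mult G ` ((\<beta> <#\<^bsub>G\<^esub> standard_parabolic S M X) #>\<^bsub>G\<^esub> inv\<^bsub>G\<^esub> \<beta>) =
    cj (- left_mult G \<beta>) ` grp (gen ` X)"
proof -
  let ?H = "standard_parabolic S M X"
  have H: "h \<in> carrier G" if "h \<in> ?H" for h
    using subgroup.mem_carrier[OF standard_parabolic_subgroup[OF X] that] .
  have "(\<beta> <#\<^bsub>G\<^esub> ?H) #>\<^bsub>G\<^esub> inv\<^bsub>G\<^esub> \<beta> = (\<lambda>h. \<beta> \<otimes>\<^bsub>G\<^esub> h \<otimes>\<^bsub>G\<^esub> inv\<^bsub>G\<^esub> \<beta>) ` ?H"
    by (auto simp: l_coset_def r_coset_def)
  moreover have "left_mult G (\<beta> \<otimes>\<^bsub>G\<^esub> h \<otimes>\<^bsub>G\<^esub> inv\<^bsub>G\<^esub> \<beta>) = cj (- left_mult G \<beta>) (left_mult G h)" if "h \<in> ?H" for h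
    using H[OF that] \<beta> by (simp add: left_mult_mult left_mult_inv cj_def)
  ultimately show ?thesis unfolding left_mult_standard_parabolic[OF X, symmetric] image_image
    by (simp add: image_image cong: image_cong)
qed

lemma parabolic_subgroup_carrier:
  assumes "parabolic_subgroup S M P" shows "P \<subseteq> carrier G"
proof -
  obtain X \<beta> where X: "X \<subseteq> S" "\<beta> \<in> carrier G"
    and P: "P = (\<beta> <#\<^bsub>G\<^esub> standard_parabolic S M X) #>\<^bsub>G\<^esub> inv\<^bsub>G\<^esub> \<beta>"
    using assms unfolding parabolic_subgroup_def by blast
  show ?thesis unfolding P
    using X subgroup.subset[OF standard_parabolic_subgroup[OF X(1)]]
    by (intro r_coset_subset_G l_coset_subset_G inv_closed)
qed

lemma ex_least_parabolic:
  assumes \<alpha>: "\<alpha> \<in> carrier G"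
  shows "\<exists>P. parabolic_subgroup S M P \<and> \<alpha> \<in> P \<and> (\<forall>Q. parabolic_subgroup S M Q \<longrightarrow> \<alpha> \<in> Q \<longrightarrow> P \<subseteq> Q)"
proof -
  have xG: "left_mult G \<alpha> \<in> grp (gen ` S)" using \<alpha> left_mult_carrier by blast
  obtain X' h where Xh: "X' \<subseteq> gen ` S" "h \<in> grp (gen ` S)" "cj h (left_mult G \<alpha>) \<in> grp X'"
    and least: "\<And>Y k. Y \<subseteq> gen ` S \<Longrightarrow> k \<in> grp (gen ` S) \<Longrightarrow> cj k (left_mult G \<alpha>) \<in> grp Y \<Longrightarrow>
      cj (- h) ` grp X' \<subseteq> cj (- k) ` grp Y"
    using garside.least_parabolic[OF xG] by blast
  obtain X where X: "X \<subseteq> S" "X' = gen ` X" using Xh(1) by (rule subset_genE)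
  obtain \<beta> where \<beta>: "\<beta> \<in> carrier G" "h = left_mult G \<beta>" using Xh(2) left_mult_carrier by blast
  define P where "P = (\<beta> <#\<^bsub>G\<^esub> standard_parabolic S M X) #>\<^bsub>G\<^esub> inv\<^bsub>G\<^esub> \<beta>"
  have P: "parabolic_subgroup S M P" unfolding parabolic_subgroup_def P_def using X(1) \<beta>(1) by blast
  have PC: "P \<subseteq> carrier G" by (rule parabolic_subgroup_carrier[OF P])
  have eP: "left_mult G ` P = cj (- h) ` grp X'"
    unfolding P_def left_mult_conjugate[OF X(1) \<beta>(1)] X(2) \<beta>(2) ..
  have "cj (- h) (cj h (left_mult G \<alpha>)) \<in> left_mult G ` P" unfolding eP using Xh(3) by blast
  then have "left_mult G \<alpha> \<in> left_mult G ` P" by simp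
  then have \<alpha>P: "\<alpha> \<in> P" using inj_on_image_mem_iff[OF left_mult_inj \<alpha> PC] by blast
  have "P \<subseteq> Q" if Q: "parabolic_subgroup S M Q" "\<alpha> \<in> Q" for Q
  proof -
    obtain Y \<kappa> where Y: "Y \<subseteq> S" "\<kappa> \<in> carrier G"
      "Q = (\<kappa> <#\<^bsub>G\<^esub> standard_parabolic S M Y) #>\<^bsub>G\<^esub> inv\<^bsub>G\<^esub> \<kappa>"
      using Q(1) unfolding parabolic_subgroup_def by blast
    have eQ: "left_mult G ` Q = cj (- left_mult G \<kappa>) ` grp (gen ` Y)"
      unfolding Y(3) by (rule left_mult_conjugate[OF Y(1,2)])
    then have "left_mult G \<alpha> \<in> cj (- left_mult G \<kappa>) ` grp (gen ` Y)" using Q(2) by blast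
    then have "cj (left_mult G \<kappa>) (left_mult G \<alpha>) \<in> grp (gen ` Y)" by auto
    then have "cj (- h) ` grp X' \<subseteq> cj (- left_mult G \<kappa>) ` grp (gen ` Y)"
      using Y(1,2) left_mult_carrier by (intro least) blast+
    then have "left_mult G ` P \<subseteq> left_mult G ` Q" unfolding eP eQ .
    then show ?thesis
      using inj_on_image_mem_iff[OF left_mult_inj _ parabolic_subgroup_carrier[OF Q(1)]] PC by blast
  qed
  then show ?thesis using P \<alpha>P by blast
qed

end

theorem theorem1p1:
  fixes S :: "'s set" and m :: "'s \<Rightarrow> 's \<Rightarrow> enat" and \<alpha> :: "'s word set"
  assumes "coxeter_data S m"
    and "spherical_type S m"
    and "\<alpha> \<in> carrier (artin_group S m)"
  shows "\<exists>!P. parabolic_subgroup S m P \<and> \<alpha> \<in> P \<and>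
           (\<forall>Q. parabolic_subgroup S m Q \<and> \<alpha> \<in> Q \<and> Q \<subseteq> P \<longrightarrow> Q = P)"
proof -
  interpret artin S m
    by (intro artin.intro coxeter_cox_matrix artin_axioms.intro assms(1))
  obtain L where "\<forall>w. reduced w \<longrightarrow> set w \<subseteq> S \<longrightarrow> length w \<le> L"
    using spherical_bound[OF assms(2)] by blast
  then interpret spherical_artin S m L by unfold_locales blast
  obtain P where "parabolic_subgroup S m P" "\<alpha> \<in> P"
    "\<And>Q. parabolic_subgroup S m Q \<Longrightarrow> \<alpha> \<in> Q \<Longrightarrow> P \<subseteq> Q"
    using ex_least_parabolic[OF assms(3)] by blast
  \<comment> \<open>A least parabolic subgroup is contained in every minimal one and therefore equal
    to it.\<close>
  then show ?thesis by (intro ex1I[of _ P]) blast+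
qed

end
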